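(* Assume the following. (i) For all $n\in\mathbb{N}^*$, the observation points $X_1,\dots,X_n$ are independent and uniformly distributed on $[0,n^{1/d}]^d$, and $Y$, $(X_1,\dots,X_n)$ and $\epsilon$ are mutually independent. (ii) The covariance function $K_0$ is stationary and continuous on $\mathbb{R}^d$, and there exists $C_0<+\infty$ such that $|K_0(t)|\le \frac{C_0}{1+|t|^{d+1}}$ for all $t\in\mathbb{R}^d$. (iii) For all $\theta\in\Theta$, $K_\theta$ is a stationary covariance function. For all fixed $t\in\mathbb{R}^d$, $K_\theta(t)$ is $p+1$ times continuously differentiable with respect to $\theta$. For all $i_1,\dots,i_p\in\mathbb{N}$ with $i_1+\dots+i_p\le p+1$ there exists $A_{i_1,\dots,i_p}<+\infty$ such that for all $t\in\mathbb{R}^d$, $\theta\in\Theta$, $\left|\frac{\partial^{i_1}}{\partial\theta_1^{i_1}}\cdots\frac{\partial^{i_p}}{\partial\theta_p^{i_p}}K_\theta(t)\right|\le\frac{A_{i_1,\dots,i_p}}{1+|t|^{d+1}}$. There exists a constant $C_{inf}>0$ such that $\delta_\theta\ge C_{inf}$ for all $\theta\in\Theta$. Furthermore $\delta_\theta$ is $p+1$ times continuously differentiable with respect to $\theta$, and for all $i_1,\dots,i_p\in\mathbb{N}$ with $i_1+\dots+i_p\le p+1$ there exists $B_{i_1,\dots,i_p}<+\infty$ such that for all $\theta\in\Theta$, $\left|\frac{\partial^{i_1}}{\partial\theta_1^{i_1}}\cdots\frac{\partial^{i_p}}{\partial\theta_p^{i_p}}\delta_\theta\right|\le B_{i_1,\dots,i_p}$.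 Then, for any sequence of random variables $\hat\theta_{ML}$ with $\hat\theta_{ML}\in\mathrm{argmin}_{\theta\in\Theta}L_\theta$, as $n\to\infty$, $$D_{n,\hat\theta_{ML}}=\inf_{\theta\in\Theta}D_{n,\theta}+o_p(1),$$ where the $o_p(1)$ term is a function of $X$ and $y$ only that goes to $0$ in probability as $n\to\infty$.
   Context: Fix $d,p\in\mathbb{N}^*$ and $\Theta=[\theta_{inf},\theta_{sup}]^p$ with $-\infty<\theta_{inf}<\theta_{sup}<+\infty$. For $t\in\mathbb{R}^d$, $|t|=\max_{i}|t_i|$. $Y$ is a stationary Gaussian process on $\mathbb{R}^d$ with zero mean and covariance function $K_0$, i.e. $\mathrm{Cov}(Y(s),Y(t))=K_0(s-t)$. For each $n$, $X=(X_1,\dots,X_n)$ is the random $n$-tuple of observation points in $\mathbb{R}^d$, $\epsilon=(\epsilon_1,\dots,\epsilon_n)^t\sim\mathcal{N}(0,\delta_0 I_n)$ with $\delta_0\ge 0$, and $y=(y_1,\dots,y_n)^t$ with $y_i=Y(X_i)+\epsilon_i$. The parametric model is $\{(K_\theta,\delta_\theta),\theta\in\Theta\}$ with $K_\theta$ a stationary covariance function on $\mathbb{R}^d$ and $\delta_\theta>0$; it need not contain $(K_0,\delta_0)$. Define the $n\times n$ random matrices $(R_\theta)_{i,j}=K_\theta(X_i-X_j)+\delta_\theta\mathbf{1}_{i=j}$ and $(R_0)_{i,j}=K_0(X_i-X_j)+\delta_0\mathbf{1}_{i=j}$. The modified opposite log-likelihood is $$L_\theta=\frac1n\log(\det(R_\theta))+\frac1n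 y^tR_\theta^{-1}y .$$ The normalized conditional Kullback-Leibler divergence is $$D_{n,\theta}=\frac1n\left\{\log\left(\det(R_\theta R_0^{-1})\right)+\mathrm{Tr}(R_0R_\theta^{-1})\right\}-1 .$$ $L_\theta$ may have several global minimizers. *)

theory Defs
  imports
    "HOL-Probability.Probability"
    "Jordan_Normal_Form.Determinant"
    "Jordan_Normal_Form.Gauss_Jordan_Elimination"
begin

section \<open>Gaussian families and independence\<close>

(* v is the variance; v = 0 gives the Dirac mass at m *)
definition gauss_law :: "real \<Rightarrow> real \<Rightarrow> real measure" where
  "gauss_law m v =
     (if v = 0 then return borel m else density lborel (\<lambda>x. ennreal (normal_density m (sqrt v) x)))"

(* jointly Gaussian, possibly degenerate: a Gaussian process for infinite I,
   a Gaussian vector for finite I *)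
definition gaussian_family :: "'w measure \<Rightarrow> 'i set \<Rightarrow> ('i \<Rightarrow> 'w \<Rightarrow> real) \<Rightarrow> bool" where
  "gaussian_family M I Z \<longleftrightarrow>
     (\<forall>i\<in>I. Z i \<in> borel_measurable M) \<and>
     (\<forall>J a. finite J \<and> J \<subseteq> I \<longrightarrow>
        (\<exists>m v. 0 \<le> v \<and> distr M borel (\<lambda>\<omega>. \<Sum>j\<in>J. a j * Z j \<omega>) = gauss_law m v))"

definition centered_gaussian_family ::
  "'w measure \<Rightarrow> 'i set \<Rightarrow> ('i \<Rightarrow> 'w \<Rightarrow> real) \<Rightarrow> ('i \<Rightarrow> 'i \<Rightarrow> real) \<Rightarrow> bool" where
  "centered_gaussian_family M I Z C \<longleftrightarrow>
     gaussian_family M I Z \<and>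
     (\<forall>i\<in>I. (\<integral>\<omega>. Z i \<omega> \<partial>M) = 0) \<and>
     (\<forall>i\<in>I. \<forall>j\<in>I. (\<integral>\<omega>. Z i \<omega> * Z j \<omega> \<partial>M) = C i j)"

definition family_algebra ::
  "'w measure \<Rightarrow> 'i set \<Rightarrow> ('i \<Rightarrow> 'w \<Rightarrow> 'b::topological_space) \<Rightarrow> 'w measure" where
  "family_algebra M I Z = vimage_algebra (space M) (\<lambda>\<omega>. \<lambda>i\<in>I. Z i \<omega>) (\<Pi>\<^sub>M i\<in>I. borel)"

(* Joint measurability with respect to the sigma-algebra generated by the process itself.  It makes
   Z evaluated at a random point a random variable.  Joint measurability with respect to M would not
   be enough: for U uniform on [0,1], the process Z t = indicator {t = U} is a version of 0 and is
   independent of U, but Z U = 1. *)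
definition measurable_process ::
  "'w measure \<Rightarrow> ('t::topological_space \<Rightarrow> 'w \<Rightarrow> real) \<Rightarrow> bool" where
  "measurable_process M Z \<longleftrightarrow>
     (\<lambda>(t, \<omega>). Z t \<omega>) \<in> borel_measurable (borel \<Otimes>\<^sub>M family_algebra M UNIV Z)"

definition mutually_independent3 ::
  "'w measure \<Rightarrow> 'w measure \<Rightarrow> 'w measure \<Rightarrow> 'w measure \<Rightarrow> bool" where
  "mutually_independent3 M A B C \<longleftrightarrow>
     prob_space.indep_sets M (\<lambda>k::nat. [sets A, sets B, sets C] ! k) {..<3}"

definition tendsto_zero_in_prob :: "'w measure \<Rightarrow> (nat \<Rightarrow> 'w \<Rightarrow> real) \<Rightarrow> bool" where
  "tendsto_zero_in_prob M r \<longleftrightarrow>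
     (\<forall>n\<ge>1. r n \<in> borel_measurable M) \<and>
     (\<forall>e>0. (\<lambda>n. measure M {\<omega>\<in>space M. \<bar>r n \<omega>\<bar> > e}) \<longlonglongrightarrow> 0)"

section \<open>Covariance functions and differentiability in the parameter\<close>

definition stationary_covariance :: "('a::real_vector \<Rightarrow> real) \<Rightarrow> bool" where
  "stationary_covariance k \<longleftrightarrow>
     (\<forall>t. k (- t) = k t) \<and>
     (\<forall>T a. finite T \<longrightarrow> (\<Sum>s\<in>T. \<Sum>t\<in>T. a s * a t * k (s - t)) \<ge> 0)"

(* the line through x in the direction of coordinate i, as far as it stays in S; partial
   derivatives are therefore one-sided on the boundary of a box *)
definition line_in :: "(real^'p::finite) set \<Rightarrow> 'p \<Rightarrow> real^'p \<Rightarrow> real set" where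
  "line_in S i x = {h. x + h *\<^sub>R axis i 1 \<in> S}"

definition partial_on ::
  "(real^'p::finite) set \<Rightarrow> 'p \<Rightarrow> (real^'p \<Rightarrow> real) \<Rightarrow> real^'p \<Rightarrow> real" where
  "partial_on S i f x =
     vector_derivative (\<lambda>h. f (x + h *\<^sub>R axis i 1)) (at 0 within line_in S i x)"

definition partials_on ::
  "(real^'p::finite) set \<Rightarrow> 'p list \<Rightarrow> (real^'p \<Rightarrow> real) \<Rightarrow> real^'p \<Rightarrow> real" where
  "partials_on S js f = foldr (partial_on S) js f"

primrec cont_diff_on ::
  "nat \<Rightarrow> (real^'p::finite) set \<Rightarrow> (real^'p \<Rightarrow> real) \<Rightarrow> bool" where
  "cont_diff_on 0 S f \<longleftrightarrow> continuous_on S f"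
| "cont_diff_on (Suc k) S f \<longleftrightarrow>
     continuous_on S f \<and>
     (\<forall>i. (\<forall>x\<in>S. (\<lambda>h. f (x + h *\<^sub>R axis i 1)) differentiable (at 0 within line_in S i x)) \<and>
          cont_diff_on k S (partial_on S i f))"

(* The coordinate type is unordered, so the partial derivative for the multi-index \<alpha> is taken
   along every list of coordinates in which each i occurs \<alpha> i times; for functions that are
   cont_diff_on of order at least |\<alpha>| on a box, all these agree by Schwarz's theorem. *)
definition multi_index_list :: "('p \<Rightarrow> nat) \<Rightarrow> 'p list \<Rightarrow> bool" where
  "multi_index_list \<alpha> js \<longleftrightarrow> (\<forall>i. count_list js i = \<alpha> i)"

section \<open>Likelihood and Kullback-Leibler divergence\<close>

(* observation points are indexed by 0, ..., n - 1 *)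
definition cov_matrix ::
  "('a::minus \<Rightarrow> real) \<Rightarrow> real \<Rightarrow> nat \<Rightarrow> (nat \<Rightarrow> 'a) \<Rightarrow> real mat" where
  "cov_matrix k \<delta> n x = mat n n (\<lambda>(i, j). k (x i - x j) + (if i = j then \<delta> else 0))"

(* 0 for a singular matrix *)
definition mat_inv :: "real mat \<Rightarrow> real mat" where
  "mat_inv A = (case mat_inverse A of Some B \<Rightarrow> B | None \<Rightarrow> 0\<^sub>m (dim_row A) (dim_col A))"

definition mat_trace :: "real mat \<Rightarrow> real" where
  "mat_trace A = (\<Sum>i<dim_row A. A $$ (i, i))"

definition neg_log_lik ::
  "('q \<Rightarrow> 'a::minus \<Rightarrow> real) \<Rightarrow> ('q \<Rightarrow> real) \<Rightarrow> nat \<Rightarrow> (nat \<Rightarrow> 'a) \<Rightarrow> (nat \<Rightarrow> real) \<Rightarrow> 'q \<Rightarrow> real" where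
  "neg_log_lik K \<delta> n x y \<theta> =
     (let R = cov_matrix (K \<theta>) (\<delta> \<theta>) n x; v = Matrix.vec n y
      in 1 / real n * ln (Determinant.det R) + 1 / real n * scalar_prod v (mat_inv R *\<^sub>v v))"

definition kl_div ::
  "('q \<Rightarrow> 'a::minus \<Rightarrow> real) \<Rightarrow> ('q \<Rightarrow> real) \<Rightarrow> ('a \<Rightarrow> real) \<Rightarrow> real \<Rightarrow>
   nat \<Rightarrow> (nat \<Rightarrow> 'a) \<Rightarrow> 'q \<Rightarrow> real" where
  "kl_div K \<delta> K0 \<delta>0 n x \<theta> =
     (let R = cov_matrix (K \<theta>) (\<delta> \<theta>) n x; R0 = cov_matrix K0 \<delta>0 n x
      in 1 / real n * (ln (Determinant.det (R * mat_inv R0)) + mat_trace (R0 * mat_inv R)) - 1)"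

definition obs_value ::
  "('a \<Rightarrow> 'w \<Rightarrow> real) \<Rightarrow> (nat \<Rightarrow> 'w \<Rightarrow> 'a) \<Rightarrow> (nat \<Rightarrow> 'w \<Rightarrow> real) \<Rightarrow> nat \<Rightarrow> 'w \<Rightarrow> real" where
  "obs_value Y X \<epsilon> i \<omega> = Y (X i \<omega>) \<omega> + \<epsilon> i \<omega>"

definition function_of_data ::
  "'w measure \<Rightarrow> nat \<Rightarrow> (nat \<Rightarrow> 'w \<Rightarrow> 'a::topological_space) \<Rightarrow> (nat \<Rightarrow> 'w \<Rightarrow> real) \<Rightarrow>
   ('w \<Rightarrow> 'b::topological_space) \<Rightarrow> bool" where
  "function_of_data M n X y f \<longleftrightarrow>
     (\<exists>g \<in> borel_measurable ((\<Pi>\<^sub>M i\<in>{..<n}. borel) \<Otimes>\<^sub>M (\<Pi>\<^sub>M i\<in>{..<n}. borel)).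
        \<forall>\<omega>\<in>space M. f \<omega> = g (\<lambda>i\<in>{..<n}. X i \<omega>, \<lambda>i\<in>{..<n}. y i \<omega>))"

end

theory Submission
  imports Defs "HOL-Real_Asymp.Real_Asymp"
begin

text \<open>
  Write W for the likelihood minus its conditional expectation given the observation points.
  The log-determinants cancel in W, and D differs from L - W by a term that does not depend
  on the parameter, so the excess of D at a minimiser of L is at most twice the supremum of
  |W|. At a fixed parameter W is a centred quadratic form in a Gaussian vector, whose second
  moment is at most a constant times the expected squared Frobenius norm of the true covariance
  matrix divided by the square of n, hence of order 1 / n. By the resolvent identity and the
  Schur test, the modulus of continuity of W in the parameter is controlled by the largest row sum
  of the decay function over the observation points; exponential moments of these row sums show that
  the largest one is of order log n with high probability. Chebyshev's inequality on a grid of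
  polylogarithmic size then suffices.

  Without a nugget the true covariance matrix has to be shown to be almost surely invertible. A
  vanishing quadratic form at distinct points yields a linear relation between translates of the
  covariance function, so the product of its Fourier transform with a nonzero exponential polynomial
  vanishes; hence the Fourier transform vanishes, and integrating it against shrinking Gaussians gives
  K0(0) = 0. In that last case the divergence does not depend on the parameter at all.
\<close>

text \<open>The points are not separated, so the row sums of the covariance matrices admit no
  deterministic bound independent of n; what is bounded uniformly is the inverse of the model
  matrix, through the lower bound on the nugget. The estimates are arranged around this. At a fixed
  parameter the variance is controlled by the Frobenius norm of the true covariance matrix, whose
  square has mean of order n although single rows may be long. The largest row sum enters only
  multiplied by the mesh of the grid, so a bound of order log n costs no more than a finer mesh:
  with row sums at most 2 ln n, mean square of the observations at most ln n and mesh of order (ln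
  n)^-3, the oscillation between grid points tends to 0, while about (ln n)^(3p) grid points are
  harmless against a variance of order 1/n. Conditioning on the points is replaced by a product
  decomposition: the observations are jointly measurable in a deterministic design and in the
  sigma-algebra of process and noise, which is independent of the points. Invertibility of the true
  covariance matrix enters where the logarithm in the divergence is split.\<close>

section \<open>Determinants and inverses of covariance matrices\<close>

text \<open>For a singular matrix both sides are 0, since 1 / 0 = 0.\<close>

lemma mat_inv_eq_adj:
  assumes A: "A \<in> carrier_mat n n"
  shows "mat_inv A = (1 / Determinant.det A) \<cdot>\<^sub>m adj_mat A"
proof (cases "Determinant.det A = 0")
  case True
  have "mat_inverse A = None"
  proof (rule ccontr)
    assume "mat_inverse A \<noteq> None"
    then obtain B where "mat_inverse A = Some B" by auto
    from mat_inverse(2)[OF A this] have B: "A * B = 1\<^sub>m n" "B \<in> carrier_mat n n" by auto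
    have "Determinant.det A * Determinant.det B = 1"
      using det_mult[OF A B(2)] B(1) by simp
    then show False using True by simp
  qed
  then show ?thesis using True A adj_mat(1)[OF A] by (auto simp: mat_inv_def)
next
  case False
  define C where "C = (1 / Determinant.det A) \<cdot>\<^sub>m adj_mat A"
  have C: "C \<in> carrier_mat n n" using adj_mat(1)[OF A] by (simp add: C_def)
  have AC: "A * C = 1\<^sub>m n"
    using adj_mat(1,2)[OF A] A False by (auto simp: C_def mult_smult_distrib)
  have CA: "C * A = 1\<^sub>m n" by (rule mat_mult_left_right_inverse[OF A C AC])
  have "A \<in> Units (ring_mat TYPE(real) n ())"
    using A C AC CA by (auto simp: Units_def ring_mat_def)
  then obtain B where B0: "mat_inverse A = Some B" using mat_inverse(1)[OF A] by fastforce
  from mat_inverse(2)[OF A this] have B: "A * B = 1\<^sub>m n" "B \<in> carrier_mat n n" by auto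
  have "B = (C * A) * B" using B CA by simp
  also have "\<dots> = C * (A * B)" using A B C by (simp add: assoc_mult_mat)
  also have "\<dots> = C" using B C by simp
  finally have "B = C" .
  then show ?thesis using B0 by (simp add: mat_inv_def C_def)
qed

lemma mat_inv_carrier [simp]: "A \<in> carrier_mat n n \<Longrightarrow> mat_inv A \<in> carrier_mat n n"
  using adj_mat(1)[of A n] by (simp add: mat_inv_eq_adj)

lemma mat_inv_mult:
  assumes A: "A \<in> carrier_mat n n" and d: "Determinant.det A \<noteq> 0"
  shows "A * mat_inv A = 1\<^sub>m n" "mat_inv A * A = 1\<^sub>m n"
proof -
  show 1: "A * mat_inv A = 1\<^sub>m n"
    using adj_mat(1,2)[OF A] A d by (auto simp: mat_inv_eq_adj[OF A] mult_smult_distrib)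
  show "mat_inv A * A = 1\<^sub>m n"
    by (rule mat_mult_left_right_inverse[OF A _ 1]) (use A in simp)
qed

text \<open>A property of an entry function, not of a matrix: quadratic forms become finite double
  sums and no carrier conditions arise. Symmetry is kept apart and comes from stationarity through
  \<open>cov_entry_sym\<close>.\<close>

definition pos_def_on :: "nat \<Rightarrow> (nat \<Rightarrow> nat \<Rightarrow> real) \<Rightarrow> bool" where
  "pos_def_on n F \<longleftrightarrow> (\<forall>w. (\<exists>i<n. w i \<noteq> 0) \<longrightarrow> (\<Sum>i<n. \<Sum>j<n. w i * w j * F i j) > 0)"

lemma det_nonzero_of_pos_def:
  assumes "pos_def_on n F"
  shows "Determinant.det (Matrix.mat n n (\<lambda>(i, j). F i j)) \<noteq> 0"
proof
  let ?A = "Matrix.mat n n (\<lambda>(i, j). F i j)"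
  assume "Determinant.det ?A = 0"
  then obtain v where v: "v \<in> carrier_vec n" "v \<noteq> 0\<^sub>v n" "?A *\<^sub>v v = 0\<^sub>v n"
    using det_0_iff_vec_prod_zero[of ?A n] by auto
  define w where "w = (\<lambda>i. vec_index v i)"
  have "\<exists>i<n. w i \<noteq> 0"
  proof (rule ccontr)
    assume "\<not> ?thesis"
    then have "v = 0\<^sub>v n" using v(1) by (intro eq_vecI) (auto simp: w_def)
    then show False using v(2) by simp
  qed
  moreover have "(\<Sum>j<n. F i j * w j) = 0" if "i < n" for i
  proof -
    have "vec_index (?A *\<^sub>v v) i = 0" using v(3) that by simp
    then show ?thesis using that v(1)
      by (simp add: scalar_prod_def w_def atLeast0LessThan)
  qed
  then have "(\<Sum>i<n. \<Sum>j<n. w i * w j * F i j) = 0"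
    by (simp add: mult.assoc mult.commute[of "w _" "F _ _"] sum_distrib_left[symmetric])
  ultimately show False using assms unfolding pos_def_on_def by fastforce
qed

text \<open>Leibniz formula with the entries taken from \<open>f\<close> directly: a permutation of
  {0..<n} never leaves the range where the matrix agrees with \<open>f\<close>. As a polynomial in
  the entries the determinant inherits continuity and measurability.\<close>

lemma det_mat_expand:
  "Determinant.det (Matrix.mat n n (\<lambda>(i, j). f i j)) =
    (\<Sum>p | p permutes {0..<n}. signof p * (\<Prod>i = 0..<n. f i (p i)))"
  by (subst det_def'[of _ n])
    (auto intro!: sum.cong prod.cong arg_cong2[where f = "(*)"] dest: permutes_in_image)

lemma continuous_on_det:
  assumes "\<And>i j. i < n \<Longrightarrow> j < n \<Longrightarrow> continuous_on S (\<lambda>t. F t i j)"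
  shows "continuous_on S (\<lambda>t. Determinant.det (Matrix.mat n n (\<lambda>(i, j). F t i j)) :: real)"
  unfolding det_mat_expand
  by (intro continuous_intros assms) (auto dest: permutes_in_image)

lemma borel_measurable_det:
  assumes "\<And>i j. i < n \<Longrightarrow> j < n \<Longrightarrow> (\<lambda>t. F t i j) \<in> borel_measurable N"
  shows "(\<lambda>t. Determinant.det (Matrix.mat n n (\<lambda>(i, j). F t i j)) :: real) \<in> borel_measurable N"
  unfolding det_mat_expand
  by (intro borel_measurable_sum borel_measurable_times borel_measurable_const
      borel_measurable_prod assms) (auto dest: permutes_in_image)

text \<open>The segment from the identity matrix to \<^term>\<open>F\<close> consists of positive definite matrices, so the
  determinant keeps its sign along it.\<close>

lemma det_pos_of_pos_def:
  assumes F: "pos_def_on n F"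
  shows "Determinant.det (Matrix.mat n n (\<lambda>(i, j). F i j)) > 0"
proof -
  define B where "B t i j = (1 - t) * (if i = j then 1 else 0) + t * F i j" for t :: real and i j :: nat
  define d where "d t = Determinant.det (Matrix.mat n n (\<lambda>(i, j). B t i j))" for t
  have B: "pos_def_on n (B t)" if t: "0 \<le> t" "t \<le> 1" for t
    unfolding pos_def_on_def
  proof (intro allI impI)
    fix w :: "nat \<Rightarrow> real" assume w: "\<exists>i<n. w i \<noteq> 0"
    have "(\<Sum>i<n. \<Sum>j<n. w i * w j * B t i j) =
        (\<Sum>i<n. \<Sum>j<n. (if i = j then (1 - t) * (w i * w j) else 0) + t * (w i * w j * F i j))"
      unfolding B_def by (intro sum.cong refl) (auto simp: algebra_simps)
    also have "\<dots> = (1 - t) * (\<Sum>i<n. (w i)\<^sup>2) + t * (\<Sum>i<n. \<Sum>j<n. w i * w j * F i j)"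
      by (simp add: sum.distrib sum_distrib_left sum.delta' power2_eq_square)
    finally have eq: "(\<Sum>i<n. \<Sum>j<n. w i * w j * B t i j) = \<dots>" .
    have "(\<Sum>i<n. (w i)\<^sup>2) > 0" using w by (auto intro!: sum_pos2)
    moreover have "(\<Sum>i<n. \<Sum>j<n. w i * w j * F i j) > 0" using F w unfolding pos_def_on_def by blast
    ultimately show "(\<Sum>i<n. \<Sum>j<n. w i * w j * B t i j) > 0"
      unfolding eq using t by (cases "t = 1") (auto intro!: add_pos_nonneg mult_pos_pos)
  qed
  have nz: "d t \<noteq> 0" if "0 \<le> t" "t \<le> 1" for t
    unfolding d_def by (intro det_nonzero_of_pos_def B that)
  have cont: "continuous_on {0..1} d"
    unfolding d_def by (intro continuous_on_det) (auto simp: B_def intro!: continuous_intros)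
  have "Matrix.mat n n (\<lambda>(i, j). B 0 i j) = 1\<^sub>m n" by (auto simp: B_def)
  then have d0: "d 0 = 1" by (simp add: d_def)
  have "d 1 > 0"
  proof (rule ccontr)
    assume "\<not> d 1 > 0"
    then have "\<exists>t\<ge>0. t \<le> 1 \<and> d t = 0"
      using IVT2'[of d 1 0 0] cont d0 by auto
    then show False using nz by blast
  qed
  moreover have "B 1 = F" by (intro ext) (simp add: B_def)
  ultimately show ?thesis by (simp add: d_def)
qed

text \<open>\<open>stationary_covariance\<close> sums over a set of points, so each point occurs
  once. A family \<open>x\<close> may repeat points; the weights of coinciding indices are added up
  in \<open>a\<close>.\<close>

lemma stationary_covariance_psd:
  assumes k: "stationary_covariance k" and I: "finite I"
  shows "(\<Sum>i\<in>I. \<Sum>j\<in>I. w i * w j * k (x i - x j)) \<ge> 0"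
proof -
  define a where "a s = (\<Sum>i | i \<in> I \<and> x i = s. w i)" for s
  have "(\<Sum>i\<in>I. \<Sum>j\<in>I. w i * w j * k (x i - x j)) =
    (\<Sum>s\<in>x ` I. \<Sum>i | i \<in> I \<and> x i = s. \<Sum>t\<in>x ` I. \<Sum>j | j \<in> I \<and> x j = t. w i * w j * k (x i - x j))"
    by (subst sum.image_gen[OF I, where g = x], intro sum.cong refl, subst sum.image_gen[OF I, where g = x]) simp
  also have "\<dots> = (\<Sum>s\<in>x ` I. \<Sum>i | i \<in> I \<and> x i = s. \<Sum>t\<in>x ` I. \<Sum>j | j \<in> I \<and> x j = t. w i * w j * k (s - t))"
    by (intro sum.cong refl) auto
  also have "\<dots> = (\<Sum>s\<in>x ` I. \<Sum>t\<in>x ` I. \<Sum>i | i \<in> I \<and> x i = s. \<Sum>j | j \<in> I \<and> x j = t. w i * w j * k (s - t))"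
    by (intro sum.cong refl sum.swap)
  also have "\<dots> = (\<Sum>s\<in>x ` I. \<Sum>t\<in>x ` I. a s * a t * k (s - t))"
    unfolding a_def sum_product by (simp add: sum_distrib_right)
  also have "\<dots> \<ge> 0" using k I by (auto simp: stationary_covariance_def)
  finally show ?thesis .
qed

section \<open>Covariance and precision matrices entry by entry\<close>

definition cov_entry :: "('a::minus \<Rightarrow> real) \<Rightarrow> real \<Rightarrow> (nat \<Rightarrow> 'a) \<Rightarrow> nat \<Rightarrow> nat \<Rightarrow> real" where
  "cov_entry k \<delta> x i j = k (x i - x j) + (if i = j then \<delta> else 0)"

definition prec_entry ::
  "('a::minus \<Rightarrow> real) \<Rightarrow> real \<Rightarrow> nat \<Rightarrow> (nat \<Rightarrow> 'a) \<Rightarrow> nat \<Rightarrow> nat \<Rightarrow> real" where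
  "prec_entry k \<delta> n x i j = mat_inv (cov_matrix k \<delta> n x) $$ (i, j)"

lemma cov_matrix_eq: "cov_matrix k \<delta> n x = Matrix.mat n n (\<lambda>(i, j). cov_entry k \<delta> x i j)"
  by (simp add: cov_matrix_def cov_entry_def)

lemma cov_matrix_carrier [simp]: "cov_matrix k \<delta> n x \<in> carrier_mat n n"
  by (simp add: cov_matrix_def)

lemma stationary_covariance_even: "stationary_covariance k \<Longrightarrow> k (- t) = k t"
  by (simp add: stationary_covariance_def)

lemma cov_entry_sym: "stationary_covariance k \<Longrightarrow> cov_entry k \<delta> x i j = cov_entry k \<delta> x j i"
  using stationary_covariance_even[of k "x j - x i"] by (simp add: cov_entry_def)

lemma quadratic_cov_entry:
  "(\<Sum>i<n. \<Sum>j<n. w i * w j * cov_entry k \<delta> x i j) =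
   (\<Sum>i<n. \<Sum>j<n. w i * w j * k (x i - x j)) + \<delta> * (\<Sum>i<n. (w i)\<^sup>2)"
proof -
  have "(\<Sum>i<n. \<Sum>j<n. w i * w j * cov_entry k \<delta> x i j) =
    (\<Sum>i<n. \<Sum>j<n. w i * w j * k (x i - x j) + (if i = j then \<delta> * (w i)\<^sup>2 else 0))"
    by (intro sum.cong refl) (auto simp: cov_entry_def algebra_simps power2_eq_square)
  then show ?thesis by (simp add: sum.distrib sum_distrib_left)
qed

text \<open>The kernel part of the form is nonnegative, so the nugget bounds the spectrum from below
  whatever the design. The uniform bound \<open>prec_entry_bound\<close> on the inverse rests on
  this.\<close>

lemma quadratic_cov_entry_ge:
  assumes "stationary_covariance k"
  shows "(\<Sum>i<n. \<Sum>j<n. w i * w j * cov_entry k \<delta> x i j) \<ge> \<delta> * (\<Sum>i<n. (w i)\<^sup>2)"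
  using stationary_covariance_psd[OF assms, of "{..<n}" w x] by (simp add: quadratic_cov_entry)

lemma pos_def_cov_entry:
  assumes "stationary_covariance k" "\<delta> > 0"
  shows "pos_def_on n (cov_entry k \<delta> x)"
  unfolding pos_def_on_def
proof (intro allI impI)
  fix w :: "nat \<Rightarrow> real" assume w: "\<exists>i<n. w i \<noteq> 0"
  then have "(\<Sum>i<n. (w i)\<^sup>2) > 0" by (auto intro!: sum_pos2)
  then have "0 < \<delta> * (\<Sum>i<n. (w i)\<^sup>2)" using assms by simp
  also note quadratic_cov_entry_ge[OF assms(1)]
  finally show "0 < (\<Sum>i<n. \<Sum>j<n. w i * w j * cov_entry k \<delta> x i j)" .
qed

lemma det_cov_matrix_pos:
  "pos_def_on n (cov_entry k \<delta> x) \<Longrightarrow> Determinant.det (cov_matrix k \<delta> n x) > 0"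
  unfolding cov_matrix_eq by (rule det_pos_of_pos_def)

lemma prec_entry_inverse:
  assumes "pos_def_on n (cov_entry k \<delta> x)" "i < n" "j < n"
  shows "(\<Sum>l<n. cov_entry k \<delta> x i l * prec_entry k \<delta> n x l j) = (if i = j then 1 else 0)"
    and "(\<Sum>l<n. prec_entry k \<delta> n x i l * cov_entry k \<delta> x l j) = (if i = j then 1 else 0)"
proof -
  let ?A = "cov_matrix k \<delta> n x"
  have d: "dim_row (mat_inv ?A) = n" "dim_col (mat_inv ?A) = n" by (metis carrier_matD mat_inv_carrier cov_matrix_carrier)+
  have d': "dim_row ?A = n" "dim_col ?A = n" by (simp_all add: cov_matrix_def)
  have e: "i < n \<Longrightarrow> j < n \<Longrightarrow> ?A $$ (i, j) = cov_entry k \<delta> x i j" for i j by (simp add: cov_matrix_eq)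
  note inv = mat_inv_mult[of ?A n, OF _ less_imp_neq[OF det_cov_matrix_pos[OF assms(1)], symmetric]]
  have "(?A * mat_inv ?A) $$ (i, j) = (if i = j then 1 else 0)"
    using assms by (subst inv(1)) auto
  then show "(\<Sum>l<n. cov_entry k \<delta> x i l * prec_entry k \<delta> n x l j) = (if i = j then 1 else 0)"
    using assms(2,3) by (simp add: d d' scalar_prod_def prec_entry_def e atLeast0LessThan)
  have "(mat_inv ?A * ?A) $$ (i, j) = (if i = j then 1 else 0)"
    using assms by (subst inv(2)) auto
  then show "(\<Sum>l<n. prec_entry k \<delta> n x i l * cov_entry k \<delta> x l j) = (if i = j then 1 else 0)"
    using assms(2,3) by (simp add: d d' scalar_prod_def prec_entry_def e atLeast0LessThan)
qed

lemma sum_delta_mult: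
  fixes f :: "nat \<Rightarrow> real"
  assumes "j < n"
  shows "(\<Sum>l<n. f l * (if l = j then 1 else 0)) = f j" "(\<Sum>l<n. (if j = l then 1 else 0) * f l) = f j"
proof -
  have "(\<Sum>l<n. f l * (if l = j then 1 else 0)) = (\<Sum>l<n. if l = j then f l else 0)"
    by (intro sum.cong refl) simp
  also have "\<dots> = f j" using assms by simp
  finally show "(\<Sum>l<n. f l * (if l = j then 1 else 0)) = f j" .
  moreover have "(\<Sum>l<n. f l * (if l = j then 1 else 0)) = (\<Sum>l<n. (if j = l then 1 else 0) * f l)"
    by (intro sum.cong refl) simp
  ultimately show "(\<Sum>l<n. (if j = l then 1 else 0) * f l) = f j" by simp
qed

text \<open>With P the inverse of R: P = P (P R)^T = (P R) P^T = P^T, where the middle step uses the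
  symmetry of R.\<close>

lemma prec_entry_sym:
  assumes k: "stationary_covariance k" and pd: "pos_def_on n (cov_entry k \<delta> x)" and ij: "i < n" "j < n"
  shows "prec_entry k \<delta> n x i j = prec_entry k \<delta> n x j i"
proof -
  let ?P = "prec_entry k \<delta> n x" and ?R = "cov_entry k \<delta> x"
  have "?P i j = (\<Sum>l<n. ?P i l * (if l = j then 1 else 0))" using ij by (simp only: sum_delta_mult)
  also have "\<dots> = (\<Sum>l<n. ?P i l * (\<Sum>m<n. ?P j m * ?R m l))"
    using ij by (intro sum.cong refl) (auto simp: prec_entry_inverse(2)[OF pd])
  also have "\<dots> = (\<Sum>l<n. \<Sum>m<n. ?P i l * ?R l m * ?P j m)"
    unfolding sum_distrib_left
  proof (intro sum.cong refl)
    fix l m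
    show "?P i l * (?P j m * ?R m l) = ?P i l * ?R l m * ?P j m"
      using cov_entry_sym[OF k, of \<delta> x l m] by simp
  qed
  also have "\<dots> = (\<Sum>m<n. (\<Sum>l<n. ?P i l * ?R l m) * ?P j m)"
    by (subst sum.swap) (simp add: sum_distrib_right)
  also have "\<dots> = (\<Sum>m<n. (if i = m then 1 else 0) * ?P j m)"
    using ij by (intro sum.cong refl) (auto simp: prec_entry_inverse(2)[OF pd])
  also have "\<dots> = ?P j i" using ij by (simp only: sum_delta_mult)
  finally show ?thesis .
qed

text \<open>For w = P v one has R w = v, hence c |w|^2 \<le> <w, v>; expanding |c w - v|^2 \<ge> 0
  then yields c^2 |w|^2 \<le> |v|^2, in place of the Cauchy-Schwarz inequality. In other words, the
  inverse has operator norm at most 1 / c.\<close>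

lemma prec_entry_bound:
  assumes k: "stationary_covariance k" and c: "0 < c" "c \<le> \<delta>"
  shows "(\<Sum>i<n. (\<Sum>j<n. prec_entry k \<delta> n x i j * v j)\<^sup>2) \<le> (\<Sum>i<n. (v i)\<^sup>2) / c\<^sup>2"
proof -
  let ?P = "prec_entry k \<delta> n x" and ?R = "cov_entry k \<delta> x"
  have pd: "pos_def_on n ?R" using k c by (intro pos_def_cov_entry) auto
  define w where "w i = (\<Sum>j<n. ?P i j * v j)" for i
  have v: "(\<Sum>j<n. ?R i j * w j) = v i" if i: "i < n" for i
  proof -
    have "(\<Sum>j<n. ?R i j * w j) = (\<Sum>j<n. \<Sum>l<n. ?R i j * ?P j l * v l)"
      by (simp add: w_def sum_distrib_left ac_simps)
    also have "\<dots> = (\<Sum>l<n. (\<Sum>j<n. ?R i j * ?P j l) * v l)"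
      by (subst sum.swap) (simp add: sum_distrib_right)
    also have "\<dots> = (\<Sum>l<n. (if i = l then 1 else 0) * v l)"
      using i by (intro sum.cong refl) (auto simp: prec_entry_inverse(1)[OF pd])
    also have "\<dots> = v i" using i by (simp only: sum_delta_mult)
    finally show ?thesis .
  qed
  have "c * (\<Sum>i<n. (w i)\<^sup>2) \<le> \<delta> * (\<Sum>i<n. (w i)\<^sup>2)"
    using c by (intro mult_right_mono sum_nonneg) auto
  also have "\<dots> \<le> (\<Sum>i<n. \<Sum>j<n. w i * w j * ?R i j)" by (rule quadratic_cov_entry_ge[OF k])
  also have "\<dots> = (\<Sum>i<n. w i * (\<Sum>j<n. ?R i j * w j))"
    by (simp add: sum_distrib_left ac_simps)
  also have "\<dots> = (\<Sum>i<n. w i * v i)" by (simp add: v)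
  finally have 1: "c * (\<Sum>i<n. (w i)\<^sup>2) \<le> (\<Sum>i<n. w i * v i)" .
  have "0 \<le> (\<Sum>i<n. (c * w i - v i)\<^sup>2)" by (intro sum_nonneg) auto
  also have "\<dots> = c\<^sup>2 * (\<Sum>i<n. (w i)\<^sup>2) - 2 * c * (\<Sum>i<n. w i * v i) + (\<Sum>i<n. (v i)\<^sup>2)"
    by (simp add: power2_diff sum.distrib sum_subtractf sum_distrib_left power_mult_distrib ac_simps)
  also have "\<dots> \<le> c\<^sup>2 * (\<Sum>i<n. (w i)\<^sup>2) - 2 * c * (c * (\<Sum>i<n. (w i)\<^sup>2)) + (\<Sum>i<n. (v i)\<^sup>2)"
    using mult_left_mono[OF 1, of "2 * c"] c by simp
  also have "\<dots> = (\<Sum>i<n. (v i)\<^sup>2) - c\<^sup>2 * (\<Sum>i<n. (w i)\<^sup>2)"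
    by (simp add: power2_eq_square algebra_simps)
  finally have "c\<^sup>2 * (\<Sum>i<n. (w i)\<^sup>2) \<le> (\<Sum>i<n. (v i)\<^sup>2)" by simp
  then show ?thesis using c by (simp add: w_def field_simps)
qed

text \<open>Expanding the right-hand side, A R' A' collapses to A and A R A' to A'. The change of
  the inverse is thereby expressed through the change of the matrix, which is what the Lipschitz
  bounds control.\<close>

lemma resolvent_identity:
  fixes R R' A A' :: "nat \<Rightarrow> nat \<Rightarrow> real"
  assumes AR: "\<And>i j. i < n \<Longrightarrow> j < n \<Longrightarrow> (\<Sum>l<n. A i l * R l j) = (if i = j then 1 else 0)"
    and RA': "\<And>i j. i < n \<Longrightarrow> j < n \<Longrightarrow> (\<Sum>l<n. R' i l * A' l j) = (if i = j then 1 else 0)"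
    and ij: "i < n" "j < n"
  shows "A i j - A' i j = (\<Sum>k<n. \<Sum>l<n. A i k * (R' k l - R k l) * A' l j)"
proof -
  have "(\<Sum>k<n. \<Sum>l<n. A i k * (R' k l - R k l) * A' l j) =
      (\<Sum>k<n. A i k * (\<Sum>l<n. R' k l * A' l j)) - (\<Sum>k<n. \<Sum>l<n. A i k * R k l * A' l j)"
    by (simp add: sum_distrib_left sum_subtractf[symmetric] algebra_simps)
  also have "(\<Sum>k<n. \<Sum>l<n. A i k * R k l * A' l j) = (\<Sum>l<n. (\<Sum>k<n. A i k * R k l) * A' l j)"
    by (subst sum.swap) (simp add: sum_distrib_right)
  also have "\<dots> = (\<Sum>l<n. (if i = l then 1 else 0) * A' l j)"
    using ij by (intro sum.cong refl) (auto simp: AR)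
  also have "\<dots> = A' i j" using ij by (simp only: sum_delta_mult)
  also have "(\<Sum>k<n. A i k * (\<Sum>l<n. R' k l * A' l j)) = (\<Sum>k<n. A i k * (if k = j then 1 else 0))"
    using ij by (intro sum.cong refl) (auto simp: RA')
  also have "\<dots> = A i j" using ij by (simp only: sum_delta_mult)
  finally show ?thesis by simp
qed

text \<open>Splitting |u_i v_j| into (u_i^2 + v_j^2) / 2 leaves a row sum in front of each u_i^2 and
  a column sum in front of each v_j^2. Row sums are the quantity that can be bounded for a random
  design.\<close>

lemma schur_test:
  fixes E :: "nat \<Rightarrow> nat \<Rightarrow> real"
  assumes row: "\<And>i. i < n \<Longrightarrow> (\<Sum>j<n. \<bar>E i j\<bar>) \<le> \<rho>" and col: "\<And>j. j < n \<Longrightarrow> (\<Sum>i<n. \<bar>E i j\<bar>) \<le> \<rho>"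
  shows "\<bar>\<Sum>i<n. \<Sum>j<n. u i * E i j * v j\<bar> \<le> \<rho> / 2 * ((\<Sum>i<n. (u i)\<^sup>2) + (\<Sum>i<n. (v i)\<^sup>2))"
proof -
  have "\<bar>\<Sum>i<n. \<Sum>j<n. u i * E i j * v j\<bar> \<le> (\<Sum>i<n. \<Sum>j<n. \<bar>u i * E i j * v j\<bar>)"
    by (intro order_trans[OF sum_abs] sum_mono) auto
  also have "\<dots> \<le> (\<Sum>i<n. \<Sum>j<n. \<bar>E i j\<bar> / 2 * (u i)\<^sup>2 + \<bar>E i j\<bar> / 2 * (v j)\<^sup>2)"
  proof (intro sum_mono)
    fix i j
    have "\<bar>u i\<bar> * \<bar>v j\<bar> \<le> ((u i)\<^sup>2 + (v j)\<^sup>2) / 2"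
      using sum_squares_bound[of "\<bar>u i\<bar>" "\<bar>v j\<bar>"] by simp
    from mult_left_mono[OF this, of "\<bar>E i j\<bar>"]
    show "\<bar>u i * E i j * v j\<bar> \<le> \<bar>E i j\<bar> / 2 * (u i)\<^sup>2 + \<bar>E i j\<bar> / 2 * (v j)\<^sup>2"
      by (simp add: abs_mult algebra_simps)
  qed
  also have "\<dots> = (\<Sum>i<n. (\<Sum>j<n. \<bar>E i j\<bar>) * ((u i)\<^sup>2 / 2)) + (\<Sum>i<n. \<Sum>j<n. \<bar>E i j\<bar> * ((v j)\<^sup>2 / 2))"
    unfolding sum.distrib sum_distrib_right by (simp add: ac_simps)
  also have "(\<Sum>i<n. \<Sum>j<n. \<bar>E i j\<bar> * ((v j)\<^sup>2 / 2)) = (\<Sum>j<n. (\<Sum>i<n. \<bar>E i j\<bar>) * ((v j)\<^sup>2 / 2))"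
    unfolding sum_distrib_right by (rule sum.swap)
  also have "(\<Sum>i<n. (\<Sum>j<n. \<bar>E i j\<bar>) * ((u i)\<^sup>2 / 2)) \<le> (\<Sum>i<n. \<rho> * ((u i)\<^sup>2 / 2))"
    by (intro sum_mono mult_right_mono row) auto
  also have "(\<Sum>j<n. (\<Sum>i<n. \<bar>E i j\<bar>) * ((v j)\<^sup>2 / 2)) \<le> (\<Sum>j<n. \<rho> * ((v j)\<^sup>2 / 2))"
    by (intro sum_mono mult_right_mono col) auto
  finally show ?thesis by (simp add: sum_distrib_left sum_divide_distrib distrib_left ac_simps)
qed

lemma sum_swap4:
  fixes f :: "'a \<Rightarrow> 'b \<Rightarrow> 'c \<Rightarrow> 'd \<Rightarrow> 'e::comm_monoid_add"
  shows "(\<Sum>i\<in>A. \<Sum>j\<in>B. \<Sum>a\<in>C. \<Sum>b\<in>D. f i j a b) = (\<Sum>a\<in>C. \<Sum>b\<in>D. \<Sum>i\<in>A. \<Sum>j\<in>B. f i j a b)"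
proof -
  have "(\<Sum>i\<in>A. \<Sum>j\<in>B. \<Sum>a\<in>C. \<Sum>b\<in>D. f i j a b) = (\<Sum>i\<in>A. \<Sum>a\<in>C. \<Sum>j\<in>B. \<Sum>b\<in>D. f i j a b)"
    by (intro sum.cong refl sum.swap)
  also have "\<dots> = (\<Sum>a\<in>C. \<Sum>i\<in>A. \<Sum>j\<in>B. \<Sum>b\<in>D. f i j a b)" by (rule sum.swap)
  also have "\<dots> = (\<Sum>a\<in>C. \<Sum>i\<in>A. \<Sum>b\<in>D. \<Sum>j\<in>B. f i j a b)"
    by (intro sum.cong refl sum.swap)
  also have "\<dots> = (\<Sum>a\<in>C. \<Sum>b\<in>D. \<Sum>i\<in>A. \<Sum>j\<in>B. f i j a b)"
    by (intro sum.cong refl sum.swap)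
  finally show ?thesis .
qed

text \<open>By the resolvent identity the form is u^T (R' - R) v with u = P z and v = P' z, where
  symmetry of P moves it onto z. The Schur test applies with row sums alone, since R' - R is
  symmetric, and both |u| and |v| are at most |z| / c.\<close>

lemma quadratic_prec_diff:
  assumes k: "stationary_covariance k" "stationary_covariance k'"
    and c: "0 < c" "c \<le> \<delta>" "c \<le> \<delta>'"
    and row: "\<And>i. i < n \<Longrightarrow> (\<Sum>j<n. \<bar>cov_entry k' \<delta>' x i j - cov_entry k \<delta> x i j\<bar>) \<le> \<rho>"
  shows "\<bar>\<Sum>i<n. \<Sum>j<n. z i * z j * (prec_entry k \<delta> n x i j - prec_entry k' \<delta>' n x i j)\<bar>
    \<le> \<rho> / c\<^sup>2 * (\<Sum>i<n. (z i)\<^sup>2)"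
proof (cases "n = 0")
  case False
  let ?R = "cov_entry k \<delta> x" and ?R' = "cov_entry k' \<delta>' x"
  let ?P = "prec_entry k \<delta> n x" and ?P' = "prec_entry k' \<delta>' n x"
  have pd: "pos_def_on n ?R" "pos_def_on n ?R'" using k c by (auto intro!: pos_def_cov_entry)
  define u v where "u i = (\<Sum>j<n. ?P i j * z j)" and "v i = (\<Sum>j<n. ?P' i j * z j)" for i
  \<comment> \<open>Read off from row 0, which exists because n is positive here.\<close>
  have "\<rho> \<ge> 0" using order_trans[OF sum_nonneg row[of 0]] False by simp
  have "(\<Sum>i<n. \<Sum>j<n. z i * z j * (?P i j - ?P' i j)) =
      (\<Sum>i<n. \<Sum>j<n. z i * z j * (\<Sum>a<n. \<Sum>b<n. ?P i a * (?R' a b - ?R a b) * ?P' b j))"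
    using resolvent_identity[of n ?P ?R ?R' ?P', OF prec_entry_inverse(2)[OF pd(1)] prec_entry_inverse(1)[OF pd(2)]]
    by (intro sum.cong refl) simp
  also have "\<dots> = (\<Sum>i<n. \<Sum>j<n. \<Sum>a<n. \<Sum>b<n. z i * z j * (?P i a * (?R' a b - ?R a b) * ?P' b j))"
    unfolding sum_distrib_left ..
  also have "\<dots> = (\<Sum>a<n. \<Sum>b<n. \<Sum>i<n. \<Sum>j<n. z i * z j * (?P i a * (?R' a b - ?R a b) * ?P' b j))"
    by (rule sum_swap4)
  also have "\<dots> = (\<Sum>a<n. \<Sum>b<n. u a * (?R' a b - ?R a b) * v b)"
  proof (intro sum.cong refl)
    fix a b assume "a \<in> {..<n}" "b \<in> {..<n}"
    then have "(\<Sum>i<n. ?P i a * z i) = u a"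
      unfolding u_def by (intro sum.cong refl) (metis lessThan_iff prec_entry_sym[OF k(1) pd(1)])
    then have "u a * (?R' a b - ?R a b) * v b = (\<Sum>i<n. ?P i a * z i) * ((?R' a b - ?R a b) * (\<Sum>j<n. ?P' b j * z j))"
      by (simp add: v_def)
    also have "\<dots> = (\<Sum>i<n. \<Sum>j<n. z i * z j * (?P i a * (?R' a b - ?R a b) * ?P' b j))"
      unfolding sum_distrib_left sum_distrib_right by (subst sum.swap) (simp add: ac_simps)
    finally show "(\<Sum>i<n. \<Sum>j<n. z i * z j * (?P i a * (?R' a b - ?R a b) * ?P' b j)) =
       u a * (?R' a b - ?R a b) * v b" by simp
  qed
  also have "\<bar>\<dots>\<bar> \<le> \<rho> / 2 * ((\<Sum>i<n. (u i)\<^sup>2) + (\<Sum>i<n. (v i)\<^sup>2))"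
  proof (rule schur_test[OF row])
    fix j assume j: "j < n"
    have "(\<Sum>i<n. \<bar>?R' i j - ?R i j\<bar>) = (\<Sum>i<n. \<bar>?R' j i - ?R j i\<bar>)"
      by (intro sum.cong refl) (metis cov_entry_sym[OF k(1)] cov_entry_sym[OF k(2)])
    also have "\<dots> \<le> \<rho>" using row[OF j] .
    finally show "(\<Sum>i<n. \<bar>?R' i j - ?R i j\<bar>) \<le> \<rho>" .
  qed
  also have "\<dots> \<le> \<rho> / 2 * ((\<Sum>i<n. (z i)\<^sup>2) / c\<^sup>2 + (\<Sum>i<n. (z i)\<^sup>2) / c\<^sup>2)"
    unfolding u_def v_def using \<open>\<rho> \<ge> 0\<close>
    by (intro mult_left_mono add_mono prec_entry_bound k c) auto
  finally show ?thesis by simp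
qed simp

section \<open>Likelihood and divergence in terms of entries\<close>

text \<open>What remains of the difference between the likelihood and its conditional expectation once the
  log-determinants have cancelled.\<close>

definition fluct :: "nat \<Rightarrow> (nat \<Rightarrow> nat \<Rightarrow> real) \<Rightarrow> (nat \<Rightarrow> nat \<Rightarrow> real) \<Rightarrow> (nat \<Rightarrow> real) \<Rightarrow> real" where
  "fluct n A R z = 1 / real n * (\<Sum>i<n. \<Sum>j<n. A i j * (z i * z j - R i j))"

lemma neg_log_lik_eq:
  "neg_log_lik K \<delta> n x y \<theta> = 1 / real n * ln (Determinant.det (cov_matrix (K \<theta>) (\<delta> \<theta>) n x)) +
     1 / real n * (\<Sum>i<n. \<Sum>j<n. prec_entry (K \<theta>) (\<delta> \<theta>) n x i j * (y i * y j))"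
proof -
  let ?A = "cov_matrix (K \<theta>) (\<delta> \<theta>) n x"
  have d: "dim_row (mat_inv ?A) = n" "dim_col (mat_inv ?A) = n" by (metis carrier_matD mat_inv_carrier cov_matrix_carrier)+
  show ?thesis unfolding neg_log_lik_def Let_def
    by (simp add: scalar_prod_def d prec_entry_def atLeast0LessThan sum_distrib_left ac_simps)
qed

lemma kl_div_eq:
  "kl_div K \<delta> K0 \<delta>0 n x \<theta> =
     1 / real n * (ln (Determinant.det (cov_matrix (K \<theta>) (\<delta> \<theta>) n x) * Determinant.det (mat_inv (cov_matrix K0 \<delta>0 n x)))
        + (\<Sum>i<n. \<Sum>j<n. cov_entry K0 \<delta>0 x i j * prec_entry (K \<theta>) (\<delta> \<theta>) n x j i)) - 1"
proof -
  let ?A = "cov_matrix (K \<theta>) (\<delta> \<theta>) n x" and ?B = "cov_matrix K0 \<delta>0 n x"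
  have d: "dim_row (mat_inv ?A) = n" "dim_col (mat_inv ?A) = n" by (metis carrier_matD mat_inv_carrier cov_matrix_carrier)+
  have d': "dim_row ?B = n" "dim_col ?B = n" by (simp_all add: cov_matrix_def)
  have e: "i < n \<Longrightarrow> j < n \<Longrightarrow> ?B $$ (i, j) = cov_entry K0 \<delta>0 x i j" for i j by (simp add: cov_matrix_eq)
  have "Determinant.det (?A * mat_inv ?B) = Determinant.det ?A * Determinant.det (mat_inv ?B)"
    by (rule det_mult[OF cov_matrix_carrier mat_inv_carrier[OF cov_matrix_carrier]])
  then show ?thesis unfolding kl_div_def Let_def
    by (simp add: mat_trace_def scalar_prod_def d d' e prec_entry_def atLeast0LessThan)
qed

text \<open>The value 0 of \<open>mat_inv\<close> at a singular matrix is compatible with 1 / 0 = 0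
  as soon as n is positive. Both cases together give \<open>det_mat_inv_cov\<close>, so the
  divergence can be treated as a function of the design without excluding singular matrices.\<close>

lemma det_mat_inv:
  assumes A: "A \<in> carrier_mat n n"
  shows "n > 0 \<Longrightarrow> Determinant.det A = 0 \<Longrightarrow> Determinant.det (mat_inv A) = 0"
    and "Determinant.det A \<noteq> 0 \<Longrightarrow> Determinant.det (mat_inv A) = 1 / Determinant.det A"
proof -
  have c: "dim_col (adj_mat A) = n" using adj_mat(1)[OF A] by auto
  {
    assume n: "n > 0" and d: "Determinant.det A = 0"
    have "Determinant.det (mat_inv A) = (1 / Determinant.det A) ^ n * Determinant.det (adj_mat A)"
      unfolding mat_inv_eq_adj[OF A] det_smult c ..
    also have "\<dots> = 0" unfolding d using n by simp
    finally show "Determinant.det (mat_inv A) = 0" .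
  }
  {
    assume d: "Determinant.det A \<noteq> 0"
    have "Determinant.det A * Determinant.det (mat_inv A) = Determinant.det (1\<^sub>m n)"
      unfolding det_mult[OF A mat_inv_carrier[OF A], symmetric] mat_inv_mult(1)[OF A d] ..
    also have "\<dots> = 1" by (rule det_one)
    finally show "Determinant.det (mat_inv A) = 1 / Determinant.det A"
      using d by (metis mult.commute nonzero_eq_divide_eq)
  }
qed

text \<open>Each divergence is likelihood minus fluctuation minus the same number ln (det R0) / n +
  1, with the trace rewritten by symmetry of R0. The identity is deterministic and holds for every
  vector \<open>y\<close>; positive definiteness of R0 serves to split the logarithm of det R / det
  R0.\<close>

lemma kl_div_diff:
  assumes n: "n \<ge> 1"
    and R: "pos_def_on n (cov_entry (K \<theta>) (\<delta> \<theta>) x)" "pos_def_on n (cov_entry (K \<theta>') (\<delta> \<theta>') x)"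
    and R0: "pos_def_on n (cov_entry K0 \<delta>0 x)" and K0: "stationary_covariance K0"
  shows "kl_div K \<delta> K0 \<delta>0 n x \<theta> - kl_div K \<delta> K0 \<delta>0 n x \<theta>' =
    neg_log_lik K \<delta> n x y \<theta> - neg_log_lik K \<delta> n x y \<theta>'
    - (fluct n (prec_entry (K \<theta>) (\<delta> \<theta>) n x) (cov_entry K0 \<delta>0 x) y
       - fluct n (prec_entry (K \<theta>') (\<delta> \<theta>') n x) (cov_entry K0 \<delta>0 x) y)"
proof -
  have *: "kl_div K \<delta> K0 \<delta>0 n x \<theta> = neg_log_lik K \<delta> n x y \<theta>
      - fluct n (prec_entry (K \<theta>) (\<delta> \<theta>) n x) (cov_entry K0 \<delta>0 x) y
      - 1 / real n * ln (Determinant.det (cov_matrix K0 \<delta>0 n x)) - 1"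
    if R: "pos_def_on n (cov_entry (K \<theta>) (\<delta> \<theta>) x)" for \<theta>
  proof -
    let ?d = "Determinant.det (cov_matrix (K \<theta>) (\<delta> \<theta>) n x)" and ?e = "Determinant.det (cov_matrix K0 \<delta>0 n x)"
    have d: "?d > 0" "?e > 0" using R R0 by (simp_all add: det_cov_matrix_pos)
    have e: "Determinant.det (mat_inv (cov_matrix K0 \<delta>0 n x)) = 1 / ?e"
      by (rule det_mat_inv(2)[OF cov_matrix_carrier less_imp_neq[OF d(2), symmetric]])
    have ln_ratio: "ln (a * b) = ln a - ln c" if "b = 1 / c" "a > 0" "c > 0" for a b c :: real
      using that by (simp add: ln_div)
    have 1: "ln (?d * Determinant.det (mat_inv (cov_matrix K0 \<delta>0 n x))) = ln ?d - ln ?e"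
      by (rule ln_ratio[OF e d])
    have 2: "(\<Sum>i<n. \<Sum>j<n. cov_entry K0 \<delta>0 x i j * prec_entry (K \<theta>) (\<delta> \<theta>) n x j i) =
        (\<Sum>i<n. \<Sum>j<n. prec_entry (K \<theta>) (\<delta> \<theta>) n x i j * cov_entry K0 \<delta>0 x i j)"
    proof (subst sum.swap, intro sum.cong refl)
      fix i j
      show "cov_entry K0 \<delta>0 x j i * prec_entry (K \<theta>) (\<delta> \<theta>) n x i j =
          prec_entry (K \<theta>) (\<delta> \<theta>) n x i j * cov_entry K0 \<delta>0 x i j"
        using cov_entry_sym[OF K0, of \<delta>0 x i j] by simp
    qed
    have 3: "fluct n (prec_entry (K \<theta>) (\<delta> \<theta>) n x) (cov_entry K0 \<delta>0 x) y =
       1 / real n * (\<Sum>i<n. \<Sum>j<n. prec_entry (K \<theta>) (\<delta> \<theta>) n x i j * (y i * y j))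
       - 1 / real n * (\<Sum>i<n. \<Sum>j<n. prec_entry (K \<theta>) (\<delta> \<theta>) n x i j * cov_entry K0 \<delta>0 x i j)"
      by (simp only: fluct_def right_diff_distrib sum_subtractf)
    show ?thesis unfolding kl_div_eq neg_log_lik_eq 1 2 3 right_diff_distrib distrib_left by linarith
  qed
  show ?thesis unfolding *[OF R(1)] *[OF R(2)] by linarith
qed

section \<open>Moments of Gaussian families\<close>

text \<open>\<open>has_bochner_integral\<close> keeps integrability together with the value. The
  Dirac law, v = 0, obeys the same formulas, so degenerate vectors are covered from here on.\<close>

lemma gauss_law_moments:
  assumes "0 \<le> v"
  shows "has_bochner_integral (gauss_law m v) (\<lambda>x. x - m) 0"
    and "has_bochner_integral (gauss_law m v) (\<lambda>x. (x - m) ^ 2) v"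
    and "has_bochner_integral (gauss_law m v) (\<lambda>x. (x - m) ^ 4) (3 * v\<^sup>2)"
proof -
  have ret: "has_bochner_integral (return borel m) f (f m)" if "f \<in> borel_measurable borel" for f :: "real \<Rightarrow> real"
    using that by (auto simp: has_bochner_integral_iff integral_return integrable_iff_bounded nn_integral_return)
  have den: "has_bochner_integral (density lborel (\<lambda>x. ennreal (normal_density m (sqrt v) x))) f y"
    if "has_bochner_integral lborel (\<lambda>x. normal_density m (sqrt v) x * f x) y" "f \<in> borel_measurable borel"
    for f :: "real \<Rightarrow> real" and y
    using that by (intro has_bochner_integral_density) auto
  have 1: "has_bochner_integral (gauss_law m v) f y"
    if "v > 0 \<Longrightarrow> has_bochner_integral lborel (\<lambda>x. normal_density m (sqrt v) x * f x) y"
      "v = 0 \<Longrightarrow> y = f m" "f \<in> borel_measurable borel"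
    for f :: "real \<Rightarrow> real" and y
  proof (cases "v = 0")
    case True
    then show ?thesis using ret[OF that(3)] that(2) by (simp add: gauss_law_def)
  next
    case False
    then have "v > 0" using assms by simp
    then show ?thesis using den[OF that(1) that(3)] False by (simp add: gauss_law_def)
  qed
  show "has_bochner_integral (gauss_law m v) (\<lambda>x. x - m) 0"
    using normal_moment_odd[of "sqrt v" m 0] by (intro 1) auto
  show "has_bochner_integral (gauss_law m v) (\<lambda>x. (x - m) ^ 2) v"
    using normal_moment_even[of "sqrt v" m 1] by (intro 1) (auto simp: fact_numeral)
  \<comment> \<open>Fourth moment of a normal variable: 4! / (2^2 2!) = 3 in front of v^2.\<close>
  have "fact (2 * 2) / ((2 / (sqrt v)\<^sup>2) ^ 2 * fact 2) = 3 * v\<^sup>2"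
    using assms by (simp add: fact_numeral power_divide)
  then show "has_bochner_integral (gauss_law m v) (\<lambda>x. (x - m) ^ 4) (3 * v\<^sup>2)"
    using normal_moment_even[of "sqrt v" m 2] by (intro 1) auto
qed

lemma gaussian_moments:
  assumes d: "distr M borel Z = gauss_law m v" and v: "0 \<le> v" and Z: "Z \<in> borel_measurable M"
  shows "has_bochner_integral M (\<lambda>\<omega>. Z \<omega> - m) 0"
    and "has_bochner_integral M (\<lambda>\<omega>. (Z \<omega> - m) ^ 2) v"
    and "has_bochner_integral M (\<lambda>\<omega>. (Z \<omega> - m) ^ 4) (3 * v\<^sup>2)"
  using gauss_law_moments[OF v, of m, folded d] Z
  by (simp_all add: has_bochner_integral_iff integrable_distr_eq integral_distr)

context prob_space
begin

lemma integrable_mult_of_squares: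
  fixes f g :: "'a \<Rightarrow> real"
  assumes "integrable M (\<lambda>\<omega>. (f \<omega>)\<^sup>2)" "integrable M (\<lambda>\<omega>. (g \<omega>)\<^sup>2)"
    "f \<in> borel_measurable M" "g \<in> borel_measurable M"
  shows "integrable M (\<lambda>\<omega>. f \<omega> * g \<omega>)"
proof (rule Bochner_Integration.integrable_bound)
  show "integrable M (\<lambda>\<omega>. (f \<omega>)\<^sup>2 + (g \<omega>)\<^sup>2)" using assms by auto
  show "AE \<omega> in M. norm (f \<omega> * g \<omega>) \<le> norm ((f \<omega>)\<^sup>2 + (g \<omega>)\<^sup>2)"
  proof (intro AE_I2)
    fix \<omega>
    have "\<bar>f \<omega>\<bar> * \<bar>g \<omega>\<bar> \<le> (f \<omega>)\<^sup>2 + (g \<omega>)\<^sup>2"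
      using sum_squares_bound[of "\<bar>f \<omega>\<bar>" "\<bar>g \<omega>\<bar>"] mult_nonneg_nonneg[OF abs_ge_zero abs_ge_zero, of "f \<omega>" "g \<omega>"]
      unfolding mult.assoc power2_abs by linarith
    then show "norm (f \<omega> * g \<omega>) \<le> norm ((f \<omega>)\<^sup>2 + (g \<omega>)\<^sup>2)" by (simp add: abs_mult)
  qed
qed (use assms in auto)

lemma integrable_power_le_4:
  fixes f :: "'a \<Rightarrow> real"
  assumes "integrable M (\<lambda>\<omega>. f \<omega> ^ 4)" "f \<in> borel_measurable M" "k \<le> 4"
  shows "integrable M (\<lambda>\<omega>. f \<omega> ^ k)"
proof (rule Bochner_Integration.integrable_bound)
  show "integrable M (\<lambda>\<omega>. 1 + f \<omega> ^ 4)" using assms by auto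
  show "AE \<omega> in M. norm (f \<omega> ^ k) \<le> norm (1 + f \<omega> ^ 4)"
  proof (intro AE_I2)
    fix \<omega>
    have "\<bar>f \<omega>\<bar> ^ k \<le> 1 + \<bar>f \<omega>\<bar> ^ 4"
    proof (cases "\<bar>f \<omega>\<bar> \<le> 1")
      case True
      then have "\<bar>f \<omega>\<bar> ^ k \<le> 1" by (simp add: power_le_one)
      moreover have "0 \<le> \<bar>f \<omega>\<bar> ^ 4" by simp
      ultimately show ?thesis by linarith
    next
      case False
      then have "\<bar>f \<omega>\<bar> ^ k \<le> \<bar>f \<omega>\<bar> ^ 4" using assms(3) by (intro power_increasing) auto
      then show ?thesis by simp
    qed
    then show "norm (f \<omega> ^ k) \<le> norm (1 + f \<omega> ^ 4)" by (simp add: power_abs)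
  qed
qed (use assms in auto)

text \<open>The moments of order 1, 2 and 4 of linear combinations, with the values they have for a
  centred Gaussian vector. This much passes to sums of independent vectors by multiplying out, so Y
  + \<epsilon> never has to be identified as Gaussian.\<close>

definition gaussian_moments_4 :: "nat \<Rightarrow> (nat \<Rightarrow> 'a \<Rightarrow> real) \<Rightarrow> (nat \<Rightarrow> nat \<Rightarrow> real) \<Rightarrow> bool" where
  "gaussian_moments_4 n z R \<longleftrightarrow>
    (\<forall>i<n. z i \<in> borel_measurable M) \<and>
    (\<forall>a. has_bochner_integral M (\<lambda>\<omega>. \<Sum>i<n. a i * z i \<omega>) 0 \<and>
       has_bochner_integral M (\<lambda>\<omega>. (\<Sum>i<n. a i * z i \<omega>)\<^sup>2) (\<Sum>i<n. \<Sum>j<n. a i * a j * R i j) \<and>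
       has_bochner_integral M (\<lambda>\<omega>. (\<Sum>i<n. a i * z i \<omega>) ^ 4) (3 * (\<Sum>i<n. \<Sum>j<n. a i * a j * R i j)\<^sup>2))"

text \<open>\<open>gaussian_family\<close> provides some mean and some variance for each
  combination; integrating identifies them as 0 and the quadratic form of \<open>C\<close>.\<close>

lemma centered_gaussian_family_moments:
  assumes g: "centered_gaussian_family M I Z C" and x: "\<And>i. i < n \<Longrightarrow> x i \<in> I"
  shows "gaussian_moments_4 n (\<lambda>i. Z (x i)) (\<lambda>i j. C (x i) (x j))"
  unfolding gaussian_moments_4_def
proof (intro conjI allI impI)
  note G = g[unfolded centered_gaussian_family_def gaussian_family_def]
  have meas: "Z i \<in> borel_measurable M" if "i \<in> I" for i using G that by blast
  \<comment> \<open>The integral of a non-integrable function defaults to 0, so the moment equations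
    of the family say little by themselves; the one-point combinations supply integrability.\<close>
  have Zi: "integrable M (Z i)" "integrable M (\<lambda>\<omega>. (Z i \<omega>)\<^sup>2)" "(\<integral>\<omega>. Z i \<omega> \<partial>M) = 0" if i: "i \<in> I" for i
  proof -
    have "finite {i} \<and> {i} \<subseteq> I" using i by auto
    then obtain m v where mv: "0 \<le> v" "distr M borel (\<lambda>\<omega>. \<Sum>j\<in>{i}. 1 * Z j \<omega>) = gauss_law m v"
      using G by meson
    note mom = gaussian_moments[OF _ mv(1) meas[OF i], of m]
    have d: "distr M borel (Z i) = gauss_law m v" using mv(2) by simp
    have "integrable M (\<lambda>\<omega>. (Z i \<omega> - m) + m)" using mom(1)[OF d]
      by (intro Bochner_Integration.integrable_add) (auto simp: has_bochner_integral_iff)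
    then show int: "integrable M (Z i)" by simp
    show e: "(\<integral>\<omega>. Z i \<omega> \<partial>M) = 0" using G i by blast
    have "(\<integral>\<omega>. Z i \<omega> - m \<partial>M) = 0" using mom(1)[OF d] by (simp add: has_bochner_integral_iff)
    then have "m = 0" using int e by (simp add: prob_space)
    then show "integrable M (\<lambda>\<omega>. (Z i \<omega>)\<^sup>2)" using mom(2)[OF d] by (simp add: has_bochner_integral_iff)
  qed
  fix a :: "nat \<Rightarrow> real"
  define U where "U \<omega> = (\<Sum>i<n. a i * Z (x i) \<omega>)" for \<omega>
  \<comment> \<open>The points may coincide, whereas the family is summed over a set of indices:
    coefficients at equal points are merged.\<close>
  define J where "J = x ` {..<n}"
  define b where "b s = (\<Sum>i | i \<in> {..<n} \<and> x i = s. a i)" for s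
  have "U \<omega> = (\<Sum>j\<in>J. b j * Z j \<omega>)" for \<omega>
  proof -
    have "U \<omega> = (\<Sum>s\<in>J. \<Sum>i | i \<in> {..<n} \<and> x i = s. a i * Z (x i) \<omega>)"
      unfolding U_def J_def by (rule sum.image_gen) simp
    also have "\<dots> = (\<Sum>s\<in>J. \<Sum>i | i \<in> {..<n} \<and> x i = s. a i * Z s \<omega>)" by (intro sum.cong refl) auto
    finally show ?thesis by (simp add: b_def sum_distrib_right)
  qed
  then have Ueq: "U = (\<lambda>\<omega>. \<Sum>j\<in>J. b j * Z j \<omega>)" by auto
  have "finite J \<and> J \<subseteq> I" using x by (auto simp: J_def)
  then obtain m v where mv: "0 \<le> v" "distr M borel U = gauss_law m v"
    using G unfolding Ueq by meson
  have Um: "U \<in> borel_measurable M" unfolding U_def using meas x by measurable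
  note mom = gaussian_moments[OF mv(2,1) Um]
  have Uint: "has_bochner_integral M U 0"
  proof -
    have "has_bochner_integral M (\<lambda>\<omega>. \<Sum>i<n. a i * Z (x i) \<omega>) (\<Sum>i<n. a i * 0)"
      using Zi x by (intro has_bochner_integral_sum has_bochner_integral_mult_right) (auto simp: has_bochner_integral_iff)
    then show ?thesis by (simp add: U_def[abs_def])
  qed
  have "(\<integral>\<omega>. U \<omega> - m \<partial>M) = 0" using mom(1) by (simp add: has_bochner_integral_iff)
  then have m: "m = 0" using Uint by (simp add: prob_space has_bochner_integral_iff)
  have prodint: "integrable M (\<lambda>\<omega>. Z (x i) \<omega> * Z (x j) \<omega>)" if "i < n" "j < n" for i j
    using Zi x meas that by (intro integrable_mult_of_squares) auto
  have "has_bochner_integral M (\<lambda>\<omega>. \<Sum>i<n. \<Sum>j<n. a i * a j * (Z (x i) \<omega> * Z (x j) \<omega>))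
      (\<Sum>i<n. \<Sum>j<n. a i * a j * C (x i) (x j))"
    using G x prodint by (intro has_bochner_integral_sum has_bochner_integral_mult_right)
      (auto simp: has_bochner_integral_iff)
  also have "(\<lambda>\<omega>. \<Sum>i<n. \<Sum>j<n. a i * a j * (Z (x i) \<omega> * Z (x j) \<omega>)) = (\<lambda>\<omega>. (U \<omega>)\<^sup>2)"
    by (intro ext) (simp add: U_def power2_eq_square sum_product ac_simps)
  finally have U2: "has_bochner_integral M (\<lambda>\<omega>. (U \<omega>)\<^sup>2) (\<Sum>i<n. \<Sum>j<n. a i * a j * C (x i) (x j))" .
  with mom(2) m have v: "v = (\<Sum>i<n. \<Sum>j<n. a i * a j * C (x i) (x j))"
    by (metis (no_types, lifting) has_bochner_integral_eq diff_zero has_bochner_integral_cong)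
  show "has_bochner_integral M (\<lambda>\<omega>. \<Sum>i<n. a i * Z (x i) \<omega>) 0" using Uint unfolding U_def .
  show "has_bochner_integral M (\<lambda>\<omega>. (\<Sum>i<n. a i * Z (x i) \<omega>)\<^sup>2) (\<Sum>i<n. \<Sum>j<n. a i * a j * C (x i) (x j))"
    using U2 unfolding U_def .
  show "has_bochner_integral M (\<lambda>\<omega>. (\<Sum>i<n. a i * Z (x i) \<omega>) ^ 4) (3 * (\<Sum>i<n. \<Sum>j<n. a i * a j * C (x i) (x j))\<^sup>2)"
    using mom(3) unfolding m v U_def by simp
qed (use g x in \<open>auto simp: centered_gaussian_family_def gaussian_family_def\<close>)

text \<open>The odd mixed moments vanish because a centred factor splits off, and 3 q^2 + 6 q r + 3
  r^2 = 3 (q + r)^2 preserves the Gaussian form of the fourth moment.\<close>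

lemma gaussian_moments_4_add:
  assumes z: "gaussian_moments_4 n z R" and w: "gaussian_moments_4 n w S"
    and indep: "\<And>a. indep_var borel (\<lambda>\<omega>. \<Sum>i<n. a i * z i \<omega>) borel (\<lambda>\<omega>. \<Sum>i<n. a i * w i \<omega>)"
  shows "gaussian_moments_4 n (\<lambda>i \<omega>. z i \<omega> + w i \<omega>) (\<lambda>i j. R i j + S i j)"
  unfolding gaussian_moments_4_def
proof (intro conjI allI impI)
  fix a
  define U V where "U \<omega> = (\<Sum>i<n. a i * z i \<omega>)" and "V \<omega> = (\<Sum>i<n. a i * w i \<omega>)" for \<omega>
  define q r where "q = (\<Sum>i<n. \<Sum>j<n. a i * a j * R i j)" and "r = (\<Sum>i<n. \<Sum>j<n. a i * a j * S i j)"
  have UV: "(\<Sum>i<n. a i * (z i \<omega> + w i \<omega>)) = U \<omega> + V \<omega>" for \<omega>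
    by (simp add: U_def V_def distrib_left sum.distrib)
  have qr: "(\<Sum>i<n. \<Sum>j<n. a i * a j * (R i j + S i j)) = q + r"
    by (simp add: q_def r_def distrib_left sum.distrib)
  have U: "has_bochner_integral M U 0" "has_bochner_integral M (\<lambda>\<omega>. (U \<omega>)\<^sup>2) q"
     "has_bochner_integral M (\<lambda>\<omega>. U \<omega> ^ 4) (3 * q\<^sup>2)"
    using z unfolding gaussian_moments_4_def U_def q_def by blast+
  have V: "has_bochner_integral M V 0" "has_bochner_integral M (\<lambda>\<omega>. (V \<omega>)\<^sup>2) r"
     "has_bochner_integral M (\<lambda>\<omega>. V \<omega> ^ 4) (3 * r\<^sup>2)"
    using w unfolding gaussian_moments_4_def V_def r_def by blast+
  have UVm: "U \<in> borel_measurable M" "V \<in> borel_measurable M"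
    using U(1) V(1) by (auto simp: has_bochner_integral_iff)
  have ind: "indep_var borel U borel V" using indep[of a] unfolding U_def V_def .
  have prod: "has_bochner_integral M (\<lambda>\<omega>. U \<omega> ^ k * V \<omega> ^ l) (expectation (\<lambda>\<omega>. U \<omega> ^ k) * expectation (\<lambda>\<omega>. V \<omega> ^ l))"
    if "k \<le> 4" "l \<le> 4" for k l
  proof -
    have "indep_var borel ((\<lambda>x. x ^ k) \<circ> U) borel ((\<lambda>x. x ^ l) \<circ> V)"
      by (rule indep_var_compose[OF ind]) auto
    then have i: "indep_var borel (\<lambda>\<omega>. U \<omega> ^ k) borel (\<lambda>\<omega>. V \<omega> ^ l)" by (simp add: comp_def)
    have "integrable M (\<lambda>\<omega>. U \<omega> ^ k)" "integrable M (\<lambda>\<omega>. V \<omega> ^ l)"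
      using integrable_power_le_4 U(3) V(3) UVm that by (auto simp: has_bochner_integral_iff)
    then show ?thesis
      using indep_var_integrable[OF i] indep_var_lebesgue_integral[OF i] by (simp add: has_bochner_integral_iff)
  qed
  have e: "expectation U = 0" "expectation V = 0" "expectation (\<lambda>\<omega>. (U \<omega>)\<^sup>2) = q" "expectation (\<lambda>\<omega>. (V \<omega>)\<^sup>2) = r"
    using U V by (auto simp: has_bochner_integral_iff)
  have 1: "has_bochner_integral M (\<lambda>\<omega>. U \<omega> * V \<omega>) 0"
    using prod[of 1 1] e by simp
  have 2: "has_bochner_integral M (\<lambda>\<omega>. U \<omega> ^ 3 * V \<omega>) 0" "has_bochner_integral M (\<lambda>\<omega>. U \<omega> * V \<omega> ^ 3) 0"
    "has_bochner_integral M (\<lambda>\<omega>. (U \<omega>)\<^sup>2 * (V \<omega>)\<^sup>2) (q * r)"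
    using prod[of 3 1] prod[of 1 3] prod[of 2 2] e by simp_all
  show "has_bochner_integral M (\<lambda>\<omega>. \<Sum>i<n. a i * (z i \<omega> + w i \<omega>)) 0"
    unfolding UV using has_bochner_integral_add[OF U(1) V(1)] by simp
  have "has_bochner_integral M (\<lambda>\<omega>. (U \<omega>)\<^sup>2 + 2 * (U \<omega> * V \<omega>) + (V \<omega>)\<^sup>2) (q + 2 * 0 + r)"
    by (intro has_bochner_integral_add has_bochner_integral_mult_right U V 1)
  also have "(\<lambda>\<omega>. (U \<omega>)\<^sup>2 + 2 * (U \<omega> * V \<omega>) + (V \<omega>)\<^sup>2) = (\<lambda>\<omega>. (U \<omega> + V \<omega>)\<^sup>2)"
    by (intro ext) (simp add: power2_eq_square power3_eq_cube power4_eq_xxxx algebra_simps)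
  finally show "has_bochner_integral M (\<lambda>\<omega>. (\<Sum>i<n. a i * (z i \<omega> + w i \<omega>))\<^sup>2) (\<Sum>i<n. \<Sum>j<n. a i * a j * (R i j + S i j))"
    unfolding UV qr by simp
  have "has_bochner_integral M (\<lambda>\<omega>. U \<omega> ^ 4 + 4 * (U \<omega> ^ 3 * V \<omega>) + 6 * ((U \<omega>)\<^sup>2 * (V \<omega>)\<^sup>2) + 4 * (U \<omega> * V \<omega> ^ 3) + V \<omega> ^ 4)
     (3 * q\<^sup>2 + 4 * 0 + 6 * (q * r) + 4 * 0 + 3 * r\<^sup>2)"
    by (intro has_bochner_integral_add has_bochner_integral_mult_right U V 2)
  also have "(\<lambda>\<omega>. U \<omega> ^ 4 + 4 * (U \<omega> ^ 3 * V \<omega>) + 6 * ((U \<omega>)\<^sup>2 * (V \<omega>)\<^sup>2) + 4 * (U \<omega> * V \<omega> ^ 3) + V \<omega> ^ 4) = (\<lambda>\<omega>. (U \<omega> + V \<omega>) ^ 4)"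
    by (intro ext) (simp add: power2_eq_square power3_eq_cube power4_eq_xxxx algebra_simps)
  also have "3 * q\<^sup>2 + 4 * 0 + 6 * (q * r) + 4 * 0 + 3 * r\<^sup>2 = 3 * (q + r)\<^sup>2" by (simp add: power2_eq_square algebra_simps)
  finally show "has_bochner_integral M (\<lambda>\<omega>. (\<Sum>i<n. a i * (z i \<omega> + w i \<omega>)) ^ 4) (3 * (\<Sum>i<n. \<Sum>j<n. a i * a j * (R i j + S i j))\<^sup>2)"
    unfolding UV qr .
qed (use z w in \<open>auto simp: gaussian_moments_4_def intro!: borel_measurable_add\<close>)

text \<open>By polarisation, both formulas follow from the second and fourth moments of linear combinations.\<close>

lemma isserlis:
  assumes z: "gaussian_moments_4 n z R" and R: "\<And>i j. R i j = R j i"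
    and ij: "i < n" "j < n"
  shows "has_bochner_integral M (\<lambda>\<omega>. z i \<omega> * z j \<omega>) (R i j)"
    and "k < n \<Longrightarrow> l < n \<Longrightarrow> has_bochner_integral M (\<lambda>\<omega>. (z i \<omega> * z j \<omega>) * (z k \<omega> * z l \<omega>))
      (R i j * R k l + R i k * R j l + R i l * R j k)"
proof -
  \<comment> \<open>Coefficients of z_i + s z_j. Written as a sum of two indicators, they are also
    right for i = j, where they give (1 + s) z_i.\<close>
  define e where "e i j s m = of_bool (m = i) + of_bool (m = j) * s" for i j m :: nat and s :: real
  have e: "(\<Sum>m<n. e i j s m * f m) = f i + s * f j" if "i < n" "j < n" for i j s f
  proof -
    have "(\<Sum>m<n. e i j s m * f m) = (\<Sum>m<n. (if m = i then f m else 0) + (if m = j then s * f m else 0))"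
      by (intro sum.cong refl) (simp add: e_def distrib_right)
    also have "\<dots> = f i + s * f j" unfolding sum.distrib using that by simp
    finally show ?thesis .
  qed
  have quad: "(\<Sum>p<n. \<Sum>q<n. a p * a q * R p q) = (\<Sum>p<n. a p * (\<Sum>q<n. a q * R p q))" for a
    by (simp add: sum_distrib_left ac_simps)
  have m2: "has_bochner_integral M (\<lambda>\<omega>. (\<Sum>i<n. a i * z i \<omega>)\<^sup>2) (\<Sum>i<n. a i * (\<Sum>j<n. a j * R i j))" for a
    using z unfolding gaussian_moments_4_def quad by blast
  have m4: "has_bochner_integral M (\<lambda>\<omega>. (\<Sum>i<n. a i * z i \<omega>) ^ 4) (3 * (\<Sum>i<n. a i * (\<Sum>j<n. a j * R i j))\<^sup>2)" for a
    using z unfolding gaussian_moments_4_def quad by blast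
  have "has_bochner_integral M (\<lambda>\<omega>. 1/4 * ((z i \<omega> + 1 * z j \<omega>)\<^sup>2 - (z i \<omega> + (-1) * z j \<omega>)\<^sup>2))
    (1/4 * ((R i i + 1 * R i j + 1 * (R j i + 1 * R j j)) - (R i i + (-1) * R i j + (-1) * (R j i + (-1) * R j j))))"
    using m2[of "e i j 1"] m2[of "e i j (-1)"] unfolding e[OF ij]
    by (intro has_bochner_integral_mult_right has_bochner_integral_diff)
  also have "(\<lambda>\<omega>. 1/4 * ((z i \<omega> + 1 * z j \<omega>)\<^sup>2 - (z i \<omega> + (-1) * z j \<omega>)\<^sup>2)) = (\<lambda>\<omega>. z i \<omega> * z j \<omega>)"
    by (intro ext) (simp add: power2_eq_square algebra_simps)
  finally show "has_bochner_integral M (\<lambda>\<omega>. z i \<omega> * z j \<omega>) (R i j)" using R[of i j] by simp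
  assume kl: "k < n" "l < n"
  \<comment> \<open>(u + v)^4 + (u - v)^4 - 2 u^4 = 12 u^2 v^2 + 2 v^4 isolates the mixed moment of
    two linear combinations.\<close>
  have two: "has_bochner_integral M (\<lambda>\<omega>. (\<Sum>i<n. a i * z i \<omega>)\<^sup>2 * (\<Sum>i<n. b i * z i \<omega>)\<^sup>2)
     ((\<Sum>i<n. a i * (\<Sum>j<n. a j * R i j)) * (\<Sum>i<n. b i * (\<Sum>j<n. b j * R i j)) + 2 * (\<Sum>i<n. a i * (\<Sum>j<n. b j * R i j))\<^sup>2)" for a b
  proof -
    define u v where "u \<omega> = (\<Sum>i<n. a i * z i \<omega>)" and "v \<omega> = (\<Sum>i<n. b i * z i \<omega>)" for \<omega>
    define A B C where "A = (\<Sum>i<n. a i * (\<Sum>j<n. a j * R i j))" and "B = (\<Sum>i<n. b i * (\<Sum>j<n. b j * R i j))"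
      and "C = (\<Sum>i<n. a i * (\<Sum>j<n. b j * R i j))"
    have C': "(\<Sum>i<n. b i * (\<Sum>j<n. a j * R i j)) = C"
      unfolding C_def sum_distrib_left by (subst sum.swap, intro sum.cong refl) (metis R mult.left_commute)
    have s: "(\<Sum>i<n. (a i + s * b i) * z i \<omega>) = u \<omega> + s * v \<omega>" for s \<omega>
      unfolding u_def v_def distrib_right sum.distrib sum_distrib_left by (simp add: ac_simps)
    have q: "(\<Sum>i<n. (a i + s * b i) * (\<Sum>j<n. (a j + s * b j) * R i j)) = A + 2 * s * C + s * s * B" for s
    proof -
      have "(\<Sum>i<n. (a i + s * b i) * (\<Sum>j<n. (a j + s * b j) * R i j)) =
        (\<Sum>i<n. a i * (\<Sum>j<n. a j * R i j) + s * (a i * (\<Sum>j<n. b j * R i j)) + s * (b i * (\<Sum>j<n. a j * R i j))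
          + s * s * (b i * (\<Sum>j<n. b j * R i j)))"
        by (intro sum.cong refl) (simp add: distrib_right distrib_left sum.distrib sum_distrib_left[symmetric] mult.assoc)
      also have "\<dots> = A + s * C + s * C + s * s * B"
        unfolding sum.distrib sum_distrib_left[symmetric] C' A_def B_def by (simp add: C_def)
      finally show ?thesis by simp
    qed
    have "has_bochner_integral M (\<lambda>\<omega>. 1/12 * ((u \<omega> + 1 * v \<omega>) ^ 4 + (u \<omega> + (-1) * v \<omega>) ^ 4 - 2 * (u \<omega> + 0 * v \<omega>) ^ 4) - 1/6 * v \<omega> ^ 4)
      (1/12 * (3 * (A + 2 * 1 * C + 1 * 1 * B)\<^sup>2 + 3 * (A + 2 * (-1) * C + (-1) * (-1) * B)\<^sup>2 - 2 * (3 * (A + 2 * 0 * C + 0 * 0 * B)\<^sup>2)) - 1/6 * (3 * B\<^sup>2))"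
      using m4[of "\<lambda>i. a i + 1 * b i"] m4[of "\<lambda>i. a i + (-1) * b i"] m4[of "\<lambda>i. a i + 0 * b i"] m4[of b] unfolding s q
      unfolding v_def[symmetric] B_def[symmetric]
      by (intro has_bochner_integral_mult_right has_bochner_integral_diff has_bochner_integral_add)
    also have "(\<lambda>\<omega>. 1/12 * ((u \<omega> + 1 * v \<omega>) ^ 4 + (u \<omega> + (-1) * v \<omega>) ^ 4 - 2 * (u \<omega> + 0 * v \<omega>) ^ 4) - 1/6 * v \<omega> ^ 4)
       = (\<lambda>\<omega>. (u \<omega>)\<^sup>2 * (v \<omega>)\<^sup>2)"
      by (intro ext) (simp add: power2_eq_square power4_eq_xxxx field_simps)
    also have "(1/12 * (3 * (A + 2 * 1 * C + 1 * 1 * B)\<^sup>2 + 3 * (A + 2 * (-1) * C + (-1) * (-1) * B)\<^sup>2 - 2 * (3 * (A + 2 * 0 * C + 0 * 0 * B)\<^sup>2)) - 1/6 * (3 * B\<^sup>2))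
       = A * B + 2 * C\<^sup>2"
      by (simp add: power2_eq_square field_simps)
    finally show ?thesis unfolding u_def v_def A_def B_def C_def .
  qed
  have t: "has_bochner_integral M (\<lambda>\<omega>. (z i \<omega> + s * z j \<omega>)\<^sup>2 * (z k \<omega> + t * z l \<omega>)\<^sup>2)
    ((R i i + s * R i j + s * (R j i + s * R j j)) * (R k k + t * R k l + t * (R l k + t * R l l))
     + 2 * (R i k + t * R i l + s * (R j k + t * R j l))\<^sup>2)" for s t
    using two[of "e i j s" "e k l t"] unfolding e[OF ij] e[OF kl] .
  define F where "F s t \<omega> = (z i \<omega> + s * z j \<omega>)\<^sup>2 * (z k \<omega> + t * z l \<omega>)\<^sup>2" for s t \<omega>
  define G where "G s t = ((R i i + s * R i j + s * (R j i + s * R j j)) * (R k k + t * R k l + t * (R l k + t * R l l))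
     + 2 * (R i k + t * R i l + s * (R j k + t * R j l))\<^sup>2)" for s t
  have FG: "has_bochner_integral M (F s t) (G s t)" for s t
    using t[of s t] by (simp add: F_def[abs_def] G_def)
  \<comment> \<open>The product of (z_i + z_j)^2 - (z_i - z_j)^2 = 4 z_i z_j and its counterpart for
    k and l, multiplied out.\<close>
  have "has_bochner_integral M (\<lambda>\<omega>. 1/16 * (F 1 1 \<omega> - F 1 (-1) \<omega> - F (-1) 1 \<omega> + F (-1) (-1) \<omega>))
     (1/16 * (G 1 1 - G 1 (-1) - G (-1) 1 + G (-1) (-1)))"
    by (intro has_bochner_integral_mult_right has_bochner_integral_diff has_bochner_integral_add FG)
  also have "(\<lambda>\<omega>. 1/16 * (F 1 1 \<omega> - F 1 (-1) \<omega> - F (-1) 1 \<omega> + F (-1) (-1) \<omega>)) = (\<lambda>\<omega>. (z i \<omega> * z j \<omega>) * (z k \<omega> * z l \<omega>))"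
    by (intro ext) (simp add: F_def power2_eq_square algebra_simps)
  also have "1/16 * (G 1 1 - G 1 (-1) - G (-1) 1 + G (-1) (-1)) = R i j * R k l + R i k * R j l + R i l * R j k"
    unfolding G_def R[of j i] R[of l k] by (simp add: power2_eq_square algebra_simps)
  finally show "has_bochner_integral M (\<lambda>\<omega>. (z i \<omega> * z j \<omega>) * (z k \<omega> * z l \<omega>)) (R i j * R k l + R i k * R j l + R i l * R j k)" .
qed

text \<open>Of the three pairings in the fourth moment, centring by \<open>R i j\<close> and
  \<open>R k l\<close> cancels the pairing (i j)(k l); for symmetric A each of the two that remain
  is the trace of A R A R.\<close>

lemma quadratic_form_moments:
  assumes z: "gaussian_moments_4 n z R" and R: "\<And>i j. R i j = R j i"
  shows "has_bochner_integral M (\<lambda>\<omega>. \<Sum>i<n. \<Sum>j<n. A i j * (z i \<omega> * z j \<omega>)) (\<Sum>i<n. \<Sum>j<n. A i j * R i j)"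
    and "has_bochner_integral M (\<lambda>\<omega>. (\<Sum>i<n. \<Sum>j<n. A i j * (z i \<omega> * z j \<omega> - R i j))\<^sup>2)
      (\<Sum>i<n. \<Sum>j<n. \<Sum>k<n. \<Sum>l<n. A i j * A k l * (R i k * R j l + R i l * R j k))"
proof -
  show "has_bochner_integral M (\<lambda>\<omega>. \<Sum>i<n. \<Sum>j<n. A i j * (z i \<omega> * z j \<omega>)) (\<Sum>i<n. \<Sum>j<n. A i j * R i j)"
    by (intro has_bochner_integral_sum has_bochner_integral_mult_right isserlis(1)[OF z R]) auto
  have "has_bochner_integral M (\<lambda>\<omega>. (z i \<omega> * z j \<omega> - R i j) * (z k \<omega> * z l \<omega> - R k l)) (R i k * R j l + R i l * R j k)"
    if "i < n" "j < n" "k < n" "l < n" for i j k l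
  proof -
    have "has_bochner_integral M (\<lambda>\<omega>. (z i \<omega> * z j \<omega>) * (z k \<omega> * z l \<omega>) - R k l * (z i \<omega> * z j \<omega>) - R i j * (z k \<omega> * z l \<omega>) + R i j * R k l)
       ((R i j * R k l + R i k * R j l + R i l * R j k) - R k l * R i j - R i j * R k l + R i j * R k l)"
      using that by (intro has_bochner_integral_mult_right has_bochner_integral_diff has_bochner_integral_add isserlis[OF z R])
        (auto simp: has_bochner_integral_iff prob_space)
    then show ?thesis by (simp add: algebra_simps)
  qed
  then have "has_bochner_integral M (\<lambda>\<omega>. \<Sum>i<n. \<Sum>j<n. \<Sum>k<n. \<Sum>l<n. A i j * A k l * ((z i \<omega> * z j \<omega> - R i j) * (z k \<omega> * z l \<omega> - R k l)))
      (\<Sum>i<n. \<Sum>j<n. \<Sum>k<n. \<Sum>l<n. A i j * A k l * (R i k * R j l + R i l * R j k))"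
    by (intro has_bochner_integral_sum has_bochner_integral_mult_right) auto
  also have "(\<lambda>\<omega>. \<Sum>i<n. \<Sum>j<n. \<Sum>k<n. \<Sum>l<n. A i j * A k l * ((z i \<omega> * z j \<omega> - R i j) * (z k \<omega> * z l \<omega> - R k l)))
     = (\<lambda>\<omega>. (\<Sum>i<n. \<Sum>j<n. A i j * (z i \<omega> * z j \<omega> - R i j))\<^sup>2)"
    unfolding power2_eq_square sum_distrib_right unfolding sum_distrib_left
    by (intro ext sum.cong refl) (simp only: mult_ac)
  finally show "has_bochner_integral M (\<lambda>\<omega>. (\<Sum>i<n. \<Sum>j<n. A i j * (z i \<omega> * z j \<omega> - R i j))\<^sup>2)
      (\<Sum>i<n. \<Sum>j<n. \<Sum>k<n. \<Sum>l<n. A i j * A k l * (R i k * R j l + R i l * R j k))" .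
qed

end

text \<open>The left side is 2 Tr(B B) for B = A R, and Tr(B B) is at most the squared Frobenius
  norm of B. The bound on A acts on the columns of R one by one, so that R enters through its
  Frobenius norm and not through its operator norm.\<close>

lemma trace_quadratic_bound:
  fixes A R :: "nat \<Rightarrow> nat \<Rightarrow> real"
  assumes R: "\<And>i j. R i j = R j i" and A: "\<And>i j. i < n \<Longrightarrow> j < n \<Longrightarrow> A i j = A j i"
    and bound: "\<And>v. (\<Sum>i<n. (\<Sum>j<n. A i j * v j)\<^sup>2) \<le> (\<Sum>i<n. (v i)\<^sup>2) / c\<^sup>2"
  shows "(\<Sum>i<n. \<Sum>j<n. \<Sum>k<n. \<Sum>l<n. A i j * A k l * (R i k * R j l + R i l * R j k))
    \<le> 2 / c\<^sup>2 * (\<Sum>i<n. \<Sum>j<n. (R i j)\<^sup>2)"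
proof -
  define B where "B i l = (\<Sum>j<n. A i j * R j l)" for i l
  define T where "T = (\<Sum>i<n. \<Sum>l<n. B i l * B l i)"
  have 1: "(\<Sum>i<n. \<Sum>j<n. \<Sum>k<n. \<Sum>l<n. A i j * A k l * (R i l * R j k)) = T"
  proof -
    have "(\<Sum>i<n. \<Sum>j<n. \<Sum>k<n. \<Sum>l<n. A i j * A k l * (R i l * R j k)) = (\<Sum>i<n. \<Sum>k<n. \<Sum>j<n. \<Sum>l<n. A i j * A k l * (R i l * R j k))"
      by (intro sum.cong refl sum.swap)
    also have "\<dots> = (\<Sum>i<n. \<Sum>k<n. B i k * B k i)"
      unfolding B_def sum_product
    proof (intro sum.cong refl)
      fix i k j l
      show "A i j * A k l * (R i l * R j k) = A i j * R j k * (A k l * R l i)" using R[of i l] by simp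
    qed
    finally show ?thesis by (simp add: T_def)
  qed
  have 2: "(\<Sum>i<n. \<Sum>j<n. \<Sum>k<n. \<Sum>l<n. A i j * A k l * (R i k * R j l)) = T"
  proof -
    have "(\<Sum>i<n. \<Sum>j<n. \<Sum>k<n. \<Sum>l<n. A i j * A k l * (R i k * R j l)) = (\<Sum>i<n. \<Sum>j<n. \<Sum>l<n. \<Sum>k<n. A i j * A k l * (R i k * R j l))"
      by (intro sum.cong refl sum.swap)
    also have "\<dots> = (\<Sum>i<n. \<Sum>j<n. \<Sum>k<n. \<Sum>l<n. A i j * A k l * (R i l * R j k))"
      by (intro sum.cong refl) (simp add: A)
    finally show ?thesis using 1 by simp
  qed
  have "T \<le> (\<Sum>i<n. \<Sum>l<n. ((B i l)\<^sup>2 + (B l i)\<^sup>2) / 2)"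
    unfolding T_def by (intro sum_mono) (use sum_squares_bound in \<open>simp add: field_simps\<close>)
  also have "\<dots> = ((\<Sum>i<n. \<Sum>l<n. (B i l)\<^sup>2) + (\<Sum>i<n. \<Sum>l<n. (B l i)\<^sup>2)) / 2"
    by (simp add: sum_divide_distrib sum.distrib add_divide_distrib)
  also have "(\<Sum>i<n. \<Sum>l<n. (B i l)\<^sup>2) = (\<Sum>i<n. \<Sum>l<n. (B l i)\<^sup>2)" by (rule sum.swap)
  also have "(\<Sum>i<n. \<Sum>l<n. (B l i)\<^sup>2) \<le> (\<Sum>i<n. (\<Sum>j<n. (R j i)\<^sup>2) / c\<^sup>2)"
    unfolding B_def by (intro sum_mono bound)
  also have "\<dots> = (\<Sum>i<n. \<Sum>j<n. (R i j)\<^sup>2) / c\<^sup>2" by (simp add: sum_divide_distrib R[of _ "_"])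
  finally have "T \<le> (\<Sum>i<n. \<Sum>j<n. (R i j)\<^sup>2) / c\<^sup>2" by simp
  moreover have "(\<Sum>i<n. \<Sum>j<n. \<Sum>k<n. \<Sum>l<n. A i j * A k l * (R i k * R j l + R i l * R j k)) = T + T"
    unfolding distrib_left sum.distrib using 1 2 by simp
  ultimately show ?thesis by simp
qed

section \<open>Regularity in the parameter\<close>

text \<open>\<open>partial_on\<close> differentiates at 0 along the line through each point.
  Shifting by s turns these into derivatives of one function of h on a convex set, one-sided at its
  ends, and the mean value inequality applies.\<close>

lemma coordinate_line_lipschitz:
  fixes f :: "real^'p::finite \<Rightarrow> real"
  assumes S: "convex S"
    and diff: "\<And>x. x \<in> S \<Longrightarrow> (\<lambda>h. f (x + h *\<^sub>R axis i 1)) differentiable (at 0 within line_in S i x)"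
    and bound: "\<And>x. x \<in> S \<Longrightarrow> \<bar>partial_on S i f x\<bar> \<le> B"
    and x: "x \<in> S" "x + h *\<^sub>R axis i 1 \<in> S"
  shows "\<bar>f (x + h *\<^sub>R axis i 1) - f x\<bar> \<le> B * \<bar>h\<bar>"
proof -
  let ?e = "axis i 1 :: real^'p"
  have conv: "convex (line_in S i x)"
  proof (rule convexI)
    fix a b u v :: real assume ab: "a \<in> line_in S i x" "b \<in> line_in S i x" and uv: "0 \<le> u" "0 \<le> v" "u + v = 1"
    have "x + (u * a + v * b) *\<^sub>R ?e = (u + v) *\<^sub>R x + (u * a + v * b) *\<^sub>R ?e" using uv by simp
    also have "\<dots> = u *\<^sub>R (x + a *\<^sub>R ?e) + v *\<^sub>R (x + b *\<^sub>R ?e)" by (simp add: algebra_simps)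
    also have "\<dots> \<in> S" using ab uv S by (auto simp: line_in_def intro: convexD)
    finally show "u *\<^sub>R a + v *\<^sub>R b \<in> line_in S i x" by (simp add: line_in_def)
  qed
  have "norm (f (x + h *\<^sub>R ?e) - f (x + 0 *\<^sub>R ?e)) \<le> B * norm (h - 0)"
  proof (rule field_differentiable_bound[OF conv])
    fix s assume s: "s \<in> line_in S i x"
    then have y: "x + s *\<^sub>R ?e \<in> S" by (simp add: line_in_def)
    have im: "(+) s ` line_in S i (x + s *\<^sub>R ?e) = line_in S i x"
    proof
      show "line_in S i x \<subseteq> (+) s ` line_in S i (x + s *\<^sub>R ?e)"
      proof
        fix r assume "r \<in> line_in S i x"
        then have "r - s \<in> line_in S i (x + s *\<^sub>R ?e)" "r = s + (r - s)"
          by (auto simp: line_in_def algebra_simps)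
        then show "r \<in> (+) s ` line_in S i (x + s *\<^sub>R ?e)" by blast
      qed
    qed (auto simp: line_in_def algebra_simps)
    have "((\<lambda>h. f ((x + s *\<^sub>R ?e) + h *\<^sub>R ?e)) has_field_derivative partial_on S i f (x + s *\<^sub>R ?e))
        (at 0 within line_in S i (x + s *\<^sub>R ?e))"
      unfolding partial_on_def has_real_derivative_iff_has_vector_derivative
      using diff[OF y] by (rule vector_derivative_works[THEN iffD1])
    then have "((\<lambda>h. f (x + (s + h) *\<^sub>R ?e)) has_field_derivative partial_on S i f (x + s *\<^sub>R ?e))
        (at 0 within line_in S i (x + s *\<^sub>R ?e))"
      by (simp add: algebra_simps)
    then show "((\<lambda>h. f (x + h *\<^sub>R ?e)) has_field_derivative partial_on S i f (x + s *\<^sub>R ?e)) (at s within line_in S i x)"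
      using DERIV_at_within_shift[of "\<lambda>h. f (x + h *\<^sub>R ?e)" _ s 0 "line_in S i (x + s *\<^sub>R ?e)"]
      unfolding im by simp
    show "norm (partial_on S i f (x + s *\<^sub>R ?e)) \<le> B" using bound[OF y] by simp
  qed (use x in \<open>auto simp: line_in_def\<close>)
  then show ?thesis by simp
qed

text \<open>Coordinates are exchanged one at a time; a box is a product, so the intermediate points
  \<open>z J\<close> stay inside it.\<close>

lemma cbox_lipschitz:
  fixes f :: "real^'p::finite \<Rightarrow> real" and a b :: "real^'p"
  assumes diff: "\<And>x i. x \<in> cbox a b \<Longrightarrow> (\<lambda>h. f (x + h *\<^sub>R axis i 1)) differentiable (at 0 within line_in (cbox a b) i x)"
    and bound: "\<And>x i. x \<in> cbox a b \<Longrightarrow> \<bar>partial_on (cbox a b) i f x\<bar> \<le> B"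
    and x: "x \<in> cbox a b" and y: "y \<in> cbox a b"
  shows "\<bar>f y - f x\<bar> \<le> B * (\<Sum>i\<in>UNIV. \<bar>y $ i - x $ i\<bar>)"
proof -
  define z where "z J = (\<chi> i. if i \<in> J then y $ i else x $ i)" for J
  have zin: "z J \<in> cbox a b" for J using x y by (auto simp: z_def mem_box_cart)
  have "\<bar>f (z J) - f x\<bar> \<le> B * (\<Sum>i\<in>J. \<bar>y $ i - x $ i\<bar>)" if "finite J" for J
    using that
  proof (induction J)
    case empty
    have "z {} = x" by (simp add: z_def Finite_Cartesian_Product.vec_eq_iff)
    then show ?case by simp
  next
    case (insert i J)
    have eq: "z (insert i J) = z J + (y $ i - x $ i) *\<^sub>R axis i 1"
      unfolding Finite_Cartesian_Product.vec_eq_iff using insert.hyps by (auto simp: z_def axis_def)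
    have "\<bar>f (z (insert i J)) - f (z J)\<bar> \<le> B * \<bar>y $ i - x $ i\<bar>"
      unfolding eq using zin[of "insert i J"] zin[of J]
      by (intro coordinate_line_lipschitz[OF convex_box(1) diff bound]) (auto simp: eq[symmetric])
    with insert show ?case by (simp add: distrib_left)
  qed
  from this[of UNIV] show ?thesis by (simp add: z_def vec_lambda_eta)
qed

lemma cbox_grid:
  fixes lo hi :: real and m :: nat
  assumes "lo < hi" "m \<ge> 1"
  obtains G :: "(real^'p::finite) set" where "finite G" "G \<subseteq> cbox (\<chi> i. lo) (\<chi> i. hi)"
    "card G \<le> (m + 1) ^ CARD('p)"
    "\<And>\<theta>. \<theta> \<in> cbox (\<chi> i. lo) (\<chi> i. hi) \<Longrightarrow>
       \<exists>\<theta>'\<in>G. (\<Sum>i\<in>UNIV. \<bar>\<theta> $ i - \<theta>' $ i\<bar>) \<le> real CARD('p) * (hi - lo) / real m"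
proof
  define pt where "pt f = (\<chi> i. lo + (hi - lo) * real (f i) / real m :: real^'p)" for f :: "'p \<Rightarrow> nat"
  \<comment> \<open>Grid indices run up to m inclusively: rounding down yields m exactly on the
    upper face.\<close>
  define F where "F = (UNIV :: 'p set) \<rightarrow>\<^sub>E {..m}"
  have fin: "finite F" unfolding F_def by (intro finite_PiE) auto
  show "finite (pt ` F)" using fin by simp
  have "card (pt ` F) \<le> card F" by (rule card_image_le[OF fin])
  also have "card F = (m + 1) ^ CARD('p)" unfolding F_def by (subst card_PiE) auto
  finally show "card (pt ` F) \<le> (m + 1) ^ CARD('p)" .
  show "pt ` F \<subseteq> cbox (\<chi> i. lo) (\<chi> i. hi)"
  proof (rule image_subsetI)
    fix f assume f: "f \<in> F"
    have "lo \<le> lo + (hi - lo) * real (f i) / real m \<and> lo + (hi - lo) * real (f i) / real m \<le> hi" for i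
    proof -
      have "f i \<le> m" using f by (auto simp: F_def)
      then have "(hi - lo) * (real (f i) / real m) \<le> (hi - lo) * 1"
        using assms by (intro mult_left_mono) (auto simp: field_simps)
      then show ?thesis using assms by simp
    qed
    then show "pt f \<in> cbox (\<chi> i. lo) (\<chi> i. hi)" by (simp add: mem_box_cart pt_def)
  qed
  fix \<theta> :: "real^'p" assume th: "\<theta> \<in> cbox (\<chi> i. lo) (\<chi> i. hi)"
  define s where "s i = (\<theta> $ i - lo) * real m / (hi - lo)" for i
  define f where "f i = nat \<lfloor>s i\<rfloor>" for i
  have s: "0 \<le> s i" "s i \<le> m" for i
  proof -
    have t: "lo \<le> \<theta> $ i" "\<theta> $ i \<le> hi" using th by (auto simp: mem_box_cart)
    show "0 \<le> s i" using t assms by (auto simp: s_def)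
    have "(\<theta> $ i - lo) * real m \<le> (hi - lo) * real m" using t by (intro mult_right_mono) auto
    then show "s i \<le> m" using assms by (simp add: s_def field_simps)
  qed
  have f: "f i \<le> m" "\<bar>s i - real (f i)\<bar> \<le> 1" for i
    using s[of i] by (auto simp: f_def nat_le_iff floor_le_iff, linarith+)
  have "f \<in> F" using f by (auto simp: F_def)
  moreover have "(\<Sum>i\<in>UNIV. \<bar>\<theta> $ i - pt f $ i\<bar>) \<le> (\<Sum>i\<in>(UNIV :: 'p set). (hi - lo) / real m)"
  proof (rule sum_mono)
    fix i
    have "\<theta> $ i - pt f $ i = (hi - lo) / real m * (s i - real (f i))"
      using assms by (simp add: pt_def s_def field_simps)
    then have "\<bar>\<theta> $ i - pt f $ i\<bar> = (hi - lo) / real m * \<bar>s i - real (f i)\<bar>"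
      using assms by (simp add: abs_mult)
    also have "\<dots> \<le> (hi - lo) / real m * 1" using assms f by (intro mult_left_mono) auto
    finally show "\<bar>\<theta> $ i - pt f $ i\<bar> \<le> (hi - lo) / real m" by simp
  qed
  ultimately show "\<exists>\<theta>'\<in>pt ` F. (\<Sum>i\<in>UNIV. \<bar>\<theta> $ i - \<theta>' $ i\<bar>) \<le> real CARD('p) * (hi - lo) / real m"
    by (intro bexI[of _ "pt f"]) auto
qed

section \<open>Strict positive definiteness at distinct points\<close>

text \<open>Multiplying the relation by the inverse of one of the exponentials and differentiating removes that term.\<close>

lemma exponential_sum_independent:
  fixes l :: "'t \<Rightarrow> real" and c :: "'t \<Rightarrow> complex"
  assumes "finite T" "inj_on l T" "0 < \<epsilon>"
    and "\<And>h. \<bar>h\<bar> < \<epsilon> \<Longrightarrow> (\<Sum>t\<in>T. c t * iexp (l t * h)) = 0"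
  shows "\<forall>t\<in>T. c t = 0"
  using assms
proof (induction T arbitrary: c rule: finite_induct)
  case (insert u T)
  \<comment> \<open>Defined for complex h, so that the termwise derivative is a complex one; on the
    real interval g is the constant - c u.\<close>
  define g where "g h = (\<Sum>t\<in>T. c t * exp (\<i> * of_real (l t - l u) * h))" for h :: complex
  have g: "g (of_real h) = - c u" if h: "\<bar>h\<bar> < \<epsilon>" for h
  proof -
    have "0 = iexp (- l u * h) * (\<Sum>t\<in>insert u T. c t * iexp (l t * h))"
      using insert.prems(3)[OF h] by simp
    also have "\<dots> = (\<Sum>t\<in>insert u T. c t * (iexp (- l u * h) * iexp (l t * h)))"
      by (simp only: sum_distrib_left mult_ac)
    also have "\<dots> = (\<Sum>t\<in>insert u T. c t * exp (\<i> * of_real (l t - l u) * of_real h))"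
      by (intro sum.cong refl) (simp add: exp_add[symmetric] algebra_simps)
    also have "\<dots> = c u + g (of_real h)"
      using insert.hyps by (simp add: g_def)
    finally show ?thesis by (simp add: eq_neg_iff_add_eq_0 add.commute)
  qed
  have deriv: "(\<Sum>t\<in>T. (c t * (\<i> * of_real (l t - l u))) * exp (\<i> * of_real (l t - l u) * of_real h)) = 0"
    if h: "\<bar>h\<bar> < \<epsilon>" for h
  proof -
    have "(g has_field_derivative (\<Sum>t\<in>T. c t * (exp (\<i> * of_real (l t - l u) * of_real h) * (\<i> * of_real (l t - l u))))) (at (of_real h))"
      unfolding g_def by (auto intro!: derivative_eq_intros sum.cong simp: mult_ac)
    from has_vector_derivative_real_field[OF this]
    have 1: "((\<lambda>x. g (of_real x)) has_vector_derivative (\<Sum>t\<in>T. c t * (exp (\<i> * of_real (l t - l u) * of_real h) * (\<i> * of_real (l t - l u))))) (at h)" .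
    have "((\<lambda>x. - c u) has_vector_derivative 0) (at h)" by simp
    then have 2: "((\<lambda>x. g (of_real x)) has_vector_derivative 0) (at h)"
    proof (rule has_vector_derivative_transform_within_open)
      show "open {-\<epsilon><..<\<epsilon>}" "h \<in> {-\<epsilon><..<\<epsilon>}" using h by (auto simp: abs_less_iff)
      fix x assume "x \<in> {-\<epsilon><..<\<epsilon>}"
      then show "- c u = g (of_real x)" using g[of x] by (simp add: abs_less_iff)
    qed
    from vector_derivative_unique_at[OF 1 2] show ?thesis by (simp add: mult_ac)
  qed
  have "\<forall>t\<in>T. c t * (\<i> * of_real (l t - l u)) = 0"
  proof (rule insert.IH)
    show "inj_on l T" using insert.prems by simp
    fix h assume h: "\<bar>h\<bar> < \<epsilon>"
    have "(\<Sum>t\<in>T. (c t * (\<i> * of_real (l t - l u))) * iexp (l t * h))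
      = iexp (l u * h) * (\<Sum>t\<in>T. (c t * (\<i> * of_real (l t - l u))) * exp (\<i> * of_real (l t - l u) * of_real h))"
      unfolding sum_distrib_left
    proof (intro sum.cong refl)
      fix t
      have "iexp (l t * h) = iexp (l u * h) * exp (\<i> * of_real (l t - l u) * of_real h)"
        by (simp add: exp_add[symmetric] algebra_simps)
      then show "(c t * (\<i> * of_real (l t - l u))) * iexp (l t * h) =
        iexp (l u * h) * ((c t * (\<i> * of_real (l t - l u))) * exp (\<i> * of_real (l t - l u) * of_real h))"
        by simp
    qed
    then show "(\<Sum>t\<in>T. (c t * (\<i> * of_real (l t - l u))) * iexp (l t * h)) = 0"
      using deriv[OF h] by simp
  qed (use insert.prems in auto)
  moreover have "l t \<noteq> l u" if "t \<in> T" for t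
    using insert.prems(1) insert.hyps(2) that by (auto simp: inj_on_def)
  ultimately have T: "\<forall>t\<in>T. c t = 0" by auto
  then have "c u = 0" using g[of 0] insert.prems(2) by (simp add: g_def)
  with T show ?case by simp
qed simp

text \<open>The directions that identify two given points form a hyperplane, and finitely many
  hyperplanes are a null set. Along a separating direction an exponential sum in several variables
  becomes one in a single variable with distinct frequencies.\<close>

lemma exists_separating_direction:
  fixes T :: "'a::euclidean_space set"
  assumes "finite T"
  shows "\<exists>u. inj_on (\<lambda>t. u \<bullet> t) T"
proof -
  let ?H = "\<lambda>(s, t). {u. inner (s - t) u = 0}"
  let ?P = "{(s, t). s \<in> T \<and> t \<in> T \<and> s \<noteq> t}"
  have "finite ?P" by (rule finite_subset[of _ "T \<times> T"]) (use assms in auto)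
  then have "negligible (\<Union>p\<in>?P. ?H p)"
    by (intro negligible_Union) (auto intro!: negligible_hyperplane)
  then have "(\<Union>p\<in>?P. ?H p) \<noteq> UNIV" using non_negligible_UNIV by metis
  then obtain u where u: "u \<notin> (\<Union>p\<in>?P. ?H p)" by blast
  have "inj_on (\<lambda>t. u \<bullet> t) T"
  proof (rule inj_onI, rule ccontr)
    fix s t assume "s \<in> T" "t \<in> T" "u \<bullet> s = u \<bullet> t" "s \<noteq> t"
    then have "(s, t) \<in> ?P" "u \<in> ?H (s, t)" by (auto simp: inner_diff_right inner_commute)
    then show False using u by blast
  qed
  then show ?thesis ..
qed

section \<open>Gaussian kernels against the Fourier transform\<close>

lemma power2_norm_eq_sum_Basis: "(norm u)\<^sup>2 = (\<Sum>b\<in>Basis. (inner u b)\<^sup>2)"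
  unfolding power2_norm_eq_inner by (subst euclidean_inner) (simp add: power2_eq_square)

lemma integrable_gaussian_lborel: "integrable lborel (\<lambda>u :: 'a::euclidean_space. exp (- (norm u)\<^sup>2 / 2))"
proof -
  have eq: "exp (- (norm u)\<^sup>2 / 2) = (\<Prod>b\<in>Basis. exp (- (u \<bullet> b)\<^sup>2 / 2))" for u :: 'a
    by (simp add: exp_sum[symmetric] sum_negf sum_divide_distrib[symmetric] power2_norm_eq_sum_Basis)
  have 1: "(\<integral>\<^sup>+x. ennreal (exp (- x\<^sup>2 / 2)) \<partial>lborel) < \<infinity>"
  proof -
    have "integrable lborel (\<lambda>x. sqrt (2 * pi) * std_normal_density x)" by simp
    also have "(\<lambda>x. sqrt (2 * pi) * std_normal_density x) = (\<lambda>x. exp (- x\<^sup>2 / 2))"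
      by (simp add: std_normal_density_def)
    finally show ?thesis by (simp add: integrable_iff_bounded)
  qed
  have "(\<integral>\<^sup>+u. ennreal (exp (- (norm u)\<^sup>2 / 2)) \<partial>(lborel :: 'a measure)) =
    (\<integral>\<^sup>+u. (\<Prod>b\<in>Basis. ennreal (exp (- (u \<bullet> b)\<^sup>2 / 2))) \<partial>(lborel :: 'a measure))"
    unfolding eq by (simp add: prod_ennreal)
  also have "\<dots> = (\<Prod>b\<in>(Basis :: 'a set). (\<integral>\<^sup>+x. ennreal (exp (- x\<^sup>2 / 2)) \<partial>lborel))"
    by (rule nn_integral_lborel_prod) auto
  also have "\<dots> < \<infinity>" using 1 by (simp add: ennreal_prod_eq_top less_top power_less_top_ennreal)
  finally show ?thesis by (simp add: integrable_iff_bounded)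
qed

text \<open>The Gaussian kernel is the characteristic function of a standard normal vector,
  assembled from independent coordinates. By Fubini, integrating a function against this kernel
  averages its Fourier transform.\<close>

lemma gaussian_as_mixture:
  fixes x :: "'a::euclidean_space"
  defines "N \<equiv> PiM (Basis :: 'a set) (\<lambda>_. std_normal_distribution)"
  shows "(\<integral>w. iexp (s * ((\<Sum>b\<in>Basis. w b *\<^sub>R b) \<bullet> x)) \<partial>N) = of_real (exp (- (norm (s *\<^sub>R x))\<^sup>2 / 2))"
proof -
  interpret real_distribution std_normal_distribution by (rule real_dist_normal_dist)
  interpret product_sigma_finite "\<lambda>_::'a. std_normal_distribution" ..
  have "iexp (s * ((\<Sum>b\<in>Basis. w b *\<^sub>R b) \<bullet> x)) = (\<Prod>b\<in>Basis. iexp (s * (b \<bullet> x) * w b))" for w :: "'a \<Rightarrow> real"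
    by (simp add: exp_sum[symmetric] inner_sum_left sum_distrib_left mult_ac)
  then have "(\<integral>w. iexp (s * ((\<Sum>b\<in>Basis. w b *\<^sub>R b) \<bullet> x)) \<partial>N) = (\<integral>w. (\<Prod>b\<in>Basis. iexp (s * (b \<bullet> x) * w b)) \<partial>N)"
    by simp
  also have "\<dots> = (\<Prod>b\<in>Basis. char std_normal_distribution (s * (b \<bullet> x)))"
    unfolding N_def char_def by (intro product_integral_prod integrable_iexp) auto
  also have "\<dots> = (\<Prod>b\<in>Basis. of_real (exp (- (s * (b \<bullet> x))\<^sup>2 / 2)))"
    by (simp add: char_std_normal_distribution)
  also have "\<dots> = of_real (exp (\<Sum>b\<in>Basis. - (s * (b \<bullet> x))\<^sup>2 / 2))"
    by (simp add: exp_sum of_real_prod)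
  also have "(\<Sum>b\<in>Basis. - (s * (b \<bullet> x))\<^sup>2 / 2) = - (norm (s *\<^sub>R x))\<^sup>2 / 2"
    unfolding power2_norm_eq_sum_Basis by (simp add: sum_negf sum_divide_distrib[symmetric] inner_commute)
  finally show ?thesis .
qed

lemma fourier_zero_imp_zero_at_0:
  fixes k :: "'a::euclidean_space \<Rightarrow> real"
  assumes cont: "continuous_on UNIV k" and int: "integrable lborel k" and bound: "\<And>x. \<bar>k x\<bar> \<le> B"
    and zero: "\<And>\<xi>. (\<integral>x. k x *\<^sub>R iexp (\<xi> \<bullet> x) \<partial>lborel) = 0"
  shows "k 0 = 0"
proof -
  have km [measurable]: "k \<in> borel_measurable borel" using cont by (rule borel_measurable_continuous_onI)
  define N where "N = PiM (Basis :: 'a set) (\<lambda>_. std_normal_distribution)"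
  interpret real_distribution std_normal_distribution by (rule real_dist_normal_dist)
  interpret P: product_prob_space "\<lambda>_::'a. std_normal_distribution" "Basis :: 'a set" ..
  interpret N: prob_space N unfolding N_def by (rule P.prob_space_axioms)
  interpret NL: pair_sigma_finite N "lborel :: 'a measure" ..
  have wm [measurable]: "(\<lambda>w. \<Sum>b\<in>Basis. w b *\<^sub>R b) \<in> N \<rightarrow>\<^sub>M (borel :: 'a measure)"
    unfolding N_def by measurable
  have gauss0: "(\<integral>x. k x * exp (- (norm (s *\<^sub>R x))\<^sup>2 / 2) \<partial>lborel) = 0" for s
  proof -
    let ?f = "\<lambda>w x. k x *\<^sub>R iexp (s * ((\<Sum>b\<in>Basis. w b *\<^sub>R b) \<bullet> x))"
    have "integrable (N \<Otimes>\<^sub>M lborel) (case_prod ?f)"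
    proof (rule NL.Fubini_integrable)
      show "case_prod ?f \<in> borel_measurable (N \<Otimes>\<^sub>M lborel)" by measurable
      show "integrable N (\<lambda>w. \<integral>x. norm (case_prod ?f (w, x)) \<partial>lborel)" by (simp add: norm_mult)
      show "AE w in N. integrable lborel (\<lambda>x. case_prod ?f (w, x))"
      proof (rule AE_I2)
        fix w assume "w \<in> space N"
        show "integrable lborel (\<lambda>x. case_prod ?f (w, x))"
          by (rule Bochner_Integration.integrable_bound[OF int]) auto
      qed
    qed
    then have "(\<integral>x. (\<integral>w. ?f w x \<partial>N) \<partial>lborel) = (\<integral>w. (\<integral>x. ?f w x \<partial>lborel) \<partial>N)"
      by (rule NL.Fubini_integral)
    also have "\<dots> = 0"
    proof -
      have "(\<integral>x. ?f w x \<partial>lborel) = 0" for w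
        using zero[of "s *\<^sub>R (\<Sum>b\<in>Basis. w b *\<^sub>R b)"] by simp
      then show ?thesis by simp
    qed
    finally have "0 = (\<integral>x. (\<integral>w. ?f w x \<partial>N) \<partial>lborel)" by simp
    also have "\<dots> = (\<integral>x. complex_of_real (k x * exp (- (norm (s *\<^sub>R x))\<^sup>2 / 2)) \<partial>lborel)"
    proof -
      have "(\<integral>w. ?f w x \<partial>N) = complex_of_real (k x * exp (- (norm (s *\<^sub>R x))\<^sup>2 / 2))" for x
        using gaussian_as_mixture[of s x, folded N_def]
        by (simp only: integral_mult_right_zero scaleR_conv_of_real of_real_mult)
      then show ?thesis by simp
    qed
    also have "\<dots> = of_real (\<integral>x. k x * exp (- (norm (s *\<^sub>R x))\<^sup>2 / 2) \<partial>lborel)"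
      by (rule integral_complex_of_real)
    finally show ?thesis by simp
  qed
  \<comment> \<open>Substituting u = (n + 1) x moves the shrinking from the kernel into the argument
    of \<open>k\<close>; a fixed integrable Gaussian then dominates.\<close>
  have scaled: "(\<integral>u. k ((1 / real (Suc n)) *\<^sub>R u) * exp (- (norm u)\<^sup>2 / 2) \<partial>lborel) = 0" for n
  proof -
    let ?c = "real (Suc n)"
    have c: "?c \<noteq> 0" by simp
    have "(\<integral>u. k ((1 / ?c) *\<^sub>R u) * exp (- (norm u)\<^sup>2 / 2) \<partial>lborel) =
      (\<integral>u. k ((1 / ?c) *\<^sub>R u) * exp (- (norm u)\<^sup>2 / 2)
         \<partial>(density (distr lborel borel (\<lambda>x. 0 + ?c *\<^sub>R x)) (\<lambda>_. \<bar>?c\<bar> ^ DIM('a))))"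
      using lborel_affine[OF c, of "0 :: 'a"] by simp
    also have "\<dots> = (\<integral>u. \<bar>?c\<bar> ^ DIM('a) *\<^sub>R (k ((1 / ?c) *\<^sub>R u) * exp (- (norm u)\<^sup>2 / 2))
         \<partial>(distr lborel borel (\<lambda>x. 0 + ?c *\<^sub>R x)))"
      by (rule integral_density) (simp_all, measurable)
    also have "\<dots> = (\<integral>x. \<bar>?c\<bar> ^ DIM('a) *\<^sub>R (k ((1 / ?c) *\<^sub>R (0 + ?c *\<^sub>R x)) * exp (- (norm (0 + ?c *\<^sub>R x))\<^sup>2 / 2)) \<partial>lborel)"
      by (rule integral_distr) measurable
    also have "\<dots> = \<bar>?c\<bar> ^ DIM('a) *\<^sub>R (\<integral>x. k x * exp (- (norm (?c *\<^sub>R x))\<^sup>2 / 2) \<partial>lborel)"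
      by (simp del: of_nat_Suc norm_scaleR)
    also have "\<dots> = 0" unfolding gauss0 by simp
    finally show ?thesis .
  qed
  have "(\<lambda>n. \<integral>u. k ((1 / real (Suc n)) *\<^sub>R u) * exp (- (norm u)\<^sup>2 / 2) \<partial>lborel) \<longlonglongrightarrow>
     (\<integral>u. k 0 * exp (- (norm (u :: 'a))\<^sup>2 / 2) \<partial>lborel)"
  proof (rule integral_dominated_convergence)
    show "integrable lborel (\<lambda>u :: 'a. B * exp (- (norm u)\<^sup>2 / 2))"
      by (intro integrable_mult_right integrable_gaussian_lborel)
    show "AE u in lborel. (\<lambda>n. k ((1 / real (Suc n)) *\<^sub>R u) * exp (- (norm u)\<^sup>2 / 2)) \<longlonglongrightarrow> k 0 * exp (- (norm u)\<^sup>2 / 2)"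
    proof (intro AE_I2 tendsto_mult tendsto_const)
      fix u :: 'a
      have "(\<lambda>n. (1 / real (Suc n)) *\<^sub>R u) \<longlonglongrightarrow> 0 *\<^sub>R u"
        by (intro tendsto_scaleR tendsto_const LIMSEQ_inverse_real_of_nat[unfolded inverse_eq_divide])
      then show "(\<lambda>n. k ((1 / real (Suc n)) *\<^sub>R u)) \<longlonglongrightarrow> k 0"
        using continuous_on_tendsto_compose[OF cont, of "\<lambda>n. (1 / real (Suc n)) *\<^sub>R u" 0 sequentially] by simp
    qed
    show "AE u in lborel. norm (k ((1 / real (Suc n)) *\<^sub>R u) * exp (- (norm u)\<^sup>2 / 2)) \<le> B * exp (- (norm u)\<^sup>2 / 2)" for n
      using bound by (intro AE_I2) (auto simp: abs_mult intro!: mult_right_mono)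
  qed auto
  then have "(\<integral>u. k 0 * exp (- (norm (u :: 'a))\<^sup>2 / 2) \<partial>lborel) = 0"
    unfolding scaled using LIMSEQ_unique tendsto_const by blast
  then have "k 0 = 0 \<or> (\<integral>u. exp (- (norm (u :: 'a))\<^sup>2 / 2) \<partial>lborel) = 0" by simp
  moreover have "(\<integral>u. exp (- (norm (u :: 'a))\<^sup>2 / 2) \<partial>lborel) \<noteq> 0"
  proof
    assume "(\<integral>u. exp (- (norm (u :: 'a))\<^sup>2 / 2) \<partial>lborel) = 0"
    then have "AE u in (lborel :: 'a measure). exp (- (norm u)\<^sup>2 / 2) = 0"
      by (subst (asm) integral_nonneg_eq_0_iff_AE[OF integrable_gaussian_lborel]) auto
    then have "AE u in (lborel :: 'a measure). False" by simp
    then have "emeasure lborel (UNIV :: 'a set) = 0" by (subst (asm) AE_iff_measurable[of UNIV]) auto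
    then show False by (simp add: emeasure_lborel_UNIV)
  qed
  ultimately show ?thesis by simp
qed

text \<open>The exponential polynomial cannot vanish on a whole interval along the separating
  direction, as one of its coefficients is nonzero. Every frequency is therefore a limit of zeros of
  the Fourier transform, which is continuous by dominated convergence.\<close>

lemma translates_independent:
  fixes k :: "'a::euclidean_space \<Rightarrow> real"
  assumes cont: "continuous_on UNIV k" and int: "integrable lborel k" and bound: "\<And>x. \<bar>k x\<bar> \<le> B"
    and T: "finite T" and zero: "\<And>x. (\<Sum>t\<in>T. a t * k (x - t)) = 0" and t0: "t0 \<in> T" "a t0 \<noteq> 0"
  shows "k 0 = 0"
proof (rule fourier_zero_imp_zero_at_0[OF cont int bound])
  have km [measurable]: "k \<in> borel_measurable borel" using cont by (rule borel_measurable_continuous_onI)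
  define \<phi> where "\<phi> \<xi> = (\<integral>x. k x *\<^sub>R iexp (\<xi> \<bullet> x) \<partial>lborel)" for \<xi>
  have int': "integrable lborel (\<lambda>x. k x *\<^sub>R iexp (\<xi> \<bullet> x))" for \<xi>
    by (rule Bochner_Integration.integrable_bound[OF int]) auto
  have trans: "has_bochner_integral lborel (\<lambda>x. k (x - t) *\<^sub>R iexp (\<xi> \<bullet> x)) (iexp (\<xi> \<bullet> t) * \<phi> \<xi>)" for t \<xi>
  proof -
    have "has_bochner_integral (distr lborel borel ((+) t)) (\<lambda>x. k (x - t) *\<^sub>R iexp (\<xi> \<bullet> x)) (iexp (\<xi> \<bullet> t) * \<phi> \<xi>)"
    proof (subst has_bochner_integral_iff, subst integrable_distr_eq, simp, simp, subst integral_distr, simp, simp, intro conjI)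
      have eq: "(\<lambda>x. k (t + x - t) *\<^sub>R iexp (\<xi> \<bullet> (t + x))) = (\<lambda>x. iexp (\<xi> \<bullet> t) * (k x *\<^sub>R iexp (\<xi> \<bullet> x)))"
        by (intro ext) (simp add: inner_add_right distrib_left exp_add)
      show "integrable lborel (\<lambda>x. k (t + x - t) *\<^sub>R iexp (\<xi> \<bullet> (t + x)))"
        unfolding eq by (intro integrable_mult_right int')
      show "(\<integral>x. k (t + x - t) *\<^sub>R iexp (\<xi> \<bullet> (t + x)) \<partial>lborel) = iexp (\<xi> \<bullet> t) * \<phi> \<xi>"
        unfolding eq \<phi>_def by (rule integral_mult_right_zero)
    qed
    then show ?thesis by (simp add: lborel_distr_plus)
  qed
  have P: "(\<Sum>t\<in>T. of_real (a t) * iexp (\<xi> \<bullet> t)) * \<phi> \<xi> = 0" for \<xi>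
  proof -
    have "has_bochner_integral lborel (\<lambda>x. \<Sum>t\<in>T. of_real (a t) * (k (x - t) *\<^sub>R iexp (\<xi> \<bullet> x)))
       (\<Sum>t\<in>T. of_real (a t) * (iexp (\<xi> \<bullet> t) * \<phi> \<xi>))"
      by (intro has_bochner_integral_sum has_bochner_integral_mult_right trans)
    also have "(\<lambda>x. \<Sum>t\<in>T. of_real (a t) * (k (x - t) *\<^sub>R iexp (\<xi> \<bullet> x))) = (\<lambda>x. 0)"
    proof
      fix x
      have "(\<Sum>t\<in>T. of_real (a t) * (k (x - t) *\<^sub>R iexp (\<xi> \<bullet> x))) = of_real (\<Sum>t\<in>T. a t * k (x - t)) * iexp (\<xi> \<bullet> x)"
        by (simp add: sum_distrib_left sum_distrib_right scaleR_conv_of_real mult_ac)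
      then show "(\<Sum>t\<in>T. of_real (a t) * (k (x - t) *\<^sub>R iexp (\<xi> \<bullet> x))) = 0" using zero by simp
    qed
    finally have "(\<Sum>t\<in>T. of_real (a t) * (iexp (\<xi> \<bullet> t) * \<phi> \<xi>)) = 0"
      using has_bochner_integral_zero has_bochner_integral_eq by blast
    then show ?thesis unfolding sum_distrib_right by (simp add: mult_ac)
  qed
  obtain u where u: "inj_on (\<lambda>t. u \<bullet> t) T" using exists_separating_direction[OF T] by blast
  fix \<xi> :: 'a
  have "\<exists>h. \<bar>h\<bar> < 1 / real (Suc n) \<and> \<phi> (\<xi> + h *\<^sub>R u) = 0" for n
  proof (rule ccontr)
    assume *: "\<not> ?thesis"
    have "\<forall>t\<in>T. of_real (a t) * iexp (\<xi> \<bullet> t) = 0"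
    proof (rule exponential_sum_independent[OF T u])
      show "0 < 1 / real (Suc n)" by simp
      fix h assume "\<bar>h\<bar> < 1 / real (Suc n)"
      then have "\<phi> (\<xi> + h *\<^sub>R u) \<noteq> 0" using * by blast
      then have "(\<Sum>t\<in>T. of_real (a t) * iexp ((\<xi> + h *\<^sub>R u) \<bullet> t)) = 0" using P[of "\<xi> + h *\<^sub>R u"] by simp
      then show "(\<Sum>t\<in>T. of_real (a t) * iexp (\<xi> \<bullet> t) * iexp (u \<bullet> t * h)) = 0"
        by (simp add: inner_add_left distrib_left exp_add mult_ac)
    qed
    then show False using t0 by auto
  qed
  then obtain h where h: "\<And>n. \<bar>h n\<bar> < 1 / real (Suc n)" "\<And>n. \<phi> (\<xi> + h n *\<^sub>R u) = 0" by metis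
  have "h \<longlonglongrightarrow> 0"
  proof (rule Lim_null_comparison)
    show "\<forall>\<^sub>F n in sequentially. norm (h n) \<le> 1 / real (Suc n)"
    proof (intro always_eventually allI)
      show "norm (h n) \<le> 1 / real (Suc n)" for n using h(1)[of n] by simp
    qed
    show "(\<lambda>n. 1 / real (Suc n)) \<longlonglongrightarrow> 0" using LIMSEQ_inverse_real_of_nat by (simp add: inverse_eq_divide)
  qed
  have "(\<lambda>n. \<phi> (\<xi> + h n *\<^sub>R u)) \<longlonglongrightarrow> \<phi> \<xi>"
    unfolding \<phi>_def
  proof (rule integral_dominated_convergence[where w = "\<lambda>x. \<bar>k x\<bar>"])
    show "AE x in lborel. (\<lambda>n. k x *\<^sub>R iexp ((\<xi> + h n *\<^sub>R u) \<bullet> x)) \<longlonglongrightarrow> k x *\<^sub>R iexp (\<xi> \<bullet> x)"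
    proof (rule AE_I2)
      fix x
      have "(\<lambda>n. k x *\<^sub>R iexp ((\<xi> + h n *\<^sub>R u) \<bullet> x)) \<longlonglongrightarrow> k x *\<^sub>R iexp ((\<xi> + 0 *\<^sub>R u) \<bullet> x)"
        by (intro tendsto_intros \<open>h \<longlonglongrightarrow> 0\<close>)
      then show "(\<lambda>n. k x *\<^sub>R iexp ((\<xi> + h n *\<^sub>R u) \<bullet> x)) \<longlonglongrightarrow> k x *\<^sub>R iexp (\<xi> \<bullet> x)" by simp
    qed
  qed (use int in auto)
  then have "\<phi> \<xi> = 0" unfolding h(2) using LIMSEQ_unique tendsto_const by blast
  then show "(\<integral>x. k x *\<^sub>R iexp (\<xi> \<bullet> x) \<partial>lborel) = 0" by (simp add: \<phi>_def)
qed

text \<open>A weight vector with vanishing form is orthogonal, in the semidefinite form, to every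
  further point y. This orthogonality is the linear relation between translates; as the points are
  distinct, a nonzero weight stays a nonzero coefficient.\<close>

lemma pos_def_cov_entry_distinct:
  fixes k :: "'a::euclidean_space \<Rightarrow> real"
  assumes k: "stationary_covariance k" and cont: "continuous_on UNIV k" and int: "integrable lborel k"
    and bound: "\<And>x. \<bar>k x\<bar> \<le> B" and k0: "k 0 \<noteq> 0" and x: "inj_on x {..<n}"
  shows "pos_def_on n (cov_entry k 0 x)"
  unfolding pos_def_on_def
proof (intro allI impI)
  fix w :: "nat \<Rightarrow> real" assume w: "\<exists>i<n. w i \<noteq> 0"
  define q where "q = (\<Sum>i<n. \<Sum>j<n. w i * w j * k (x i - x j))"
  have "q \<ge> 0" unfolding q_def by (intro stationary_covariance_psd[OF k]) simp
  have "k 0 \<ge> 0" using stationary_covariance_psd[OF k, of "{0::nat}" "\<lambda>_. 1" "\<lambda>_. 0"] by simp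
  have "q \<noteq> 0"
  proof
    assume q: "q = 0"
    have zero: "(\<Sum>i<n. w i * k (y - x i)) = 0" for y
    proof -
      define h where "h = (\<Sum>i<n. w i * k (y - x i))"
      have even: "k (x i - y) = k (y - x i)" for i
        using stationary_covariance_even[OF k, of "y - x i"] by simp
      \<comment> \<open>Semidefiniteness at the given points together with y, which carries the
        weight l.\<close>
      have quad: "0 \<le> 2 * l * h + l\<^sup>2 * k 0" for l
      proof -
        define v where "v i = (if i < n then w i else l)" for i
        define p where "p i = (if i < n then x i else y)" for i
        have "0 \<le> (\<Sum>i<Suc n. \<Sum>j<Suc n. v i * v j * k (p i - p j))"
          by (intro stationary_covariance_psd[OF k]) simp
        also have "\<dots> = (\<Sum>i<n. (\<Sum>j<n. w i * w j * k (x i - x j)) + w i * l * k (x i - y))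
            + ((\<Sum>j<n. l * w j * k (y - x j)) + l * l * k 0)"
          by (simp add: v_def p_def)
        also have "\<dots> = q + 2 * l * h + l\<^sup>2 * k 0"
          by (simp add: q_def h_def even sum.distrib sum_distrib_left power2_eq_square mult_ac)
        finally show ?thesis using q by simp
      qed
      \<comment> \<open>The minimiser in l of the quadratic, at which its value is - h^2 / k
        0.\<close>
      have "0 \<le> 2 * (- h / k 0) * h + (- h / k 0)\<^sup>2 * k 0" by (rule quad)
      also have "\<dots> = - (h\<^sup>2 / k 0)" using k0 by (simp add: power2_eq_square field_simps)
      finally have "h\<^sup>2 / k 0 \<le> 0" by simp
      then have "h\<^sup>2 \<le> 0" using \<open>k 0 \<ge> 0\<close> k0 by (simp add: divide_le_0_iff)
      then show ?thesis by (simp add: h_def)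
    qed
    define a where "a t = w (the_inv_into {..<n} x t)" for t
    have a: "a (x i) = w i" if "i < n" for i
      unfolding a_def using that x by (subst the_inv_into_f_f) auto
    obtain i where i: "i < n" "w i \<noteq> 0" using w by blast
    have "k 0 = 0"
    proof (rule translates_independent[OF cont int bound, of "x ` {..<n}" a "x i"])
      show "(\<Sum>t\<in>x ` {..<n}. a t * k (y - t)) = 0" for y
        using zero[of y] by (simp add: sum.reindex[OF x] a)
    qed (use i a in auto)
    then show False using k0 by simp
  qed
  then show "0 < (\<Sum>i<n. \<Sum>j<n. w i * w j * cov_entry k 0 x i j)"
    using \<open>q \<ge> 0\<close> by (simp add: quadratic_cov_entry q_def)
qed

section \<open>Measurability and continuity of the divergence\<close>

text \<open>Cramer's rule: a ratio of polynomials in the entries, valid also for singular matrices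
  because 1 / 0 = 0. Measurability thus holds on all designs, and continuity where the determinant
  does not vanish.\<close>

lemma prec_entry_eq_cofactor:
  assumes ij: "i < n" "j < n"
  shows "prec_entry k \<delta> n x i j = 1 / Determinant.det (Matrix.mat n n (\<lambda>(a, b). cov_entry k \<delta> x a b)) *
    ((- 1) ^ (j + i) * Determinant.det (Matrix.mat (n - 1) (n - 1)
        (\<lambda>(a, b). cov_entry k \<delta> x (if a < j then a else Suc a) (if b < i then b else Suc b))))"
proof -
  let ?A = "cov_matrix k \<delta> n x"
  have d: "dim_row ?A = n" "dim_col ?A = n" by (simp_all add: cov_matrix_def)
  have e: "a < n \<Longrightarrow> b < n \<Longrightarrow> ?A $$ (a, b) = cov_entry k \<delta> x a b" for a b by (simp add: cov_matrix_eq)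
  have del: "mat_delete ?A j i = Matrix.mat (n - 1) (n - 1)
      (\<lambda>(a, b). cov_entry k \<delta> x (if a < j then a else Suc a) (if b < i then b else Suc b))"
    unfolding mat_delete_def d by (intro eq_matI) (auto simp: e)
  have "prec_entry k \<delta> n x i j = 1 / Determinant.det ?A * cofactor ?A j i"
    unfolding prec_entry_def mat_inv_eq_adj[OF cov_matrix_carrier] adj_mat_def using ij by (simp add: d)
  then show ?thesis unfolding cofactor_def del by (simp add: cov_matrix_eq)
qed

lemma borel_measurable_prec_entry:
  assumes "\<And>i j. i < n \<Longrightarrow> j < n \<Longrightarrow> (\<lambda>t. cov_entry (k t) (\<delta> t) (x t) i j) \<in> borel_measurable N"
    and ij: "i < n" "j < n"
  shows "(\<lambda>t. prec_entry (k t) (\<delta> t) n (x t) i j) \<in> borel_measurable N"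
  unfolding prec_entry_eq_cofactor[OF ij]
  by (intro borel_measurable_times borel_measurable_divide borel_measurable_const borel_measurable_det assms(1))
     (use ij in auto)

lemma continuous_on_prec_entry:
  assumes "\<And>i j. i < n \<Longrightarrow> j < n \<Longrightarrow> continuous_on S (\<lambda>t. cov_entry (k t) (\<delta> t) x i j)"
    and det: "\<And>t. t \<in> S \<Longrightarrow> Determinant.det (cov_matrix (k t) (\<delta> t) n x) \<noteq> 0"
    and ij: "i < n" "j < n"
  shows "continuous_on S (\<lambda>t. prec_entry (k t) (\<delta> t) n x i j)"
  unfolding prec_entry_eq_cofactor[OF ij]
  by (intro continuous_on_mult continuous_on_divide continuous_on_const continuous_on_det assms(1))
     (use ij det in \<open>auto simp: cov_matrix_eq\<close>)

lemma det_mat_inv_cov: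
  "n \<ge> 1 \<Longrightarrow> Determinant.det (mat_inv (cov_matrix k \<delta> n x)) = 1 / Determinant.det (cov_matrix k \<delta> n x)"
  using det_mat_inv[OF cov_matrix_carrier[of k \<delta> n x]]
  by (cases "Determinant.det (cov_matrix k \<delta> n x) = 0") auto

text \<open>Designs enter through their first n points, so \<open>X\<close> may be exchanged for its
  restriction to {..<n}, an element of the product space.\<close>

lemma cov_matrix_cong: "(\<And>i. i < n \<Longrightarrow> x i = x' i) \<Longrightarrow> cov_matrix k \<delta> n x = cov_matrix k \<delta> n x'"
  by (auto simp: cov_matrix_def intro!: cong_mat)

lemma kl_div_cong: "(\<And>i. i < n \<Longrightarrow> x i = x' i) \<Longrightarrow> kl_div K \<delta> K0 \<delta>0 n x \<theta> = kl_div K \<delta> K0 \<delta>0 n x' \<theta>"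
  unfolding kl_div_def using cov_matrix_cong[of n x x'] by metis

lemma prec_entry_cong: "(\<And>i. i < n \<Longrightarrow> x i = x' i) \<Longrightarrow> prec_entry k \<delta> n x i j = prec_entry k \<delta> n x' i j"
  unfolding prec_entry_def using cov_matrix_cong[of n x x'] by metis

section \<open>The divergence as a function of design and parameter\<close>

lemma borel_measurable_cov_entry:
  fixes k :: "'a::{real_normed_vector, second_countable_topology} \<Rightarrow> real" and x :: "'n \<Rightarrow> nat \<Rightarrow> 'a::{real_normed_vector, second_countable_topology}"
  assumes [measurable]: "k \<in> borel_measurable borel"
    and [measurable]: "(\<lambda>t. x t i) \<in> borel_measurable N" "(\<lambda>t. x t j) \<in> borel_measurable N"
  shows "(\<lambda>t. cov_entry k \<delta> (x t) i j) \<in> borel_measurable N"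
  unfolding cov_entry_def by measurable

lemma borel_measurable_kl_div:
  fixes K :: "'q \<Rightarrow> 'a::{real_normed_vector, second_countable_topology} \<Rightarrow> real"
  assumes n: "n \<ge> 1" and K: "K \<theta> \<in> borel_measurable borel" and K0: "K0 \<in> borel_measurable borel"
    and x: "\<And>i. i < n \<Longrightarrow> (\<lambda>t. x t i) \<in> borel_measurable N"
  shows "(\<lambda>t. kl_div K \<delta> K0 \<delta>0 n (x t) \<theta>) \<in> borel_measurable N"
  unfolding kl_div_eq det_mat_inv_cov[OF n]
  unfolding cov_matrix_eq
  by (intro borel_measurable_diff borel_measurable_times borel_measurable_const borel_measurable_add
      borel_measurable_ln borel_measurable_divide borel_measurable_det borel_measurable_sum borel_measurable_prec_entry
      borel_measurable_cov_entry K K0 x) auto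

lemma continuous_on_kl_div:
  assumes n: "n \<ge> 1" and K: "\<And>t. continuous_on S (\<lambda>\<theta>. K \<theta> t)" and \<delta>: "continuous_on S \<delta>"
    and pd: "\<And>\<theta>. \<theta> \<in> S \<Longrightarrow> pos_def_on n (cov_entry (K \<theta>) (\<delta> \<theta>) x)"
  shows "continuous_on S (kl_div K \<delta> K0 \<delta>0 n x)"
proof -
  have e: "continuous_on S (\<lambda>\<theta>. cov_entry (K \<theta>) (\<delta> \<theta>) x i j)" for i j
    unfolding cov_entry_def using K \<delta> by (cases "i = j") (auto intro!: continuous_intros)
  have d: "Determinant.det (cov_matrix (K \<theta>) (\<delta> \<theta>) n x) > 0" if "\<theta> \<in> S" for \<theta>
    using pd[OF that] by (rule det_cov_matrix_pos)
  have dn: "Determinant.det (cov_matrix (K \<theta>) (\<delta> \<theta>) n x) \<noteq> 0" if "\<theta> \<in> S" for \<theta>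
    using d[OF that] by simp
  have dc: "continuous_on S (\<lambda>\<theta>. Determinant.det (cov_matrix (K \<theta>) (\<delta> \<theta>) n x))"
    unfolding cov_matrix_eq by (intro continuous_on_det e)
  define c where "c = Determinant.det (mat_inv (cov_matrix K0 \<delta>0 n x))"
  have "continuous_on S (\<lambda>\<theta>. ln (Determinant.det (cov_matrix (K \<theta>) (\<delta> \<theta>) n x) * c))"
  \<comment> \<open>c vanishes when the true covariance matrix is singular; the argument of the
    logarithm is then constantly 0.\<close>
  proof (cases "c = 0")
    case False
    then show ?thesis using d by (intro continuous_on_ln continuous_on_mult dc continuous_on_const) force
  qed simp
  note lnc = this
  show ?thesis
    unfolding kl_div_eq c_def[symmetric]
    by (intro continuous_on_diff continuous_on_mult continuous_on_add continuous_on_const continuous_on_sum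
        lnc continuous_on_prec_entry e dn) auto
qed

text \<open>The random parameter is a limit of simple functions, and for these the claim reduces to
  finitely many fixed parameters; continuity passes to the limit. The approximations may leave the
  box, and \<open>clamp\<close> brings them back continuously.\<close>

lemma borel_measurable_caratheodory:
  fixes f :: "'x \<Rightarrow> 'b::euclidean_space \<Rightarrow> real"
  assumes meas: "\<And>\<theta>. \<theta> \<in> cbox a b \<Longrightarrow> (\<lambda>x. f x \<theta>) \<in> borel_measurable N"
    and cont: "\<And>x. x \<in> space N \<Longrightarrow> continuous_on (cbox a b) (f x)"
    and g: "g \<in> borel_measurable N" and ne: "cbox a b \<noteq> {}"
  shows "(\<lambda>x. f x (clamp a b (g x))) \<in> borel_measurable N"
proof -
  have ab: "\<And>i. i \<in> Basis \<Longrightarrow> inner a i \<le> inner b i" using ne by (simp add: box_ne_empty)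
  then have cl: "clamp a b y \<in> cbox a b" for y by (rule clamp_in_interval)
  obtain F where F: "\<And>i. simple_function N (F i)" "\<And>x. x \<in> space N \<Longrightarrow> (\<lambda>i. F i x) \<longlonglongrightarrow> g x"
    using borel_measurable_implies_sequence_metric[OF g, of 0] by blast
  show ?thesis
  proof (rule borel_measurable_LIMSEQ_real)
    fix x assume x: "x \<in> space N"
    have "(\<lambda>i. clamp a b (F i x)) \<longlonglongrightarrow> clamp a b (g x)"
      using isCont_tendsto_compose[OF _ F(2)[OF x], of "clamp a b"] clamp_continuous_at[of a b "\<lambda>x. x" "g x"] ab
      by (simp add: continuous_at_imp_continuous_on)
    then show "(\<lambda>i. f x (clamp a b (F i x))) \<longlonglongrightarrow> f x (clamp a b (g x))"
      using cl by (intro continuous_on_tendsto_compose[OF cont[OF x]]) auto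
  next
    fix i
    define I where "I = F i ` space N"
    have fin: "finite I" unfolding I_def using F(1)[of i] by (rule simple_functionD)
    show "(\<lambda>x. f x (clamp a b (F i x))) \<in> borel_measurable N"
    proof (rule measurable_compose_countable'[where f = "\<lambda>y x. f x (clamp a b y)" and g = "F i" and I = I])
      show "(\<lambda>x. f x (clamp a b y)) \<in> borel_measurable N" for y using meas cl by blast
      show "F i \<in> N \<rightarrow>\<^sub>M count_space I"
        using F(1)[of i] fin by (auto simp: measurable_count_space_eq2 I_def simple_function_def)
    qed (use fin in \<open>rule countable_finite\<close>)
  qed
qed

text \<open>By continuity the infimum equals the one over a countable dense subset. Compactness
  bounds the values from below, so that the real infimum is a genuine one.\<close>

lemma borel_measurable_INF_continuous:
  fixes f :: "'x \<Rightarrow> 'b::euclidean_space \<Rightarrow> real"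
  assumes meas: "\<And>\<theta>. \<theta> \<in> S \<Longrightarrow> (\<lambda>x. f x \<theta>) \<in> borel_measurable N"
    and cont: "\<And>x. x \<in> space N \<Longrightarrow> continuous_on S (f x)"
    and S: "compact S" "S \<noteq> {}"
  shows "(\<lambda>x. INF \<theta>\<in>S. f x \<theta>) \<in> borel_measurable N"
proof -
  obtain Q where Q: "countable Q" "Q \<subseteq> S" "S \<subseteq> closure Q" using separable[of S] by blast
  have clQ: "closure Q = S" using Q closure_minimal[of Q S] compact_imp_closed[OF S(1)] by blast
  have Qne: "Q \<noteq> {}" using clQ S(2) by auto
  have bdd: "bdd_below (f x ` S)" if "x \<in> space N" for x
    using compact_continuous_image[OF cont[OF that] S(1)] by (intro bounded_imp_bdd_below compact_imp_bounded)
  have bddQ: "bdd_below (f x ` Q)" if "x \<in> space N" for x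
    using bdd[OF that] Q(2) by (meson bdd_below_mono image_mono)
  have eq: "(INF \<theta>\<in>S. f x \<theta>) = (INF \<theta>\<in>Q. f x \<theta>)" if x: "x \<in> space N" for x
  proof (rule antisym)
    show "(INF \<theta>\<in>S. f x \<theta>) \<le> (INF \<theta>\<in>Q. f x \<theta>)" using Qne Q(2) bdd[OF x] by (intro cINF_superset_mono) auto
    have bQ: "bdd_below (f x ` Q)" using bddQ[OF x] .
    show "(INF \<theta>\<in>Q. f x \<theta>) \<le> (INF \<theta>\<in>S. f x \<theta>)"
    proof (rule cINF_greatest[OF S(2)])
      fix \<theta> assume "\<theta> \<in> S"
      then show "(INF \<theta>\<in>Q. f x \<theta>) \<le> f x \<theta>"
        using cont[OF x] bQ unfolding clQ[symmetric]
        by (intro continuous_ge_on_closure[of Q "f x" \<theta>]) (auto intro: cINF_lower)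
    qed
  qed
  have "(\<lambda>x. INF \<theta>\<in>Q. f x \<theta>) \<in> borel_measurable N"
    using Q(1,2) meas bddQ by (intro borel_measurable_cINF) auto
  then show ?thesis by (subst measurable_cong[OF eq])
qed

section \<open>Uniform observation points\<close>

definition decay :: "'a::euclidean_space \<Rightarrow> real" where
  "decay t = 1 / (1 + infnorm t ^ (DIM('a) + 1))"

lemma decay_bounds: "0 < decay t" "decay t \<le> 1"
proof -
  have "0 \<le> infnorm t ^ (DIM('a) + 1)" by (simp add: infnorm_pos_le)
  then show "0 < decay t" "decay t \<le> 1" unfolding decay_def by (simp_all add: add_pos_nonneg field_simps)
qed

lemma decay_even: "decay (- t) = decay t"
  by (simp add: decay_def infnorm_neg)

lemma borel_measurable_decay [measurable]: "decay \<in> borel_measurable borel"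
proof -
  have "continuous_on UNIV (decay :: 'a \<Rightarrow> real)"
    unfolding decay_def
  proof (intro continuous_intros continuous_on_infnorm ballI)
    fix t :: 'a
    have "0 \<le> infnorm t ^ (DIM('a) + 1)" by (simp add: infnorm_pos_le)
    then show "1 + infnorm t ^ (DIM('a) + 1) \<noteq> 0" by linarith
  qed
  then show ?thesis by (rule borel_measurable_continuous_onI)
qed

text \<open>Cover the space by cubes of half side 2^k: the volume grows like 2^(k d) while the
  exponent d + 1 makes \<open>decay\<close> of order 2^(-k (d + 1)) near the faces, and a geometric
  series remains.\<close>

lemma nn_integral_decay_finite: "(\<integral>\<^sup>+t. ennreal (decay (t :: 'a::euclidean_space)) \<partial>lborel) < \<infinity>"
proof -
  define d where "d = DIM('a)"
  define B :: "nat \<Rightarrow> 'a set" where "B k = cbox (- (2 ^ k) *\<^sub>R One) (2 ^ k *\<^sub>R One)" for k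
  \<comment> \<open>Bounds \<open>decay t\<close> when the infinity norm of t exceeds 2^(k - 1); for
    k = 0 it is at least 1, hence trivial.\<close>
  define c :: "nat \<Rightarrow> real" where "c k = 2 ^ (d + 1) / 2 ^ (k * (d + 1))" for k
  have inB: "t \<in> B k" if "infnorm t \<le> 2 ^ k" for t k
    unfolding B_def mem_box
  proof
    fix b :: 'a assume b: "b \<in> Basis"
    have "\<bar>inner t b\<bar> \<le> 2 ^ k" using Basis_le_infnorm[OF b, of t] that by linarith
    then show "inner (- (2 ^ k) *\<^sub>R One) b \<le> inner t b \<and> inner t b \<le> inner (2 ^ k *\<^sub>R One) b"
      using b by (simp add: abs_le_iff inner_sum_left_Basis)
  qed
  have dom: "ennreal (decay t) \<le> (\<Sum>k. ennreal (c k) * indicator (B k) t)" for t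
  proof -
    have "\<exists>k. decay t \<le> c k \<and> infnorm t \<le> 2 ^ k"
    proof (cases "infnorm t \<le> 1")
      case True
      have "(1::real) \<le> 2 ^ (d + 1)" by (rule one_le_power) simp
      then have "decay t \<le> c 0" using decay_bounds(2)[of t] by (simp add: c_def)
      with True show ?thesis by (intro exI[of _ 0]) simp
    next
      case False
      define k where "k = (LEAST k. infnorm t \<le> 2 ^ k)"
      have ex: "\<exists>k. infnorm t \<le> 2 ^ k"
        using real_arch_pow[of 2 "infnorm t"] by (auto intro: less_imp_le)
      have k: "infnorm t \<le> 2 ^ k" unfolding k_def using ex by (rule LeastI_ex)
      have "k \<noteq> 0" using k False by (intro notI) simp
      then obtain m where m: "k = Suc m" by (cases k) auto
      have "\<not> infnorm t \<le> 2 ^ m" using not_less_Least[of m "\<lambda>k. infnorm t \<le> 2 ^ k"] m by (simp add: k_def)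
      then have "(2 ^ m) ^ (d + 1) \<le> infnorm t ^ (d + 1)" by (intro power_mono) auto
      also have "\<dots> \<le> 1 + infnorm t ^ (d + 1)" by simp
      finally have "decay t \<le> 1 / (2 ^ m) ^ (d + 1)" unfolding decay_def d_def
        by (intro divide_left_mono mult_pos_pos) (auto simp: add_pos_nonneg infnorm_pos_le)
      also have "\<dots> = c k" by (simp add: c_def m power_add power_mult[symmetric] field_simps)
      finally show ?thesis using k by blast
    qed
    then obtain k where k: "decay t \<le> c k" "infnorm t \<le> 2 ^ k" by blast
    have "ennreal (decay t) \<le> (\<Sum>j\<in>{k}. ennreal (c j) * indicator (B j) t)"
      using k inB[of t k] by (simp add: ennreal_leI)
    also have "\<dots> \<le> (\<Sum>j. ennreal (c j) * indicator (B j) t)" by (rule sum_le_suminf) auto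
    finally show ?thesis .
  qed
  have em: "emeasure lborel (B k) = ennreal ((2 * 2 ^ k) ^ d)" for k
  proof -
    have "emeasure lborel (B k) = ennreal (\<Prod>b\<in>(Basis :: 'a set). inner (2 ^ k *\<^sub>R One - (- (2 ^ k) *\<^sub>R One)) b)"
      unfolding B_def by (rule emeasure_lborel_cbox) (simp add: inner_sum_left_Basis)
    also have "(\<Prod>b\<in>(Basis :: 'a set). inner (2 ^ k *\<^sub>R One - (- (2 ^ k) *\<^sub>R One)) b) = (\<Prod>b\<in>(Basis :: 'a set). 2 * 2 ^ k)"
      by (intro prod.cong refl) (simp add: inner_diff_left inner_add_left inner_sum_left_Basis)
    also have "\<dots> = (2 * 2 ^ k) ^ d" by (simp add: d_def)
    finally show ?thesis .
  qed
  have "(\<integral>\<^sup>+t. ennreal (decay (t :: 'a)) \<partial>lborel) \<le> (\<integral>\<^sup>+t. (\<Sum>k. ennreal (c k) * indicator (B k) t) \<partial>lborel)"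
    by (intro nn_integral_mono dom)
  also have "\<dots> = (\<Sum>k. \<integral>\<^sup>+t. ennreal (c k) * indicator (B k) t \<partial>lborel)"
    by (rule nn_integral_suminf) (auto simp: B_def)
  also have "\<dots> = (\<Sum>k. ennreal (2 ^ (2 * d + 1) * (1 / 2) ^ k))"
  proof (intro suminf_cong)
    fix k
    have "(\<integral>\<^sup>+t. ennreal (c k) * indicator (B k) t \<partial>lborel) = ennreal (c k) * emeasure lborel (B k)"
      by (rule nn_integral_cmult_indicator) (simp add: B_def)
    also have "\<dots> = ennreal (c k * (2 * 2 ^ k) ^ d)" unfolding em by (subst ennreal_mult) (auto simp: c_def)
    also have "c k * (2 * 2 ^ k) ^ d = 2 ^ (2 * d + 1) * (1 / 2) ^ k"
    proof -
      have 1: "(2 * 2 ^ k :: real) ^ d = 2 ^ d * 2 ^ (k * d)" by (simp only: power_mult_distrib power_mult)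
      have 2: "(2 :: real) ^ (k * (d + 1)) = 2 ^ (k * d) * 2 ^ k"
        by (simp only: distrib_left power_add mult_1_right)
      have 3: "(2 :: real) ^ (2 * d + 1) = 2 ^ (d + 1) * 2 ^ d"
      proof -
        have "2 * d + 1 = (d + 1) + d" by simp
        then show ?thesis by (simp only: power_add)
      qed
      have 4: "x / (a * b) * (y * a) = x * y * (1 / b)" if "a \<noteq> 0" "b \<noteq> 0" for x y a b :: real
        using that by simp
      have "c k * (2 * 2 ^ k) ^ d = 2 ^ (d + 1) * 2 ^ d * (1 / 2 ^ k)"
        unfolding c_def 1 2 by (rule 4) simp_all
      then show ?thesis unfolding 3 by (simp only: power_one_over)
    qed
    finally show "(\<integral>\<^sup>+t. ennreal (c k) * indicator (B k) t \<partial>lborel) = ennreal (2 ^ (2 * d + 1) * (1 / 2) ^ k)" .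
  qed
  also have "\<dots> = ennreal (\<Sum>k. 2 ^ (2 * d + 1) * (1 / 2) ^ k)"
    by (intro suminf_ennreal_eq[OF _ summable_sums]) (auto intro!: summable_mult summable_geometric)
  also have "\<dots> < \<infinity>" by simp
  finally show ?thesis .
qed

lemma integrable_decay: "integrable lborel (decay :: 'a::euclidean_space \<Rightarrow> real)"
proof (rule integrableI_bounded)
  have "norm (decay t) = decay t" for t :: 'a using decay_bounds(1)[of t] by simp
  then show "(\<integral>\<^sup>+t. ennreal (norm (decay (t :: 'a))) \<partial>lborel) < \<infinity>"
    using nn_integral_decay_finite[where 'a = 'a] by simp
qed simp

text \<open>Enlarging A to the whole space and translating removes y, so points near the boundary of
  A are treated like all others.\<close>

lemma nn_integral_uniform_convolution:
  fixes h :: "'a::euclidean_space \<Rightarrow> ennreal"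
  assumes h [measurable]: "h \<in> borel_measurable borel" and even: "\<And>t. h (- t) = h t" and A: "A \<in> sets borel"
  shows "(\<integral>\<^sup>+t. h (y - t) \<partial>uniform_measure lborel A) \<le> (\<integral>\<^sup>+t. h t \<partial>lborel) / emeasure lborel A"
proof -
  have A' [measurable]: "A \<in> sets lborel" using A by simp
  have "(\<integral>\<^sup>+t. h (y - t) \<partial>uniform_measure lborel A) = (\<integral>\<^sup>+t. h (y - t) * indicator A t \<partial>lborel) / emeasure lborel A"
    by (rule nn_integral_uniform_measure) (use A in auto)
  also have "(\<integral>\<^sup>+t. h (y - t) * indicator A t \<partial>lborel) \<le> (\<integral>\<^sup>+t. h (- y + t) \<partial>lborel)"
  proof (rule nn_integral_mono)
    fix t show "h (y - t) * indicator A t \<le> h (- y + t)"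
      using even[of "y - t"] by (auto simp: indicator_def)
  qed
  also have "(\<integral>\<^sup>+t. h (- y + t) \<partial>lborel) = (\<integral>\<^sup>+t. h t \<partial>(distr lborel borel ((+) (- y))))"
    by (subst nn_integral_distr) auto
  also have "\<dots> = (\<integral>\<^sup>+t. h t \<partial>lborel)" by (simp only: lborel_distr_plus)
  finally show ?thesis by (simp add: divide_right_mono_ennreal)
qed

section \<open>Exponential moments of row sums\<close>

definition neighbour_sum :: "nat \<Rightarrow> (nat \<Rightarrow> 'a::euclidean_space) \<Rightarrow> nat \<Rightarrow> real" where
  "neighbour_sum n x i = (\<Sum>j\<in>{..<n} - {i}. decay (x i - x j))"

text \<open>The weight is infinite at coinciding points, so the bound also shows that
  the points are almost surely distinct.\<close>

definition pair_weight :: "'a::euclidean_space \<Rightarrow> ennreal" where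
  "pair_weight t = (if t = 0 then \<infinity> else ennreal (exp (decay t)))"

lemma borel_measurable_pair_weight [measurable]: "pair_weight \<in> borel_measurable borel"
  unfolding pair_weight_def[abs_def] by measurable

lemma prod_mono_ennreal:
  fixes f g :: "'b \<Rightarrow> ennreal"
  assumes "\<And>i. i \<in> I \<Longrightarrow> f i \<le> g i"
  shows "prod f I \<le> prod g I"
  using assms
proof (induction I rule: infinite_finite_induct)
  case (insert i I)
  have "f i * prod f I \<le> g i * prod g I" using insert by (intro mult_mono) auto
  then show ?case using insert.hyps by simp
qed auto

lemma exp_neighbour_sum_le: "ennreal (exp (neighbour_sum n x i)) \<le> (\<Prod>j\<in>{..<n} - {i}. pair_weight (x i - x j))"
proof -
  have "ennreal (exp (neighbour_sum n x i)) = (\<Prod>j\<in>{..<n} - {i}. ennreal (exp (decay (x i - x j))))"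
    by (simp add: neighbour_sum_def exp_sum prod_ennreal)
  also have "\<dots> \<le> (\<Prod>j\<in>{..<n} - {i}. pair_weight (x i - x j))"
    by (intro prod_mono_ennreal) (simp add: pair_weight_def)
  finally show ?thesis .
qed

lemma pair_weight_pos: "1 \<le> pair_weight t"
proof -
  have "ennreal 1 \<le> ennreal (exp (decay t))" using decay_bounds(1)[of t] by (intro ennreal_leI) simp
  then show ?thesis by (simp add: pair_weight_def)
qed

text \<open>Infinity times 0 is 0 in the extended nonnegative reals; the remaining factors are
  therefore first shown to be at least 1.\<close>

lemma prod_pair_weight_top:
  fixes n i j :: nat
  assumes "j \<in> {..<n} - {i}" "x i = x j"
  shows "(\<Prod>j\<in>{..<n} - {i}. pair_weight (x i - x j)) = \<infinity>"
proof -
  have "(\<Prod>m\<in>{..<n} - {i} - {j}. 1) \<le> (\<Prod>m\<in>{..<n} - {i} - {j}. pair_weight (x i - x m))"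
    by (intro prod_mono_ennreal pair_weight_pos)
  then have "1 \<le> (\<Prod>m\<in>{..<n} - {i} - {j}. pair_weight (x i - x m))" by (simp only: prod.neutral_const)
  then have "(\<Prod>m\<in>{..<n} - {i} - {j}. pair_weight (x i - x m)) \<noteq> 0" by (metis not_one_le_zero)
  moreover have "(\<Prod>m\<in>{..<n} - {i}. pair_weight (x i - x m)) =
      pair_weight (x i - x j) * (\<Prod>m\<in>{..<n} - {i} - {j}. pair_weight (x i - x m))"
    by (rule prod.remove) (use assms in auto)
  moreover have "pair_weight (x i - x j) = \<infinity>" using assms(2) by (simp add: pair_weight_def)
  ultimately show ?thesis by (simp add: ennreal_top_mult)
qed

text \<open>The weight is infinite at t = y alone, a null set; elsewhere exp s \<le> 1 + s + s^2
  \<le> 1 + 2 s for s in [0, 1]. The average of \<open>decay\<close> over A is at most its full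
  integral divided by the volume.\<close>

lemma nn_integral_pair_weight_le:
  fixes A :: "'a::euclidean_space set"
  assumes A: "A \<in> sets borel" "emeasure lborel A = ennreal v" "v > 0"
  defines "c \<equiv> enn2real (\<integral>\<^sup>+t. ennreal (decay (t :: 'a)) \<partial>lborel)"
  shows "(\<integral>\<^sup>+t. pair_weight (y - t) \<partial>uniform_measure lborel A) \<le> ennreal (1 + 2 * c / v)"
proof -
  interpret prob_space "uniform_measure lborel A"
    by (rule prob_space_uniform_measure) (use A in auto)
  have "AE t in lborel. t \<noteq> y"
    by (rule AE_lborel_singleton)
  then have ae: "AE t in uniform_measure lborel A. t \<noteq> y"
    by (intro AE_uniform_measureI) (use A in auto)
  have e: "exp (decay s) \<le> 1 + 2 * decay s" for s :: 'a
  proof -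
    have "exp (decay s) \<le> 1 + decay s + (decay s)\<^sup>2" using decay_bounds[of s] by (intro exp_bound) auto
    moreover have "(decay s)\<^sup>2 \<le> decay s"
      using decay_bounds[of s] mult_left_mono[of "decay s" 1 "decay s"] by (simp add: power2_eq_square)
    ultimately show ?thesis by simp
  qed
  have "(\<integral>\<^sup>+t. pair_weight (y - t) \<partial>uniform_measure lborel A) \<le> (\<integral>\<^sup>+t. 1 + 2 * ennreal (decay (y - t)) \<partial>uniform_measure lborel A)"
  proof (rule nn_integral_mono_AE)
    show "AE t in uniform_measure lborel A. pair_weight (y - t) \<le> 1 + 2 * ennreal (decay (y - t))"
      using ae
    proof eventually_elim
      fix t assume "t \<noteq> y"
      then have "pair_weight (y - t) \<le> ennreal (1 + 2 * decay (y - t))"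
        using e[of "y - t"] by (simp add: pair_weight_def ennreal_leI)
      also have "\<dots> = 1 + 2 * ennreal (decay (y - t))"
        using decay_bounds(1)[of "y - t"] by (simp add: ennreal_plus ennreal_mult less_imp_le)
      finally show "pair_weight (y - t) \<le> 1 + 2 * ennreal (decay (y - t))" .
    qed
  qed
  also have "\<dots> = 1 + 2 * (\<integral>\<^sup>+t. ennreal (decay (y - t)) \<partial>uniform_measure lborel A)"
    using emeasure_space_1 by (subst nn_integral_add) (auto simp: nn_integral_cmult)
  also have "(\<integral>\<^sup>+t. ennreal (decay (y - t)) \<partial>uniform_measure lborel A) \<le> (\<integral>\<^sup>+t. ennreal (decay (t :: 'a)) \<partial>lborel) / emeasure lborel A"
    by (rule nn_integral_uniform_convolution) (use A in \<open>auto simp: decay_even\<close>)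
  also have "(\<integral>\<^sup>+t. ennreal (decay (t :: 'a)) \<partial>lborel) = ennreal c"
    using nn_integral_decay_finite[where 'a = 'a] by (simp add: c_def less_top)
  also have "ennreal c / emeasure lborel A = ennreal (c / v)"
    unfolding A(2) by (rule divide_ennreal) (use A in \<open>auto simp: c_def\<close>)
  also have "1 + 2 * ennreal (c / v) = ennreal (1 + 2 * c / v)"
  proof -
    have "0 \<le> c / v" using A(3) by (simp add: c_def)
    have "ennreal (2 * (c / v)) = ennreal 2 * ennreal (c / v)" by (rule ennreal_mult) (use \<open>0 \<le> c / v\<close> in auto)
    then show ?thesis using \<open>0 \<le> c / v\<close> by (simp add: ennreal_plus)
  qed
  finally show ?thesis by (simp add: add_left_mono mult_left_mono)
qed

text \<open>Once point i is fixed, the n - 1 remaining factors are independent, each with mean at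
  most 1 + 2 c / n because A has volume n. Their product stays below exp (2 c) for every n: the
  density of the points is constant.\<close>

lemma nn_integral_prod_pair_weight_le:
  fixes A :: "'a::euclidean_space set"
  assumes A: "A \<in> sets borel" "emeasure lborel A = ennreal (real n)" and i: "i < n"
  defines "c \<equiv> enn2real (\<integral>\<^sup>+t. ennreal (decay (t :: 'a)) \<partial>lborel)"
  shows "(\<integral>\<^sup>+x. (\<Prod>j\<in>{..<n} - {i}. pair_weight (x i - x j)) \<partial>PiM {..<n} (\<lambda>_. uniform_measure lborel A)) \<le> ennreal (exp (2 * c))"
proof -
  have n: "real n > 0" using i by simp
  define U where "U = uniform_measure lborel A"
  have setsU [measurable_cong]: "sets U = sets borel" by (simp add: U_def)
  interpret U: prob_space U unfolding U_def
    by (rule prob_space_uniform_measure) (use A n in auto)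
  interpret product_sigma_finite "\<lambda>_ :: nat. U" ..
  let ?J = "{..<n} - {i}"
  have eq: "{..<n} = insert i ?J" using i by auto
  have "(\<integral>\<^sup>+x. (\<Prod>j\<in>?J. pair_weight (x i - x j)) \<partial>PiM (insert i ?J) (\<lambda>_. U)) =
      (\<integral>\<^sup>+y. (\<integral>\<^sup>+x. (\<Prod>j\<in>?J. pair_weight ((x(i := y)) i - (x(i := y)) j)) \<partial>PiM ?J (\<lambda>_. U)) \<partial>U)"
    by (rule product_nn_integral_insert_rev) auto
  also have "\<dots> = (\<integral>\<^sup>+y. (\<integral>\<^sup>+x. (\<Prod>j\<in>?J. pair_weight (y - x j)) \<partial>PiM ?J (\<lambda>_. U)) \<partial>U)"
    by (intro nn_integral_cong prod.cong refl) auto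
  also have "\<dots> = (\<integral>\<^sup>+y. (\<Prod>j\<in>?J. \<integral>\<^sup>+t. pair_weight (y - t) \<partial>U) \<partial>U)"
    by (intro nn_integral_cong product_nn_integral_prod) auto
  also have "\<dots> \<le> (\<integral>\<^sup>+y. (\<Prod>j\<in>?J. ennreal (1 + 2 * c / real n)) \<partial>U)"
    unfolding U_def c_def by (intro nn_integral_mono prod_mono_ennreal nn_integral_pair_weight_le A n)
  also have "\<dots> = (\<Prod>j\<in>?J. ennreal (1 + 2 * c / real n))"
    using U.emeasure_space_1 by simp
  also have "\<dots> = ennreal ((1 + 2 * c / real n) ^ card ?J)"
    unfolding prod_constant by (rule ennreal_power) (simp add: c_def)
  also have "(1 + 2 * c / real n) ^ card ?J \<le> exp (2 * c / real n) ^ n"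
  proof -
    have c: "0 \<le> 2 * c / real n" by (simp add: c_def)
    have "(1 + 2 * c / real n) ^ card ?J \<le> (1 + 2 * c / real n) ^ n"
      using c i by (intro power_increasing) auto
    also have "\<dots> \<le> exp (2 * c / real n) ^ n"
      using c exp_ge_add_one_self[of "2 * c / real n"] by (intro power_mono) auto
    finally show ?thesis .
  qed
  also have "exp (2 * c / real n) ^ n = exp (2 * c)" using n by (simp add: exp_of_nat_mult[symmetric])
  finally show ?thesis unfolding eq[symmetric] U_def by (simp add: ennreal_leI)
qed

lemma neighbour_sum_nonneg: "0 \<le> neighbour_sum n x i"
  unfolding neighbour_sum_def by (intro sum_nonneg) (simp add: decay_bounds less_imp_le)

section \<open>The sampling model\<close>

lemma space_family_algebra [simp]: "space (family_algebra M I Z) = space M"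
  by (simp add: family_algebra_def)

lemma sets_family_algebra_subset:
  assumes "\<And>i. i \<in> I \<Longrightarrow> Z i \<in> borel_measurable M"
  shows "sets (family_algebra M I Z) \<subseteq> sets M"
proof -
  have m: "(\<lambda>\<omega>. \<lambda>i\<in>I. Z i \<omega>) \<in> M \<rightarrow>\<^sub>M (\<Pi>\<^sub>M i\<in>I. borel)"
    using assms by (intro measurable_restrict) auto
  show ?thesis
  proof
    fix B assume "B \<in> sets (family_algebra M I Z)"
    then obtain S where "S \<in> sets (\<Pi>\<^sub>M i\<in>I. borel)" "B = (\<lambda>\<omega>. \<lambda>i\<in>I. Z i \<omega>) -` S \<inter> space M"
      by (auto simp: family_algebra_def sets_vimage_algebra2 space_PiM)
    then show "B \<in> sets M" using measurable_sets[OF m] by blast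
  qed
qed

lemma measurable_family_algebra_restrict:
  "(\<lambda>\<omega>. \<lambda>i\<in>I. Z i \<omega>) \<in> family_algebra M I Z \<rightarrow>\<^sub>M (\<Pi>\<^sub>M i\<in>I. borel)"
  unfolding family_algebra_def by (rule measurable_vimage_algebra1) (auto simp: space_PiM)

lemma measurable_family_algebra_component:
  assumes "i \<in> I"
  shows "Z i \<in> borel_measurable (family_algebra M I Z)"
proof -
  have "(\<lambda>\<omega>. (\<lambda>i\<in>I. Z i \<omega>) i) \<in> borel_measurable (family_algebra M I Z)"
    by (rule measurable_compose[OF measurable_family_algebra_restrict measurable_component_singleton[OF assms]])
  then show ?thesis using assms by simp
qed

text \<open>One sample size at a time. The cube enters through its volume, so A is any Borel set of
  measure n.\<close>

locale spatial_sample = prob_space M for M :: "'w measure" +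
  fixes Y :: "'a::euclidean_space \<Rightarrow> 'w \<Rightarrow> real" and X :: "nat \<Rightarrow> 'w \<Rightarrow> 'a" and \<epsilon> :: "nat \<Rightarrow> 'w \<Rightarrow> real"
    and K0 :: "'a \<Rightarrow> real" and \<delta>0 :: real and n :: nat and A :: "'a set"
  assumes Y_gaussian: "centered_gaussian_family M UNIV Y (\<lambda>s t. K0 (s - t))"
    and Y_measurable: "measurable_process M Y"
    and \<epsilon>_gaussian: "centered_gaussian_family M {..<n} \<epsilon> (\<lambda>i j. if i = j then \<delta>0 else 0)"
    and X_indep: "indep_vars (\<lambda>_. borel) X {..<n}"
    and X_uniform: "\<And>i. i < n \<Longrightarrow> distr M borel (X i) = uniform_measure lborel A"
    and A: "A \<in> sets borel" "emeasure lborel A = ennreal (real n)"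
    and independent: "mutually_independent3 M (family_algebra M UNIV Y) (family_algebra M {..<n} X) (family_algebra M {..<n} \<epsilon>)"
    and n: "n \<ge> 1"
    and K0_cov: "stationary_covariance K0" and K0_meas: "K0 \<in> borel_measurable borel"
begin

section \<open>Sigma-algebras of process, points and noise\<close>

abbreviation "FY \<equiv> family_algebra M UNIV Y"
abbreviation "FX \<equiv> family_algebra M {..<n} X"
abbreviation "F\<epsilon> \<equiv> family_algebra M {..<n} \<epsilon>"

lemma measurable_Y: "Y t \<in> borel_measurable M"
  using Y_gaussian by (auto simp: centered_gaussian_family_def gaussian_family_def)

lemma measurable_\<epsilon>: "i < n \<Longrightarrow> \<epsilon> i \<in> borel_measurable M"
  using \<epsilon>_gaussian by (auto simp: centered_gaussian_family_def gaussian_family_def)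

lemma measurable_X: "i < n \<Longrightarrow> X i \<in> borel_measurable M"
  using X_indep by (auto simp: indep_vars_def2)

lemma subalgebras: "sets FY \<subseteq> sets M" "sets FX \<subseteq> sets M" "sets F\<epsilon> \<subseteq> sets M"
  by (intro sets_family_algebra_subset; use measurable_Y measurable_X measurable_\<epsilon> in force)+

text \<open>Process and noise taken together. Observations at a deterministic design are measurable
  for it and it is independent of the points, so that \<open>nn_integral_split\<close> can integrate
  over the design separately.\<close>

definition noise_algebra :: "'w measure" where
  "noise_algebra = sigma (space M) (sets FY \<union> sets F\<epsilon>)"

lemma space_noise_algebra [simp]: "space noise_algebra = space M"
  by (simp add: noise_algebra_def space_measure_of_conv)

lemma sets_noise_algebra: "sets noise_algebra = sigma_sets (space M) (sets FY \<union> sets F\<epsilon>)"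
proof -
  have "sets FY \<union> sets F\<epsilon> \<subseteq> Pow (space M)"
    using sets.space_closed[of FY] sets.space_closed[of F\<epsilon>] by auto
  then show ?thesis by (simp add: noise_algebra_def)
qed

lemma sets_noise_algebra_subset: "sets noise_algebra \<subseteq> sets M"
  unfolding sets_noise_algebra using subalgebras by (intro sets.sigma_sets_subset) auto

lemma noise_algebra_supset: "sets FY \<subseteq> sets noise_algebra" "sets F\<epsilon> \<subseteq> sets noise_algebra"
  unfolding sets_noise_algebra by (auto intro: sigma_sets.Basic)

lemma measurable_id_noise: "(\<lambda>\<omega>. \<omega>) \<in> M \<rightarrow>\<^sub>M noise_algebra"
  using sets_noise_algebra_subset by (intro measurableI) (auto simp: sets.Int_space_eq2 dest: sets.sets_into_space)

lemma measurable_id_FY: "(\<lambda>\<omega>. \<omega>) \<in> noise_algebra \<rightarrow>\<^sub>M FY"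
  using noise_algebra_supset(1) by (intro measurableI) (auto simp: sets.Int_space_eq2)

lemma measurable_\<epsilon>_noise: "i < n \<Longrightarrow> \<epsilon> i \<in> borel_measurable noise_algebra"
  using measurable_family_algebra_component[of i "{..<n}" \<epsilon> M] noise_algebra_supset(2)
  by (auto simp: measurable_def)

lemma indep3: "indep_sets (\<lambda>k::nat. [sets FY, sets FX, sets F\<epsilon>] ! k) {..<3}"
  using independent unfolding mutually_independent3_def .

lemma prob_FY_F\<epsilon>: "a \<in> sets FY \<Longrightarrow> b \<in> sets F\<epsilon> \<Longrightarrow> prob (a \<inter> b) = prob a * prob b"
  using indep_setsD[OF indep3, of "{0, 2}" "\<lambda>k. if k = 0 then a else b"] by (simp add: Int_commute)

lemma prob_FX_noise:
  assumes a: "a \<in> sets FX" and b: "b \<in> sets noise_algebra"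
  shows "prob (a \<inter> b) = prob a * prob b"
proof -
  let ?E = "\<lambda>k::nat. [sets FY, sets FX, sets F\<epsilon>] ! k"
  \<comment> \<open>Index 1 is the algebra of the points, 0 and 2 are those of process and noise;
    three independent algebras are grouped into two blocks.\<close>
  let ?I = "\<lambda>j. if j then {1} else {0, 2 :: nat}"
  have un: "(\<Union>j. ?I j) = {..<3}" by (auto simp: UNIV_bool)
  have "indep_sets (\<lambda>j. sigma_sets (space M) (\<Union>i\<in>?I j. ?E i)) UNIV"
  proof (rule indep_sets_collect_sigma)
    show "indep_sets ?E (\<Union>j\<in>UNIV. ?I j)" unfolding un by (rule indep3)
    show "Int_stable (?E i)" if "i \<in> ?I j" for i j
      using that by (auto simp: Int_stable_def split: if_splits)
    show "disjoint_family_on ?I UNIV" by (auto simp: disjoint_family_on_def)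
  qed
  from indep_setsD[OF this, of UNIV "\<lambda>j. if j then a else b"]
  have "a \<in> sigma_sets (space M) (sets FX) \<Longrightarrow> b \<in> sigma_sets (space M) (sets FY \<union> sets F\<epsilon>) \<Longrightarrow>
      prob (a \<inter> b) = prob a * prob b"
    by (simp add: UNIV_bool Int_commute mult.commute)
  then show ?thesis using a b unfolding sets_noise_algebra by blast
qed

definition design :: "(nat \<Rightarrow> 'a) measure" where
  "design = distr M (\<Pi>\<^sub>M i\<in>{..<n}. borel) (\<lambda>\<omega>. \<lambda>i\<in>{..<n}. X i \<omega>)"

lemma sets_design [measurable_cong]: "sets design = sets (\<Pi>\<^sub>M i\<in>{..<n}. borel)"
  by (simp add: design_def)

lemma measurable_X_restrict: "(\<lambda>\<omega>. \<lambda>i\<in>{..<n}. X i \<omega>) \<in> M \<rightarrow>\<^sub>M (\<Pi>\<^sub>M i\<in>{..<n}. borel)"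
  using measurable_X by (intro measurable_restrict) auto

lemma design_eq: "design = PiM {..<n} (\<lambda>_. uniform_measure lborel A)"
proof -
  have "0 \<in> {..<n}" using n by simp
  then have "{..<n} \<noteq> {}" by blast
  then have "design = PiM {..<n} (\<lambda>i. distr M borel (X i))"
    using X_indep measurable_X unfolding design_def
    by (subst (asm) indep_vars_iff_distr_eq_PiM') auto
  also have "\<dots> = PiM {..<n} (\<lambda>_. uniform_measure lborel A)"
    by (intro PiM_cong refl X_uniform) auto
  finally show ?thesis .
qed

lemma prob_space_design: "prob_space design"
  unfolding design_def by (rule prob_space_distr[OF measurable_X_restrict])

text \<open>Takes the place of conditioning on the observation points.\<close>

lemma nn_integral_split:
  assumes F: "F \<in> borel_measurable ((\<Pi>\<^sub>M i\<in>{..<n}. borel) \<Otimes>\<^sub>M noise_algebra)"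
  shows "(\<integral>\<^sup>+\<omega>. F (\<lambda>i\<in>{..<n}. X i \<omega>, \<omega>) \<partial>M) = (\<integral>\<^sup>+x. (\<integral>\<^sup>+\<omega>. F (x, \<omega>) \<partial>M) \<partial>design)"
proof -
  let ?P = "\<Pi>\<^sub>M i\<in>{..<n}. (borel :: 'a measure)"
  \<comment> \<open>M restricted to \<open>noise_algebra\<close>, the algebra for which the
    integrand is jointly measurable.\<close>
  let ?N = "distr M noise_algebra (\<lambda>\<omega>. \<omega>)"
  let ?Z = "\<lambda>\<omega>. (\<lambda>i\<in>{..<n}. X i \<omega>, \<omega>)"
  interpret D: prob_space design by (rule prob_space_design)
  interpret N: prob_space ?N by (rule prob_space_distr[OF measurable_id_noise])
  have Z: "?Z \<in> M \<rightarrow>\<^sub>M ?P \<Otimes>\<^sub>M noise_algebra"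
    by (rule measurable_Pair[OF measurable_X_restrict measurable_id_noise])
  \<comment> \<open>By independence the joint law is a product; comparing both measures on
    rectangles is enough.\<close>
  have "design \<Otimes>\<^sub>M ?N = distr M (?P \<Otimes>\<^sub>M noise_algebra) ?Z"
  proof (rule pair_measure_eqI)
    show "sigma_finite_measure design" "sigma_finite_measure ?N" by unfold_locales
    show "sets (design \<Otimes>\<^sub>M ?N) = sets (distr M (?P \<Otimes>\<^sub>M noise_algebra) ?Z)"
      by (simp add: sets_design cong: sets_pair_measure_cong)
    fix S B assume S: "S \<in> sets design" and B: "B \<in> sets ?N"
    have S': "S \<in> sets ?P" and B': "B \<in> sets noise_algebra" using S B by (simp_all add: sets_design)
    let ?a = "(\<lambda>\<omega>. \<lambda>i\<in>{..<n}. X i \<omega>) -` S \<inter> space M"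
    have a: "?a \<in> sets FX"
      using measurable_sets[OF measurable_family_algebra_restrict S'] by simp
    have b: "B \<inter> space M = B" using sets.sets_into_space[OF B'] by auto
    have "emeasure design S * emeasure ?N B = emeasure M ?a * emeasure M B"
      unfolding design_def using S' B' b
      by (simp add: emeasure_distr[OF measurable_X_restrict] emeasure_distr[OF measurable_id_noise] vimage_def)
    also have "\<dots> = ennreal (prob ?a * prob B)"
      by (simp add: emeasure_eq_measure ennreal_mult)
    also have "\<dots> = emeasure M (?a \<inter> B)"
      using prob_FX_noise[OF a B'] by (simp add: emeasure_eq_measure)
    also have "?a \<inter> B = ?Z -` (S \<times> B) \<inter> space M" using b by auto
    also have "emeasure M \<dots> = emeasure (distr M (?P \<Otimes>\<^sub>M noise_algebra) ?Z) (S \<times> B)"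
      using S' B' by (intro emeasure_distr[OF Z, symmetric]) auto
    finally show "emeasure design S * emeasure ?N B = emeasure (distr M (?P \<Otimes>\<^sub>M noise_algebra) ?Z) (S \<times> B)" .
  qed
  note eq = this
  have F': "F \<in> borel_measurable (design \<Otimes>\<^sub>M ?N)"
    using F by (simp add: eq)
  have "(\<integral>\<^sup>+\<omega>. F (?Z \<omega>) \<partial>M) = (\<integral>\<^sup>+z. F z \<partial>distr M (?P \<Otimes>\<^sub>M noise_algebra) ?Z)"
    by (rule nn_integral_distr[OF Z, symmetric]) (use F in simp)
  also have "\<dots> = (\<integral>\<^sup>+x. (\<integral>\<^sup>+\<omega>. F (x, \<omega>) \<partial>?N) \<partial>design)"
    unfolding eq[symmetric] by (rule N.nn_integral_fst[OF F', symmetric])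
  also have "\<dots> = (\<integral>\<^sup>+x. (\<integral>\<^sup>+\<omega>. F (x, \<omega>) \<partial>M) \<partial>design)"
  proof (rule nn_integral_cong)
    fix x assume x: "x \<in> space design"
    have "(\<lambda>\<omega>. F (x, \<omega>)) \<in> borel_measurable ?N"
      by (rule measurable_compose[OF measurable_Pair1'[OF x] F'])
    then show "(\<integral>\<^sup>+\<omega>. F (x, \<omega>) \<partial>?N) = (\<integral>\<^sup>+\<omega>. F (x, \<omega>) \<partial>M)"
      by (intro nn_integral_distr[OF measurable_id_noise]) simp
  qed
  finally show ?thesis .
qed

section \<open>Observations at a deterministic design\<close>

definition obs_at :: "(nat \<Rightarrow> 'a) \<Rightarrow> nat \<Rightarrow> 'w \<Rightarrow> real" where
  "obs_at x i \<omega> = Y (x i) \<omega> + \<epsilon> i \<omega>"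

lemma measurable_obs_at:
  assumes "i < n"
  shows "(\<lambda>(x, \<omega>). obs_at x i \<omega>) \<in> borel_measurable ((\<Pi>\<^sub>M i\<in>{..<n}. borel) \<Otimes>\<^sub>M noise_algebra)"
proof -
  let ?P = "(\<Pi>\<^sub>M i\<in>{..<n}. (borel :: 'a measure)) \<Otimes>\<^sub>M noise_algebra"
  have "(\<lambda>p. (fst p i, snd p)) \<in> ?P \<rightarrow>\<^sub>M borel \<Otimes>\<^sub>M FY"
  proof (rule measurable_Pair)
    show "(\<lambda>p. fst p i) \<in> ?P \<rightarrow>\<^sub>M borel"
      using assms by (intro measurable_compose[OF measurable_fst measurable_component_singleton]) auto
    show "snd \<in> ?P \<rightarrow>\<^sub>M FY"
      by (rule measurable_compose[OF measurable_snd measurable_id_FY])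
  qed
  from measurable_compose[OF this Y_measurable[unfolded measurable_process_def]]
  have 1: "(\<lambda>p. Y (fst p i) (snd p)) \<in> borel_measurable ?P" by simp
  have 2: "(\<lambda>p. \<epsilon> i (snd p)) \<in> borel_measurable ?P"
    by (rule measurable_compose[OF measurable_snd measurable_\<epsilon>_noise[OF assms]])
  show ?thesis unfolding obs_at_def case_prod_unfold by (intro borel_measurable_add 1 2)
qed

text \<open>At a deterministic design the combinations of process values are measurable for
  \<open>FY\<close> and those of the noise for \<open>F\<epsilon>\<close>; hence they are
  independent and their covariances add up.\<close>

lemma obs_moments: "gaussian_moments_4 n (obs_at x) (cov_entry K0 \<delta>0 x)"
proof -
  have Y: "gaussian_moments_4 n (\<lambda>i. Y (x i)) (\<lambda>i j. K0 (x i - x j))"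
    using centered_gaussian_family_moments[OF Y_gaussian, of n x] by simp
  have e: "gaussian_moments_4 n (\<lambda>i. \<epsilon> i) (\<lambda>i j. if i = j then \<delta>0 else 0)"
    using centered_gaussian_family_moments[OF \<epsilon>_gaussian, of n "\<lambda>i. i"] by simp
  have ind: "indep_var borel (\<lambda>\<omega>. \<Sum>i<n. a i * Y (x i) \<omega>) borel (\<lambda>\<omega>. \<Sum>i<n. a i * \<epsilon> i \<omega>)" for a
  proof -
    let ?U = "\<lambda>\<omega>. \<Sum>i<n. a i * Y (x i) \<omega>" and ?V = "\<lambda>\<omega>. \<Sum>i<n. a i * \<epsilon> i \<omega>"
    have U: "?U \<in> borel_measurable FY"
      by (intro borel_measurable_sum borel_measurable_times borel_measurable_const measurable_family_algebra_component) simp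
    have V: "?V \<in> borel_measurable F\<epsilon>"
      by (intro borel_measurable_sum borel_measurable_times borel_measurable_const measurable_family_algebra_component) simp
    have sU: "sigma_sets (space M) {?U -` S \<inter> space M |S. S \<in> sets borel} \<subseteq> sets FY"
      using measurable_sets[OF U] by (intro sets.sigma_sets_subset[of _ FY, simplified]) auto
    have sV: "sigma_sets (space M) {?V -` S \<inter> space M |S. S \<in> sets borel} \<subseteq> sets F\<epsilon>"
      using measurable_sets[OF V] by (intro sets.sigma_sets_subset[of _ F\<epsilon>, simplified]) auto
    show ?thesis unfolding indep_var_eq
    proof (intro conjI indep_setI)
      show "random_variable borel ?U" using measurable_Y by (intro borel_measurable_sum borel_measurable_times borel_measurable_const)
      show "random_variable borel ?V" using measurable_\<epsilon> by (intro borel_measurable_sum borel_measurable_times borel_measurable_const) auto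
      show "sigma_sets (space M) {?U -` S \<inter> space M |S. S \<in> sets borel} \<subseteq> events"
        "sigma_sets (space M) {?V -` S \<inter> space M |S. S \<in> sets borel} \<subseteq> events"
        using sU sV subalgebras by auto
    qed (use sU sV prob_FY_F\<epsilon> in blast)
  qed
  have "gaussian_moments_4 n (\<lambda>i \<omega>. Y (x i) \<omega> + \<epsilon> i \<omega>) (\<lambda>i j. K0 (x i - x j) + (if i = j then \<delta>0 else 0))"
    by (rule gaussian_moments_4_add[OF Y e ind])
  then show ?thesis by (simp only: obs_at_def[abs_def] cov_entry_def[abs_def])
qed

text \<open>The trace term is the expectation of the quadratic form, so one bound covers both.\<close>

lemma fluct_modulus:
  assumes k: "stationary_covariance k" "stationary_covariance k'"
    and c: "0 < c" "c \<le> \<delta>" "c \<le> \<delta>'"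
    and row: "\<And>i. i < n \<Longrightarrow> (\<Sum>j<n. \<bar>cov_entry k' \<delta>' x i j - cov_entry k \<delta> x i j\<bar>) \<le> \<rho>"
  shows "\<bar>fluct n (prec_entry k \<delta> n x) (cov_entry K0 \<delta>0 x) z - fluct n (prec_entry k' \<delta>' n x) (cov_entry K0 \<delta>0 x) z\<bar>
    \<le> \<rho> / c\<^sup>2 * ((\<Sum>i<n. (z i)\<^sup>2) / real n + (K0 0 + \<delta>0))"
proof -
  let ?R = "cov_entry K0 \<delta>0 x"
  define D where "D i j = prec_entry k \<delta> n x i j - prec_entry k' \<delta>' n x i j" for i j
  \<comment> \<open>Available for every vector z, hence also pathwise for \<open>obs_at x\<close>,
    where taking expectations bounds the trace term.\<close>
  have bound: "\<bar>\<Sum>i<n. \<Sum>j<n. D i j * (z i * z j)\<bar> \<le> \<rho> / c\<^sup>2 * (\<Sum>i<n. (z i)\<^sup>2)" for z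
    using quadratic_prec_diff[OF k c row, of z] by (simp add: D_def mult_ac)
  have Rsym: "?R i j = ?R j i" for i j by (rule cov_entry_sym[OF K0_cov])
  note mom = quadratic_form_moments(1)[OF obs_moments Rsym]
  have sq: "has_bochner_integral M (\<lambda>\<omega>. \<Sum>i<n. (obs_at x i \<omega>)\<^sup>2) (\<Sum>i<n. K0 0 + \<delta>0)"
  proof (rule has_bochner_integral_sum)
    fix i assume "i \<in> {..<n}"
    then show "has_bochner_integral M (\<lambda>\<omega>. (obs_at x i \<omega>)\<^sup>2) (K0 0 + \<delta>0)"
      using isserlis(1)[OF obs_moments Rsym, of i i] by (simp add: power2_eq_square cov_entry_def)
  qed
  define Q where "Q \<omega> = (\<Sum>i<n. \<Sum>j<n. D i j * (obs_at x i \<omega> * obs_at x j \<omega>))" for \<omega>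
  define S where "S \<omega> = (\<Sum>i<n. (obs_at x i \<omega>)\<^sup>2)" for \<omega>
  have "has_bochner_integral M Q (\<Sum>i<n. \<Sum>j<n. D i j * ?R i j)"
    unfolding Q_def[abs_def] by (rule mom)
  then have Q: "integrable M Q" "expectation Q = (\<Sum>i<n. \<Sum>j<n. D i j * ?R i j)"
    by (simp_all add: has_bochner_integral_iff)
  have "has_bochner_integral M S (real n * (K0 0 + \<delta>0))"
    using sq unfolding S_def[abs_def] by simp
  then have S: "integrable M S" "expectation S = real n * (K0 0 + \<delta>0)"
    by (simp_all add: has_bochner_integral_iff)
  have QS: "\<bar>Q \<omega>\<bar> \<le> \<rho> / c\<^sup>2 * S \<omega>" for \<omega> unfolding Q_def S_def by (rule bound)
  have tr1: "\<bar>expectation Q\<bar> \<le> expectation (\<lambda>\<omega>. \<bar>Q \<omega>\<bar>)" by (rule integral_abs_bound)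
  have tr2: "expectation (\<lambda>\<omega>. \<bar>Q \<omega>\<bar>) \<le> expectation (\<lambda>\<omega>. \<rho> / c\<^sup>2 * S \<omega>)"
    by (rule integral_mono[OF _ _ QS]) (use Q S in auto)
  have tr3: "expectation (\<lambda>\<omega>. \<rho> / c\<^sup>2 * S \<omega>) = \<rho> / c\<^sup>2 * (real n * (K0 0 + \<delta>0))"
    unfolding S(2)[symmetric] by (rule integral_mult_right_zero)
  have tr: "\<bar>\<Sum>i<n. \<Sum>j<n. D i j * ?R i j\<bar> \<le> \<rho> / c\<^sup>2 * (real n * (K0 0 + \<delta>0))"
    using tr1 tr2 unfolding tr3 Q(2) by (rule order_trans)
  have f: "fluct n (prec_entry k \<delta> n x) ?R z - fluct n (prec_entry k' \<delta>' n x) ?R z =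
      1 / real n * ((\<Sum>i<n. \<Sum>j<n. D i j * (z i * z j)) - (\<Sum>i<n. \<Sum>j<n. D i j * ?R i j))"
    unfolding fluct_def D_def right_diff_distrib[symmetric] sum_subtractf[symmetric]
    by (simp add: algebra_simps)
  have "\<bar>fluct n (prec_entry k \<delta> n x) ?R z - fluct n (prec_entry k' \<delta>' n x) ?R z\<bar>
      \<le> 1 / real n * (\<bar>\<Sum>i<n. \<Sum>j<n. D i j * (z i * z j)\<bar> + \<bar>\<Sum>i<n. \<Sum>j<n. D i j * ?R i j\<bar>)"
    unfolding f abs_mult by (intro mult_mono abs_triangle_ineq4) auto
  also have "\<dots> \<le> 1 / real n * (\<rho> / c\<^sup>2 * (\<Sum>i<n. (z i)\<^sup>2) + \<rho> / c\<^sup>2 * (real n * (K0 0 + \<delta>0)))"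
    by (rule mult_left_mono[OF add_mono[OF bound[of z] tr]]) simp
  also have "\<dots> = \<rho> / c\<^sup>2 * ((\<Sum>i<n. (z i)\<^sup>2) / real n + (K0 0 + \<delta>0))"
  proof -
    have *: "1 / m * (q * s + q * (m * t)) = q * (s / m + t)" if "m \<noteq> 0" for m q s t :: real
    proof -
      have "1 / m * (q * s + q * (m * t)) = q * (s / m) + q * t * (m / m)" by (simp add: distrib_left)
      then show ?thesis using that by (simp add: distrib_left)
    qed
    show ?thesis by (rule *) (use n in simp)
  qed
  finally show ?thesis .
qed

end

text \<open>Markov's inequality for the nonnegative integral, the form in which
  \<open>nn_integral_split\<close> delivers moments.\<close>

lemma (in prob_space) prob_ge_le_nn_integral:
  assumes f: "f \<in> borel_measurable M" and pos: "\<And>\<omega>. \<omega> \<in> space M \<Longrightarrow> 0 \<le> f \<omega>"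
    and int: "(\<integral>\<^sup>+\<omega>. ennreal (f \<omega>) \<partial>M) \<le> ennreal b" and t: "t > 0" and b: "b \<ge> 0"
  shows "prob {\<omega> \<in> space M. t \<le> f \<omega>} \<le> b / t"
proof -
  have m: "{\<omega> \<in> space M. t \<le> f \<omega>} \<in> sets M" using f by measurable
  have "ennreal (t * prob {\<omega> \<in> space M. t \<le> f \<omega>}) = (\<integral>\<^sup>+\<omega>. ennreal t * indicator {\<omega> \<in> space M. t \<le> f \<omega>} \<omega> \<partial>M)"
    using m t by (simp add: nn_integral_cmult_indicator emeasure_eq_measure ennreal_mult)
  also have "\<dots> \<le> (\<integral>\<^sup>+\<omega>. ennreal (f \<omega>) \<partial>M)"
    by (intro nn_integral_mono) (auto simp: indicator_def intro!: ennreal_leI)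
  also note int
  finally have "t * prob {\<omega> \<in> space M. t \<le> f \<omega>} \<le> b" using b by simp
  then show ?thesis using t by (simp add: field_simps)
qed

lemma neighbour_sum_cong:
  "i < n \<Longrightarrow> (\<And>j. j < n \<Longrightarrow> x j = x' j) \<Longrightarrow> neighbour_sum n x i = neighbour_sum n x' i"
  unfolding neighbour_sum_def by (intro sum.cong refl) auto

text \<open>Bound on the exponential moment of a neighbour sum, the same for all n. It depends on
  the space alone, hence the \<open>itself\<close> argument.\<close>

definition decay_const :: "'a::euclidean_space itself \<Rightarrow> real" where
  "decay_const _ = exp (2 * enn2real (\<integral>\<^sup>+t. ennreal (decay (t :: 'a)) \<partial>lborel))"

lemma decay_const_pos: "0 < decay_const TYPE('a::euclidean_space)"
  by (simp add: decay_const_def)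

context spatial_sample
begin

section \<open>Tail bounds for the random design and the observations\<close>

lemma measurable_design_component: "i < n \<Longrightarrow> (\<lambda>x. x i) \<in> borel_measurable (\<Pi>\<^sub>M i\<in>{..<n}. (borel :: 'a measure))"
  by (rule measurable_component_singleton) simp

lemma measurable_design_diff:
  "i < n \<Longrightarrow> j < n \<Longrightarrow> (\<lambda>x. x i - x j) \<in> borel_measurable (\<Pi>\<^sub>M i\<in>{..<n}. (borel :: 'a measure))"
  by (intro borel_measurable_diff measurable_design_component)

lemma measurable_prod_pair_weight:
  "i < n \<Longrightarrow> (\<lambda>x. \<Prod>j\<in>{..<n} - {i}. pair_weight (x i - x j)) \<in> borel_measurable (\<Pi>\<^sub>M i\<in>{..<n}. (borel :: 'a measure))"
  by (intro borel_measurable_prod_ennreal measurable_compose[OF measurable_design_diff borel_measurable_pair_weight]) auto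

lemma measurable_neighbour_sum:
  "i < n \<Longrightarrow> (\<lambda>x. neighbour_sum n x i) \<in> borel_measurable (\<Pi>\<^sub>M i\<in>{..<n}. (borel :: 'a measure))"
  unfolding neighbour_sum_def
  by (intro borel_measurable_sum measurable_compose[OF measurable_design_diff borel_measurable_decay]) auto

lemma nn_integral_design_prod_le:
  "i < n \<Longrightarrow> (\<integral>\<^sup>+x. (\<Prod>j\<in>{..<n} - {i}. pair_weight (x i - x j)) \<partial>design) \<le> ennreal (decay_const TYPE('a))"
  unfolding design_eq decay_const_def by (rule nn_integral_prod_pair_weight_le[OF A])

lemma nn_integral_exp_neighbour_sum_le:
  assumes "i < n"
  shows "(\<integral>\<^sup>+x. ennreal (exp (neighbour_sum n x i)) \<partial>design) \<le> ennreal (decay_const TYPE('a))"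
  by (rule order_trans[OF nn_integral_mono nn_integral_design_prod_le[OF assms]]) (rule exp_neighbour_sum_le)

lemma AE_design_inj: "AE x in design. inj_on x {..<n}"
proof -
  have "AE x in design. \<forall>i\<in>{..<n}. (\<Prod>j\<in>{..<n} - {i}. pair_weight (x i - x j)) \<noteq> \<infinity>"
  proof (rule AE_finite_allI)
    fix i assume i: "i \<in> {..<n}"
    show "AE x in design. (\<Prod>j\<in>{..<n} - {i}. pair_weight (x i - x j)) \<noteq> \<infinity>"
    proof (rule nn_integral_PInf_AE)
      show "(\<lambda>x. \<Prod>j\<in>{..<n} - {i}. pair_weight (x i - x j)) \<in> borel_measurable design"
        using measurable_prod_pair_weight[of i] i by (simp cong: measurable_cong_sets[OF sets_design])
      show "(\<integral>\<^sup>+x. (\<Prod>j\<in>{..<n} - {i}. pair_weight (x i - x j)) \<partial>design) \<noteq> \<infinity>"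
        using nn_integral_design_prod_le[of i] i by (auto simp: top_unique)
    qed
  qed simp
  then show ?thesis
  proof eventually_elim
    fix x :: "nat \<Rightarrow> 'a"
    assume fin: "\<forall>i\<in>{..<n}. (\<Prod>j\<in>{..<n} - {i}. pair_weight (x i - x j)) \<noteq> \<infinity>"
    show "inj_on x {..<n}"
    proof (rule inj_onI, rule ccontr)
      fix i j assume ij: "i \<in> {..<n}" "j \<in> {..<n}" "x i = x j" "i \<noteq> j"
      then have "(\<Prod>j\<in>{..<n} - {i}. pair_weight (x i - x j)) = \<infinity>"
        by (intro prod_pair_weight_top[of j]) auto
      then show False using fin ij(1) by blast
    qed
  qed
qed

lemma AE_inj: "AE \<omega> in M. inj_on (\<lambda>i. X i \<omega>) {..<n}"
proof -
  have "AE \<omega> in M. inj_on (\<lambda>i\<in>{..<n}. X i \<omega>) {..<n}"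
    using AE_distrD[OF measurable_X_restrict AE_design_inj[unfolded design_def]] .
  then show ?thesis by eventually_elim (simp add: inj_on_def)
qed

lemma measurable_obs_value: "i < n \<Longrightarrow> obs_value Y X \<epsilon> i \<in> borel_measurable M"
proof -
  assume i: "i < n"
  have "(\<lambda>\<omega>. (\<lambda>i\<in>{..<n}. X i \<omega>, \<omega>)) \<in> M \<rightarrow>\<^sub>M (\<Pi>\<^sub>M i\<in>{..<n}. borel) \<Otimes>\<^sub>M noise_algebra"
    by (rule measurable_Pair[OF measurable_X_restrict measurable_id_noise])
  from measurable_compose[OF this measurable_obs_at[OF i]]
  have "(\<lambda>\<omega>. obs_at (\<lambda>i\<in>{..<n}. X i \<omega>) i \<omega>) \<in> borel_measurable M" by simp
  then show ?thesis using i by (simp add: obs_at_def obs_value_def[abs_def])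
qed

lemma measurable_neighbour_sum_X:
  assumes "i < n"
  shows "(\<lambda>\<omega>. neighbour_sum n (\<lambda>i. X i \<omega>) i) \<in> borel_measurable M"
proof -
  have eq: "neighbour_sum n (\<lambda>i. X i \<omega>) i = neighbour_sum n (\<lambda>i\<in>{..<n}. X i \<omega>) i" for \<omega>
    by (rule neighbour_sum_cong[OF assms]) simp
  show ?thesis unfolding eq
    by (rule measurable_compose[OF measurable_X_restrict measurable_neighbour_sum[OF assms]])
qed

text \<open>Chernoff's bound with parameter 1. At s = 2 ln n it is of order n^-2 and survives a
  union over n points.\<close>

lemma prob_neighbour_sum_ge:
  assumes "i < n"
  shows "prob {\<omega> \<in> space M. s \<le> neighbour_sum n (\<lambda>i. X i \<omega>) i} \<le> decay_const TYPE('a) / exp s"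
proof -
  have eq: "neighbour_sum n (\<lambda>i. X i \<omega>) i = neighbour_sum n (\<lambda>i\<in>{..<n}. X i \<omega>) i" for \<omega>
    by (rule neighbour_sum_cong[OF assms]) simp
  have m: "(\<lambda>\<omega>. exp (neighbour_sum n (\<lambda>i. X i \<omega>) i)) \<in> borel_measurable M"
    by (rule measurable_compose[OF measurable_neighbour_sum_X[OF assms] borel_measurable_exp])
  have "(\<integral>\<^sup>+\<omega>. ennreal (exp (neighbour_sum n (\<lambda>i. X i \<omega>) i)) \<partial>M) =
      (\<integral>\<^sup>+x. ennreal (exp (neighbour_sum n x i)) \<partial>design)"
    unfolding eq design_def
    by (rule nn_integral_distr[OF measurable_X_restrict, symmetric])
       (simp add: measurable_compose[OF measurable_neighbour_sum[OF assms] borel_measurable_exp])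
  also note nn_integral_exp_neighbour_sum_le[OF assms]
  finally have "prob {\<omega> \<in> space M. exp s \<le> exp (neighbour_sum n (\<lambda>i. X i \<omega>) i)} \<le> decay_const TYPE('a) / exp s"
    by (intro prob_ge_le_nn_integral m) (simp_all add: decay_const_def)
  then show ?thesis by simp
qed

lemma K0_diag_nonneg: "\<delta>0 \<ge> 0 \<Longrightarrow> 0 \<le> K0 0 + \<delta>0"
  using stationary_covariance_psd[OF K0_cov, of "{0::nat}" "\<lambda>_. 1" "\<lambda>_. 0"] by simp

lemma prob_sum_squares_ge:
  assumes \<delta>0: "\<delta>0 \<ge> 0" and t: "t > 0"
  shows "prob {\<omega> \<in> space M. t \<le> (\<Sum>i<n. (obs_value Y X \<epsilon> i \<omega>)\<^sup>2) / real n} \<le> (K0 0 + \<delta>0) / t"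
proof (rule prob_ge_le_nn_integral)
  show "(\<lambda>\<omega>. (\<Sum>i<n. (obs_value Y X \<epsilon> i \<omega>)\<^sup>2) / real n) \<in> borel_measurable M"
    using measurable_obs_value by (intro borel_measurable_divide borel_measurable_sum borel_measurable_power borel_measurable_const) auto
  let ?F = "\<lambda>p. ennreal ((\<Sum>i<n. (obs_at (fst p) i (snd p))\<^sup>2) / real n)"
  have F: "?F \<in> borel_measurable ((\<Pi>\<^sub>M i\<in>{..<n}. borel) \<Otimes>\<^sub>M noise_algebra)"
    using measurable_obs_at
    by (intro measurable_compose[OF _ measurable_ennreal] borel_measurable_divide borel_measurable_sum
        borel_measurable_power borel_measurable_const) (auto simp: case_prod_unfold)
  have eq: "obs_value Y X \<epsilon> i \<omega> = obs_at (\<lambda>i\<in>{..<n}. X i \<omega>) i \<omega>" if "i < n" for i \<omega>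
    using that by (simp add: obs_value_def obs_at_def)
  have "(\<integral>\<^sup>+\<omega>. ennreal ((\<Sum>i<n. (obs_value Y X \<epsilon> i \<omega>)\<^sup>2) / real n) \<partial>M) = (\<integral>\<^sup>+\<omega>. ?F (\<lambda>i\<in>{..<n}. X i \<omega>, \<omega>) \<partial>M)"
    by (simp add: eq)
  also have "\<dots> = (\<integral>\<^sup>+x. (\<integral>\<^sup>+\<omega>. ?F (x, \<omega>) \<partial>M) \<partial>design)" by (rule nn_integral_split[OF F])
  also have "\<dots> = (\<integral>\<^sup>+x. ennreal (K0 0 + \<delta>0) \<partial>design)"
  proof (rule nn_integral_cong)
    fix x
    have Rsym: "cov_entry K0 \<delta>0 x i j = cov_entry K0 \<delta>0 x j i" for i j by (rule cov_entry_sym[OF K0_cov])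
    have "has_bochner_integral M (\<lambda>\<omega>. (\<Sum>i<n. (obs_at x i \<omega>)\<^sup>2) / real n) ((\<Sum>i<n. K0 0 + \<delta>0) / real n)"
    proof (intro has_bochner_integral_divide_zero has_bochner_integral_sum)
      fix i assume "i \<in> {..<n}"
      then show "has_bochner_integral M (\<lambda>\<omega>. (obs_at x i \<omega>)\<^sup>2) (K0 0 + \<delta>0)"
        using isserlis(1)[OF obs_moments Rsym, of i i] by (simp add: power2_eq_square cov_entry_def)
    qed
    then have 1: "has_bochner_integral M (\<lambda>\<omega>. (\<Sum>i<n. (obs_at x i \<omega>)\<^sup>2) / real n) (K0 0 + \<delta>0)" using n by simp
    then have "(\<integral>\<^sup>+\<omega>. ennreal ((\<Sum>i<n. (obs_at x i \<omega>)\<^sup>2) / real n) \<partial>M) = ennreal (expectation (\<lambda>\<omega>. (\<Sum>i<n. (obs_at x i \<omega>)\<^sup>2) / real n))"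
      by (intro nn_integral_eq_integral) (auto simp: has_bochner_integral_iff intro!: AE_I2 divide_nonneg_nonneg sum_nonneg)
    then show "(\<integral>\<^sup>+\<omega>. ?F (x, \<omega>) \<partial>M) = ennreal (K0 0 + \<delta>0)" using 1 by (simp add: has_bochner_integral_iff)
  qed
  also have "\<dots> = ennreal (K0 0 + \<delta>0)" using prob_space.emeasure_space_1[OF prob_space_design] by simp
  finally show "(\<integral>\<^sup>+\<omega>. ennreal ((\<Sum>i<n. (obs_value Y X \<epsilon> i \<omega>)\<^sup>2) / real n) \<partial>M) \<le> ennreal (K0 0 + \<delta>0)" by simp
qed (use t K0_diag_nonneg[OF \<delta>0] in \<open>auto intro!: divide_nonneg_nonneg sum_nonneg\<close>)

text \<open>Off the diagonal, the square of \<open>decay\<close> is at most \<open>decay\<close>.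
  Bounding the neighbour sum by its exponential lets the exponential moment serve for the mean as
  well.\<close>

lemma frobenius_cov_le:
  assumes C: "\<And>t. \<bar>K0 t\<bar> \<le> C * decay t"
  shows "(\<Sum>i<n. \<Sum>j<n. (cov_entry K0 \<delta>0 x i j)\<^sup>2) \<le> (\<Sum>i<n. (K0 0 + \<delta>0)\<^sup>2 + C\<^sup>2 * exp (neighbour_sum n x i))"
proof (rule sum_mono)
  fix i assume i: "i \<in> {..<n}"
  have "(\<Sum>j<n. (cov_entry K0 \<delta>0 x i j)\<^sup>2) = (K0 0 + \<delta>0)\<^sup>2 + (\<Sum>j\<in>{..<n} - {i}. (K0 (x i - x j))\<^sup>2)"
    using i by (subst sum.remove[of _ i]) (auto simp: cov_entry_def intro!: sum.cong)
  also have "(\<Sum>j\<in>{..<n} - {i}. (K0 (x i - x j))\<^sup>2) \<le> (\<Sum>j\<in>{..<n} - {i}. C\<^sup>2 * decay (x i - x j))"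
  proof (rule sum_mono)
    fix j
    let ?t = "x i - x j"
    have "(K0 ?t)\<^sup>2 \<le> (C * decay ?t)\<^sup>2" using C[of ?t] by (rule abs_le_square_iff[THEN iffD1, OF order_trans[OF _ abs_ge_self]])
    also have "\<dots> = C\<^sup>2 * (decay ?t * decay ?t)" by (simp add: power_mult_distrib power2_eq_square)
    also have "\<dots> \<le> C\<^sup>2 * (decay ?t * 1)"
      using decay_bounds[of ?t] by (intro mult_left_mono) auto
    finally show "(K0 ?t)\<^sup>2 \<le> C\<^sup>2 * decay ?t" by simp
  qed
  also have "\<dots> = C\<^sup>2 * neighbour_sum n x i" by (simp add: neighbour_sum_def sum_distrib_left)
  also have "\<dots> \<le> C\<^sup>2 * exp (neighbour_sum n x i)"
  proof (rule mult_left_mono)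
    show "neighbour_sum n x i \<le> exp (neighbour_sum n x i)"
      using exp_ge_add_one_self[of "neighbour_sum n x i"] by linarith
  qed simp
  finally show "(\<Sum>j<n. (cov_entry K0 \<delta>0 x i j)\<^sup>2) \<le> (K0 0 + \<delta>0)\<^sup>2 + C\<^sup>2 * exp (neighbour_sum n x i)" by simp
qed

lemma measurable_fluct_obs:
  assumes k: "k \<in> borel_measurable borel"
  shows "(\<lambda>p. fluct n (prec_entry k \<delta> n (fst p)) (cov_entry K0 \<delta>0 (fst p)) (\<lambda>i. obs_at (fst p) i (snd p)))
     \<in> borel_measurable ((\<Pi>\<^sub>M i\<in>{..<n}. borel) \<Otimes>\<^sub>M noise_algebra)"
proof -
  let ?P = "(\<Pi>\<^sub>M i\<in>{..<n}. (borel :: 'a measure)) \<Otimes>\<^sub>M noise_algebra"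
  have x: "(\<lambda>p. fst p i) \<in> borel_measurable ?P" if "i < n" for i
    by (rule measurable_compose[OF measurable_fst measurable_design_component[OF that]])
  have o: "(\<lambda>p. obs_at (fst p) i (snd p)) \<in> borel_measurable ?P" if "i < n" for i
    using measurable_obs_at[OF that] by (simp add: case_prod_unfold)
  show ?thesis unfolding fluct_def
    by (intro borel_measurable_times borel_measurable_const borel_measurable_sum borel_measurable_diff
        borel_measurable_prec_entry borel_measurable_cov_entry x o k K0_meas) auto
qed

lemma fluct_X_eq:
  "fluct n (prec_entry k \<delta> n (\<lambda>i. X i \<omega>)) (cov_entry K0 \<delta>0 (\<lambda>i. X i \<omega>)) (\<lambda>i. obs_value Y X \<epsilon> i \<omega>) =
   fluct n (prec_entry k \<delta> n (\<lambda>i\<in>{..<n}. X i \<omega>)) (cov_entry K0 \<delta>0 (\<lambda>i\<in>{..<n}. X i \<omega>))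
     (\<lambda>i. obs_at (\<lambda>i\<in>{..<n}. X i \<omega>) i \<omega>)"
proof -
  have "prec_entry k \<delta> n (\<lambda>i. X i \<omega>) i j = prec_entry k \<delta> n (\<lambda>i\<in>{..<n}. X i \<omega>) i j" for i j
    by (rule prec_entry_cong) simp
  then show ?thesis unfolding fluct_def
    by (simp add: cov_entry_def obs_value_def obs_at_def)
qed

lemma measurable_fluct_X:
  assumes k: "k \<in> borel_measurable borel"
  shows "(\<lambda>\<omega>. fluct n (prec_entry k \<delta> n (\<lambda>i. X i \<omega>)) (cov_entry K0 \<delta>0 (\<lambda>i. X i \<omega>))
     (\<lambda>i. obs_value Y X \<epsilon> i \<omega>)) \<in> borel_measurable M"
  unfolding fluct_X_eq
  using measurable_compose[OF measurable_Pair[OF measurable_X_restrict measurable_id_noise] measurable_fluct_obs[OF k]]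
  by simp

text \<open>Chebyshev's inequality, with the second moment computed for a frozen design and then
  averaged over the design by \<open>nn_integral_split\<close>.\<close>

lemma prob_fluct_ge:
  assumes C: "\<And>t. \<bar>K0 t\<bar> \<le> C * decay t" and k: "stationary_covariance k" "k \<in> borel_measurable borel"
    and c: "0 < c" "c \<le> \<delta>" and s: "s > 0"
  shows "prob {\<omega> \<in> space M. s \<le> \<bar>fluct n (prec_entry k \<delta> n (\<lambda>i. X i \<omega>)) (cov_entry K0 \<delta>0 (\<lambda>i. X i \<omega>))
        (\<lambda>i. obs_value Y X \<epsilon> i \<omega>)\<bar>}
    \<le> 2 * ((K0 0 + \<delta>0)\<^sup>2 + C\<^sup>2 * decay_const TYPE('a)) / (c\<^sup>2 * real n) / s\<^sup>2"
proof -
  let ?V = "2 * ((K0 0 + \<delta>0)\<^sup>2 + C\<^sup>2 * decay_const TYPE('a)) / (c\<^sup>2 * real n)"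
  let ?f = "\<lambda>p. fluct n (prec_entry k \<delta> n (fst p)) (cov_entry K0 \<delta>0 (fst p)) (\<lambda>i. obs_at (fst p) i (snd p))"
  let ?Z = "\<lambda>\<omega>. (\<lambda>i\<in>{..<n}. X i \<omega>, \<omega>)"
  define W where "W \<omega> = fluct n (prec_entry k \<delta> n (\<lambda>i. X i \<omega>)) (cov_entry K0 \<delta>0 (\<lambda>i. X i \<omega>)) (\<lambda>i. obs_value Y X \<epsilon> i \<omega>)" for \<omega>
  have W: "W \<omega> = ?f (?Z \<omega>)" for \<omega>
    unfolding W_def fluct_X_eq by simp
  have Wm: "W \<in> borel_measurable M"
    unfolding W_def[abs_def] by (rule measurable_fluct_X[OF k(2)])
  have F: "(\<lambda>p. ennreal ((?f p)\<^sup>2)) \<in> borel_measurable ((\<Pi>\<^sub>M i\<in>{..<n}. borel) \<Otimes>\<^sub>M noise_algebra)"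
    by (intro measurable_compose[OF _ measurable_ennreal] borel_measurable_power measurable_fluct_obs k)
  \<comment> \<open>2 / c^2 comes from \<open>trace_quadratic_bound\<close>, 1 / n^2 from squaring
    the normalisation in \<open>fluct\<close>.\<close>
  define q where "q = 2 / (c\<^sup>2 * (real n)\<^sup>2)"
  have q: "q \<ge> 0" by (simp add: q_def)
  have inner: "(\<integral>\<^sup>+\<omega>. ennreal ((?f (x, \<omega>))\<^sup>2) \<partial>M) \<le> ennreal q * (\<Sum>i<n. ennreal ((K0 0 + \<delta>0)\<^sup>2) + ennreal (C\<^sup>2) * ennreal (exp (neighbour_sum n x i)))" for x
  proof -
    let ?P = "prec_entry k \<delta> n x" and ?R = "cov_entry K0 \<delta>0 x"
    have Rsym: "?R i j = ?R j i" for i j by (rule cov_entry_sym[OF K0_cov])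
    have pd: "pos_def_on n (cov_entry k \<delta> x)" using c by (intro pos_def_cov_entry k) auto
    let ?T = "\<Sum>i<n. \<Sum>j<n. \<Sum>a<n. \<Sum>b<n. ?P i j * ?P a b * (?R i a * ?R j b + ?R i b * ?R j a)"
    define G where "G \<omega> = (\<Sum>i<n. \<Sum>j<n. ?P i j * (obs_at x i \<omega> * obs_at x j \<omega> - ?R i j))\<^sup>2" for \<omega>
    have "has_bochner_integral M G ?T"
      unfolding G_def[abs_def] by (rule quadratic_form_moments(2)[OF obs_moments Rsym])
    then have G: "integrable M G" "expectation G = ?T" by (simp_all add: has_bochner_integral_iff)
    have T: "?T \<le> 2 / c\<^sup>2 * (\<Sum>i<n. \<Sum>j<n. (?R i j)\<^sup>2)"
      by (rule trace_quadratic_bound[OF Rsym prec_entry_sym[OF k(1) pd] prec_entry_bound[OF k(1) c]])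
    have f: "(?f (x, \<omega>))\<^sup>2 = (1 / (real n)\<^sup>2) * G \<omega>" for \<omega>
      by (simp add: fluct_def G_def power_mult_distrib power_divide)
    define B where "B = (\<Sum>i<n. (K0 0 + \<delta>0)\<^sup>2 + C\<^sup>2 * exp (neighbour_sum n x i))"
    have e1: "(\<integral>\<^sup>+\<omega>. ennreal ((?f (x, \<omega>))\<^sup>2) \<partial>M) = ennreal (expectation (\<lambda>\<omega>. (1 / (real n)\<^sup>2) * G \<omega>))"
      unfolding f by (rule nn_integral_eq_integral[OF integrable_mult_right[OF G(1)] AE_I2]) (simp add: G_def)
    have e2: "expectation (\<lambda>\<omega>. (1 / (real n)\<^sup>2) * G \<omega>) = (1 / (real n)\<^sup>2) * ?T"
      unfolding G(2)[symmetric] by (rule integral_mult_right_zero)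
    have "(\<Sum>i<n. \<Sum>j<n. (?R i j)\<^sup>2) \<le> B" unfolding B_def by (rule frobenius_cov_le[OF C])
    then have "2 / c\<^sup>2 * (\<Sum>i<n. \<Sum>j<n. (?R i j)\<^sup>2) \<le> 2 / c\<^sup>2 * B" by (rule mult_left_mono) simp
    with T have "?T \<le> 2 / c\<^sup>2 * B" by (rule order_trans)
    then have "(1 / (real n)\<^sup>2) * ?T \<le> (1 / (real n)\<^sup>2) * (2 / c\<^sup>2 * B)" by (rule mult_left_mono) simp
    then have e3: "(1 / (real n)\<^sup>2) * ?T \<le> q * B" unfolding q_def by (simp add: mult_ac)
    have "(\<integral>\<^sup>+\<omega>. ennreal ((?f (x, \<omega>))\<^sup>2) \<partial>M) \<le> ennreal (q * (\<Sum>i<n. (K0 0 + \<delta>0)\<^sup>2 + C\<^sup>2 * exp (neighbour_sum n x i)))"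
      unfolding e1 e2 B_def[symmetric] by (rule ennreal_leI[OF e3])
    also have "\<dots> = ennreal q * (\<Sum>i<n. ennreal ((K0 0 + \<delta>0)\<^sup>2 + C\<^sup>2 * exp (neighbour_sum n x i)))"
    proof -
      have "(\<Sum>i<n. ennreal ((K0 0 + \<delta>0)\<^sup>2 + C\<^sup>2 * exp (neighbour_sum n x i))) =
          ennreal (\<Sum>i<n. (K0 0 + \<delta>0)\<^sup>2 + C\<^sup>2 * exp (neighbour_sum n x i))"
        by (rule sum_ennreal) simp
      then show ?thesis using q by (simp only: ennreal_mult[OF q sum_nonneg] add_nonneg_nonneg mult_nonneg_nonneg
          zero_le_power2 exp_ge_zero)
    qed
    also have "\<dots> = ennreal q * (\<Sum>i<n. ennreal ((K0 0 + \<delta>0)\<^sup>2) + ennreal (C\<^sup>2) * ennreal (exp (neighbour_sum n x i)))"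
      by (simp add: ennreal_plus ennreal_mult)
    finally show ?thesis .
  qed
  have ms: "(\<lambda>x. ennreal (exp (neighbour_sum n x i))) \<in> borel_measurable design" if "i < n" for i
    using measurable_neighbour_sum[OF that]
    by (simp add: borel_measurable_exp cong: measurable_cong_sets[OF sets_design])
  have "(\<integral>\<^sup>+\<omega>. ennreal ((W \<omega>)\<^sup>2) \<partial>M) = (\<integral>\<^sup>+x. (\<integral>\<^sup>+\<omega>. ennreal ((?f (x, \<omega>))\<^sup>2) \<partial>M) \<partial>design)"
    unfolding W by (rule nn_integral_split[OF F])
  also have "\<dots> \<le> (\<integral>\<^sup>+x. ennreal q * (\<Sum>i<n. ennreal ((K0 0 + \<delta>0)\<^sup>2) + ennreal (C\<^sup>2) * ennreal (exp (neighbour_sum n x i))) \<partial>design)"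
    by (intro nn_integral_mono inner)
  also have "\<dots> = ennreal q * (\<Sum>i<n. ennreal ((K0 0 + \<delta>0)\<^sup>2) + ennreal (C\<^sup>2) * (\<integral>\<^sup>+x. ennreal (exp (neighbour_sum n x i)) \<partial>design))"
  proof -
    have 1: "(\<integral>\<^sup>+x. ennreal ((K0 0 + \<delta>0)\<^sup>2) + ennreal (C\<^sup>2) * ennreal (exp (neighbour_sum n x i)) \<partial>design) =
       ennreal ((K0 0 + \<delta>0)\<^sup>2) + ennreal (C\<^sup>2) * (\<integral>\<^sup>+x. ennreal (exp (neighbour_sum n x i)) \<partial>design)" if "i < n" for i
      using ms[OF that] prob_space.emeasure_space_1[OF prob_space_design]
      by (subst nn_integral_add) (auto simp: nn_integral_cmult)
    have m: "(\<lambda>x. ennreal ((K0 0 + \<delta>0)\<^sup>2) + ennreal (C\<^sup>2) * ennreal (exp (neighbour_sum n x i))) \<in> borel_measurable design" if "i < n" for i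
      by (intro borel_measurable_add borel_measurable_times_ennreal borel_measurable_const ms that)
    have "(\<integral>\<^sup>+x. ennreal q * (\<Sum>i<n. ennreal ((K0 0 + \<delta>0)\<^sup>2) + ennreal (C\<^sup>2) * ennreal (exp (neighbour_sum n x i))) \<partial>design)
       = ennreal q * (\<integral>\<^sup>+x. (\<Sum>i<n. ennreal ((K0 0 + \<delta>0)\<^sup>2) + ennreal (C\<^sup>2) * ennreal (exp (neighbour_sum n x i))) \<partial>design)"
      by (rule nn_integral_cmult) (use m in \<open>auto intro!: borel_measurable_sum\<close>)
    also have "(\<integral>\<^sup>+x. (\<Sum>i<n. ennreal ((K0 0 + \<delta>0)\<^sup>2) + ennreal (C\<^sup>2) * ennreal (exp (neighbour_sum n x i))) \<partial>design)
       = (\<Sum>i<n. \<integral>\<^sup>+x. ennreal ((K0 0 + \<delta>0)\<^sup>2) + ennreal (C\<^sup>2) * ennreal (exp (neighbour_sum n x i)) \<partial>design)"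
      by (rule nn_integral_sum) (use m in auto)
    finally show ?thesis using 1 by simp
  qed
  also have "\<dots> \<le> ennreal q * (\<Sum>i<n. ennreal ((K0 0 + \<delta>0)\<^sup>2) + ennreal (C\<^sup>2) * ennreal (decay_const TYPE('a)))"
    by (intro mult_left_mono sum_mono add_mono nn_integral_exp_neighbour_sum_le) auto
  also have "\<dots> = ennreal (q * (\<Sum>i<n. (K0 0 + \<delta>0)\<^sup>2 + C\<^sup>2 * decay_const TYPE('a)))"
    using q decay_const_pos[where 'a = 'a]
    by (subst ennreal_mult) (auto intro!: sum_nonneg simp: sum_ennreal[symmetric] ennreal_plus ennreal_mult simp del: sum_constant)
  also have "q * (\<Sum>i<n. (K0 0 + \<delta>0)\<^sup>2 + C\<^sup>2 * decay_const TYPE('a)) = ?V"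
    using n by (simp add: q_def power2_eq_square)
  finally have "prob {\<omega> \<in> space M. s\<^sup>2 \<le> (W \<omega>)\<^sup>2} \<le> ?V / s\<^sup>2"
    using Wm s decay_const_pos[where 'a = 'a]
    by (intro prob_ge_le_nn_integral) (auto intro!: divide_nonneg_nonneg mult_nonneg_nonneg add_nonneg_nonneg)
  moreover have "s\<^sup>2 \<le> (W \<omega>)\<^sup>2 \<longleftrightarrow> s \<le> \<bar>W \<omega>\<bar>" for \<omega>
    using s abs_le_square_iff[of s "W \<omega>"] by simp
  ultimately show ?thesis by (simp only: W_def)
qed

end

section \<open>The excess divergence of the maximum likelihood estimator\<close>

text \<open>The weight \<open>w\<close> is \<open>decay\<close> for the kernel and constant for the
  nugget, so one statement serves both. Summing the constants of the coordinates gives a single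
  \<open>L\<close>.\<close>

lemma lipschitz_of_first_partials:
  fixes f :: "'t \<Rightarrow> real^'p::finite \<Rightarrow> real" and a b :: "real^'p"
  assumes smooth: "\<And>t. cont_diff_on (Suc m) (cbox a b) (f t)"
    and bound: "\<And>\<alpha>::'p \<Rightarrow> nat. (\<Sum>i\<in>UNIV. \<alpha> i) \<le> Suc m \<Longrightarrow>
      \<exists>A. \<forall>js. multi_index_list \<alpha> js \<longrightarrow> (\<forall>t. \<forall>\<theta>\<in>cbox a b. \<bar>partials_on (cbox a b) js (f t) \<theta>\<bar> \<le> A * w t)"
    and w: "\<And>t. 0 \<le> w t"
  obtains L where "0 \<le> L" "\<And>t x y. x \<in> cbox a b \<Longrightarrow> y \<in> cbox a b \<Longrightarrow>
      \<bar>f t y - f t x\<bar> \<le> L * w t * (\<Sum>i\<in>UNIV. \<bar>y $ i - x $ i\<bar>)"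
proof -
  have "\<exists>A. \<forall>t. \<forall>\<theta>\<in>cbox a b. \<bar>partial_on (cbox a b) i (f t) \<theta>\<bar> \<le> A * w t" for i
  proof -
    \<comment> \<open>The multi-index of one first-order derivative, realised by the list
      \<open>[i]\<close>.\<close>
    let ?\<alpha> = "\<lambda>j. if j = i then 1 else 0 :: nat"
    have "(\<Sum>j\<in>UNIV. ?\<alpha> j) \<le> Suc m" by simp
    from bound[OF this] obtain A where A: "\<And>js. multi_index_list ?\<alpha> js \<Longrightarrow>
        \<forall>t. \<forall>\<theta>\<in>cbox a b. \<bar>partials_on (cbox a b) js (f t) \<theta>\<bar> \<le> A * w t" by blast
    have "multi_index_list ?\<alpha> [i]" by (auto simp: multi_index_list_def)
    from A[OF this] show ?thesis by (auto simp: partials_on_def)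
  qed
  then obtain A where A: "\<And>i t \<theta>. \<theta> \<in> cbox a b \<Longrightarrow> \<bar>partial_on (cbox a b) i (f t) \<theta>\<bar> \<le> A i * w t" by metis
  define L where "L = (\<Sum>i\<in>UNIV. \<bar>A i\<bar>)"
  show ?thesis
  proof (rule that[of L])
    show "0 \<le> L" by (simp add: L_def sum_nonneg)
    fix t x y assume x: "x \<in> cbox a b" and y: "y \<in> cbox a b"
    show "\<bar>f t y - f t x\<bar> \<le> L * w t * (\<Sum>i\<in>UNIV. \<bar>y $ i - x $ i\<bar>)"
    proof (rule cbox_lipschitz[OF _ _ x y])
      fix \<theta> i assume \<theta>: "\<theta> \<in> cbox a b"
      show "(\<lambda>h. f t (\<theta> + h *\<^sub>R axis i 1)) differentiable (at 0 within line_in (cbox a b) i \<theta>)"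
        using smooth[of t] \<theta> by simp
      have "A i \<le> L" unfolding L_def
        by (rule order_trans[OF abs_ge_self member_le_sum[of i UNIV "\<lambda>i. \<bar>A i\<bar>"]]) auto
      then have "A i * w t \<le> L * w t" using w by (rule mult_right_mono)
      then show "\<bar>partial_on (cbox a b) i (f t) \<theta>\<bar> \<le> L * w t" using A[OF \<theta>] by (rule order_trans[rotated])
    qed
  qed
qed

context spatial_sample
begin

text \<open>Three bad events: a large fluctuation on the grid, a crowded point, a large mean square
  of the observations. Off them the fluctuation is at most e / 4 on the grid plus e / 4 between grid
  points, hence e / 2 everywhere, and the excess is at most twice that.\<close>

lemma prob_excess_le:
  fixes K :: "real^'p::finite \<Rightarrow> 'a \<Rightarrow> real" and \<delta> :: "real^'p \<Rightarrow> real" and lo hi :: real and \<theta>hat :: "'w \<Rightarrow> real^'p"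
  defines "\<Theta> \<equiv> cbox (\<chi> i. lo) (\<chi> i. hi)"
  assumes C: "\<And>t. \<bar>K0 t\<bar> \<le> C * decay t" and \<delta>0: "\<delta>0 \<ge> 0" and lohi: "lo < hi"
    and K: "\<And>\<theta>. \<theta> \<in> \<Theta> \<Longrightarrow> stationary_covariance (K \<theta>)" "\<And>\<theta>. \<theta> \<in> \<Theta> \<Longrightarrow> K \<theta> \<in> borel_measurable borel"
    and c: "0 < c" "\<And>\<theta>. \<theta> \<in> \<Theta> \<Longrightarrow> c \<le> \<delta> \<theta>"
    and L: "0 \<le> L" "\<And>t \<theta> \<theta>'. \<theta> \<in> \<Theta> \<Longrightarrow> \<theta>' \<in> \<Theta> \<Longrightarrow> \<bar>K \<theta>' t - K \<theta> t\<bar> \<le> L * decay t * (\<Sum>i\<in>UNIV. \<bar>\<theta>' $ i - \<theta> $ i\<bar>)"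
      "\<And>\<theta> \<theta>'. \<theta> \<in> \<Theta> \<Longrightarrow> \<theta>' \<in> \<Theta> \<Longrightarrow> \<bar>\<delta> \<theta>' - \<delta> \<theta>\<bar> \<le> L * (\<Sum>i\<in>UNIV. \<bar>\<theta>' $ i - \<theta> $ i\<bar>)"
    and pd: "AE \<omega> in M. pos_def_on n (cov_entry K0 \<delta>0 (\<lambda>i. X i \<omega>))"
    and bdd: "\<And>x. bdd_below (kl_div K \<delta> K0 \<delta>0 n x ` \<Theta>)"
    and argmin: "\<And>\<omega>. \<omega> \<in> space M \<Longrightarrow>
      is_arg_min (neg_log_lik K \<delta> n (\<lambda>i. X i \<omega>) (\<lambda>i. obs_value Y X \<epsilon> i \<omega>)) (\<lambda>\<theta>. \<theta> \<in> \<Theta>) (\<theta>hat \<omega>)"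
    and e: "e > 0" and m: "m \<ge> 1" and \<tau>: "\<tau> > 0" and \<sigma>: "\<sigma> \<ge> 0"
    and small: "L * (real CARD('p) * (hi - lo) / real m) * (\<sigma> + 2) / c\<^sup>2 * (\<tau> + (K0 0 + \<delta>0)) \<le> e / 4"
  shows "prob {\<omega> \<in> space M. \<bar>kl_div K \<delta> K0 \<delta>0 n (\<lambda>i. X i \<omega>) (\<theta>hat \<omega>) - (INF \<theta>\<in>\<Theta>. kl_div K \<delta> K0 \<delta>0 n (\<lambda>i. X i \<omega>) \<theta>)\<bar> > e}
    \<le> real ((m + 1) ^ CARD('p)) * (2 * ((K0 0 + \<delta>0)\<^sup>2 + C\<^sup>2 * decay_const TYPE('a)) / (c\<^sup>2 * real n) / (e / 4)\<^sup>2)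
      + real n * (decay_const TYPE('a) / exp \<sigma>) + (K0 0 + \<delta>0) / \<tau>"
proof -
  let ?x = "\<lambda>\<omega> i. X i \<omega>" and ?y = "\<lambda>\<omega> i. obs_value Y X \<epsilon> i \<omega>"
  define \<kappa> where "\<kappa> = K0 0 + \<delta>0"
  have \<kappa>: "\<kappa> \<ge> 0" unfolding \<kappa>_def by (rule K0_diag_nonneg[OF \<delta>0])
  define \<eta> where "\<eta> = real CARD('p) * (hi - lo) / real m"
  define W where "W \<theta> \<omega> = fluct n (prec_entry (K \<theta>) (\<delta> \<theta>) n (?x \<omega>)) (cov_entry K0 \<delta>0 (?x \<omega>)) (?y \<omega>)" for \<theta> \<omega>
  define D where "D \<omega> = kl_div K \<delta> K0 \<delta>0 n (?x \<omega>)" for \<omega>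
  obtain G :: "(real^'p) set" where G: "finite G" "G \<subseteq> \<Theta>" "card G \<le> (m + 1) ^ CARD('p)"
    "\<And>\<theta>. \<theta> \<in> \<Theta> \<Longrightarrow> \<exists>g\<in>G. (\<Sum>i\<in>UNIV. \<bar>\<theta> $ i - g $ i\<bar>) \<le> \<eta>"
    by (rule cbox_grid[OF lohi m, where 'p = 'p, folded \<Theta>_def \<eta>_def]) (rule that)
  define E1 where "E1 = (\<Union>g\<in>G. {\<omega> \<in> space M. e / 4 \<le> \<bar>W g \<omega>\<bar>})"
  define E2 where "E2 = (\<Union>i\<in>{..<n}. {\<omega> \<in> space M. \<sigma> \<le> neighbour_sum n (?x \<omega>) i})"
  define E3 where "E3 = {\<omega> \<in> space M. \<tau> \<le> (\<Sum>i<n. (?y \<omega> i)\<^sup>2) / real n}"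
  have W_meas: "W g \<in> borel_measurable M" if "g \<in> G" for g
    unfolding W_def[abs_def] using G(2) that by (intro measurable_fluct_X K(2)) auto
  have m1: "{\<omega> \<in> space M. e / 4 \<le> \<bar>W g \<omega>\<bar>} \<in> sets M" if "g \<in> G" for g
    using W_meas[OF that] by measurable
  have m2: "{\<omega> \<in> space M. \<sigma> \<le> neighbour_sum n (?x \<omega>) i} \<in> sets M" if "i < n" for i
    using measurable_neighbour_sum_X[OF that] by measurable
  have m3: "E3 \<in> sets M"
  proof -
    have "(\<lambda>\<omega>. (\<Sum>i<n. (?y \<omega> i)\<^sup>2) / real n) \<in> borel_measurable M"
      using measurable_obs_value
      by (intro borel_measurable_divide borel_measurable_sum borel_measurable_power borel_measurable_const) auto
    then show ?thesis unfolding E3_def by measurable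
  qed
  have E1: "E1 \<in> sets M" unfolding E1_def using G(1) m1 by (intro sets.finite_UN) auto
  have E2: "E2 \<in> sets M" unfolding E2_def using m2 by (intro sets.finite_UN) auto
  have good: "\<bar>D \<omega> (\<theta>hat \<omega>) - (INF \<theta>\<in>\<Theta>. D \<omega> \<theta>)\<bar> \<le> e"
    if \<omega>: "\<omega> \<in> space M" "pos_def_on n (cov_entry K0 \<delta>0 (?x \<omega>))" "\<omega> \<notin> E1" "\<omega> \<notin> E2" "\<omega> \<notin> E3" for \<omega>
  proof -
    have hat: "\<theta>hat \<omega> \<in> \<Theta>"
      and min: "\<And>\<theta>. \<theta> \<in> \<Theta> \<Longrightarrow> neg_log_lik K \<delta> n (?x \<omega>) (?y \<omega>) (\<theta>hat \<omega>) \<le> neg_log_lik K \<delta> n (?x \<omega>) (?y \<omega>) \<theta>"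
      using argmin[OF \<omega>(1)] unfolding is_arg_min_def by (auto simp: not_less)
    have W_small: "\<bar>W \<theta> \<omega>\<bar> \<le> e / 2" if \<theta>: "\<theta> \<in> \<Theta>" for \<theta>
    proof -
      obtain g where g: "g \<in> G" "(\<Sum>i\<in>UNIV. \<bar>\<theta> $ i - g $ i\<bar>) \<le> \<eta>" using G(4)[OF \<theta>] by blast
      define d where "d = (\<Sum>i\<in>UNIV. \<bar>g $ i - \<theta> $ i\<bar>)"
      have d: "0 \<le> d" "d \<le> \<eta>" using g(2) by (simp_all add: d_def sum_nonneg abs_minus_commute)
      have g\<Theta>: "g \<in> \<Theta>" using G(2) g(1) by blast
      \<comment> \<open>The diagonal contributes two terms, the kernel at 0 and the nugget; hence
        \<sigma> + 2.\<close>
      have row: "(\<Sum>j<n. \<bar>cov_entry (K g) (\<delta> g) (?x \<omega>) i j - cov_entry (K \<theta>) (\<delta> \<theta>) (?x \<omega>) i j\<bar>) \<le> L * \<eta> * (\<sigma> + 2)"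
        if i: "i < n" for i
      proof -
        have S: "neighbour_sum n (?x \<omega>) i \<le> \<sigma>" using \<omega>(1,4) i by (auto simp: E2_def not_le intro: less_imp_le)
        have "(\<Sum>j<n. \<bar>cov_entry (K g) (\<delta> g) (?x \<omega>) i j - cov_entry (K \<theta>) (\<delta> \<theta>) (?x \<omega>) i j\<bar>) =
            \<bar>(K g 0 - K \<theta> 0) + (\<delta> g - \<delta> \<theta>)\<bar> + (\<Sum>j\<in>{..<n} - {i}. \<bar>K g (X i \<omega> - X j \<omega>) - K \<theta> (X i \<omega> - X j \<omega>)\<bar>)"
          using i by (subst sum.remove[of _ i]) (auto simp: cov_entry_def algebra_simps intro!: sum.cong)
        also have "\<dots> \<le> (L * d + L * d) + (\<Sum>j\<in>{..<n} - {i}. (L * d) * decay (X i \<omega> - X j \<omega>))"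
        proof (intro add_mono sum_mono)
          have "\<bar>K g 0 - K \<theta> 0\<bar> \<le> L * decay (0 :: 'a) * d" unfolding d_def by (rule L(2)[OF \<theta> g\<Theta>])
          also have "L * decay (0 :: 'a) * d \<le> L * 1 * d"
            using L(1) d(1) decay_bounds[of "0 :: 'a"] by (intro mult_right_mono mult_left_mono) auto
          finally have "\<bar>K g 0 - K \<theta> 0\<bar> \<le> L * d" by simp
          moreover have "\<bar>\<delta> g - \<delta> \<theta>\<bar> \<le> L * d" unfolding d_def by (rule L(3)[OF \<theta> g\<Theta>])
          ultimately show "\<bar>(K g 0 - K \<theta> 0) + (\<delta> g - \<delta> \<theta>)\<bar> \<le> L * d + L * d" by linarith
          show "\<bar>K g (X i \<omega> - X j \<omega>) - K \<theta> (X i \<omega> - X j \<omega>)\<bar> \<le> (L * d) * decay (X i \<omega> - X j \<omega>)" for j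
            using L(2)[OF \<theta> g\<Theta>, of "X i \<omega> - X j \<omega>"] unfolding d_def by (simp add: mult_ac)
        qed
        also have "\<dots> = (L * d) * (neighbour_sum n (?x \<omega>) i + 2)"
          by (simp add: neighbour_sum_def sum_distrib_left[symmetric] algebra_simps)
        also have "\<dots> \<le> (L * \<eta>) * (\<sigma> + 2)"
          using L(1) d S neighbour_sum_nonneg[of n "?x \<omega>" i] by (intro mult_mono mult_left_mono) auto
        finally show ?thesis .
      qed
      have Y2: "(\<Sum>i<n. (?y \<omega> i)\<^sup>2) / real n \<le> \<tau>" using \<omega>(1,5) by (auto simp: E3_def not_le intro: less_imp_le)
      have "\<bar>W \<theta> \<omega> - W g \<omega>\<bar> \<le> (L * \<eta> * (\<sigma> + 2)) / c\<^sup>2 * ((\<Sum>i<n. (?y \<omega> i)\<^sup>2) / real n + (K0 0 + \<delta>0))"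
        unfolding W_def by (rule fluct_modulus[OF K(1)[OF \<theta>] K(1)[OF g\<Theta>] c(1) c(2)[OF \<theta>] c(2)[OF g\<Theta>] row])
      also have "\<dots> \<le> (L * \<eta> * (\<sigma> + 2)) / c\<^sup>2 * (\<tau> + (K0 0 + \<delta>0))"
        using L(1) d \<sigma> Y2 by (intro mult_left_mono add_right_mono divide_nonneg_nonneg mult_nonneg_nonneg) auto
      also have "\<dots> \<le> e / 4" using small unfolding \<eta>_def .
      finally have "\<bar>W \<theta> \<omega> - W g \<omega>\<bar> \<le> e / 4" .
      moreover have "\<bar>W g \<omega>\<bar> < e / 4" using \<omega>(1,3) g(1) by (auto simp: E1_def not_le)
      ultimately show ?thesis by linarith
    qed
    have pdm: "pos_def_on n (cov_entry (K \<theta>) (\<delta> \<theta>) (?x \<omega>))" if "\<theta> \<in> \<Theta>" for \<theta>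
      using K(1)[OF that] c(1) c(2)[OF that] by (intro pos_def_cov_entry) auto
    \<comment> \<open>The likelihood difference is nonpositive by minimality, which leaves two
      fluctuations of size at most e / 2.\<close>
    have "D \<omega> (\<theta>hat \<omega>) - e \<le> D \<omega> \<theta>" if \<theta>: "\<theta> \<in> \<Theta>" for \<theta>
      using kl_div_diff[OF n pdm[OF hat] pdm[OF \<theta>] \<omega>(2) K0_cov, of "?y \<omega>"] min[OF \<theta>] W_small[OF hat] W_small[OF \<theta>]
      unfolding D_def W_def by linarith
    moreover have "\<Theta> \<noteq> {}" using hat by auto
    ultimately have "D \<omega> (\<theta>hat \<omega>) - e \<le> (INF \<theta>\<in>\<Theta>. D \<omega> \<theta>)" by (intro cINF_greatest)
    moreover have "(INF \<theta>\<in>\<Theta>. D \<omega> \<theta>) \<le> D \<omega> (\<theta>hat \<omega>)"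
      using bdd hat unfolding D_def by (intro cINF_lower)
    ultimately show ?thesis by linarith
  qed
  have "prob {\<omega> \<in> space M. \<bar>D \<omega> (\<theta>hat \<omega>) - (INF \<theta>\<in>\<Theta>. D \<omega> \<theta>)\<bar> > e} \<le> prob (E1 \<union> E2 \<union> E3)"
  \<comment> \<open>The covering event is the one that has to be measurable, and the inclusion may
    fail on the null set where R0 is not positive definite.\<close>
  proof (rule finite_measure_mono_AE)
    show "AE \<omega> in M. \<omega> \<in> {\<omega> \<in> space M. \<bar>D \<omega> (\<theta>hat \<omega>) - (INF \<theta>\<in>\<Theta>. D \<omega> \<theta>)\<bar> > e} \<longrightarrow> \<omega> \<in> E1 \<union> E2 \<union> E3"
      using pd by eventually_elim (use good in force)
  qed (use E1 E2 m3 in auto)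
  also have "\<dots> \<le> prob E1 + prob E2 + prob E3"
    using measure_Un_le[OF E1 E2] measure_Un_le[OF sets.Un[OF E1 E2] m3] by linarith
  finally have P: "prob {\<omega> \<in> space M. \<bar>D \<omega> (\<theta>hat \<omega>) - (INF \<theta>\<in>\<Theta>. D \<omega> \<theta>)\<bar> > e} \<le> prob E1 + prob E2 + prob E3" .
  define V where "V = 2 * ((K0 0 + \<delta>0)\<^sup>2 + C\<^sup>2 * decay_const TYPE('a)) / (c\<^sup>2 * real n) / (e / 4)\<^sup>2"
  have V: "V \<ge> 0" unfolding V_def using decay_const_pos[where 'a = 'a]
    by (intro divide_nonneg_nonneg mult_nonneg_nonneg add_nonneg_nonneg) auto
  have "prob E1 \<le> (\<Sum>g\<in>G. prob {\<omega> \<in> space M. e / 4 \<le> \<bar>W g \<omega>\<bar>})"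
    unfolding E1_def using G(1) m1 by (intro finite_measure_subadditive_finite) auto
  also have "\<dots> \<le> (\<Sum>g\<in>G. V)"
  proof (rule sum_mono)
    fix g assume "g \<in> G"
    then have g: "g \<in> \<Theta>" using G(2) by auto
    show "prob {\<omega> \<in> space M. e / 4 \<le> \<bar>W g \<omega>\<bar>} \<le> V"
      unfolding W_def V_def by (rule prob_fluct_ge[OF C K(1)[OF g] K(2)[OF g] c(1) c(2)[OF g]]) (use e in simp)
  qed
  also have "\<dots> = real (card G) * V" by simp
  also have "\<dots> \<le> real ((m + 1) ^ CARD('p)) * V" using G(3) V by (intro mult_right_mono of_nat_mono)
  finally have P1: "prob E1 \<le> real ((m + 1) ^ CARD('p)) * V" .
  have "prob E2 \<le> (\<Sum>i<n. prob {\<omega> \<in> space M. \<sigma> \<le> neighbour_sum n (?x \<omega>) i})"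
    unfolding E2_def using m2 by (intro finite_measure_subadditive_finite) auto
  also have "\<dots> \<le> (\<Sum>i<n. decay_const TYPE('a) / exp \<sigma>)" by (intro sum_mono prob_neighbour_sum_ge) simp
  finally have P2: "prob E2 \<le> real n * (decay_const TYPE('a) / exp \<sigma>)" by simp
  have P3: "prob E3 \<le> (K0 0 + \<delta>0) / \<tau>" unfolding E3_def by (rule prob_sum_squares_ge[OF \<delta>0 \<tau>])
  show ?thesis using P P1 P2 P3 unfolding V_def D_def by linarith
qed

end

section \<open>The degenerate case and the choice of the grid\<close>

text \<open>Here the inverse of the zero matrix is 0 by convention, and so is the logarithm of 0.\<close>

lemma cov_zero_kl_div_const:
  assumes n: "n \<ge> 1" and K0: "\<And>t. K0 t = 0"
  shows "kl_div K \<delta> K0 0 n x \<theta> = kl_div K \<delta> K0 0 n x \<theta>'"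
proof -
  have z: "cov_entry K0 0 x i j = 0" for i j by (simp add: cov_entry_def K0)
  have "cov_matrix K0 0 n x = 0 \<cdot>\<^sub>m 1\<^sub>m n" unfolding cov_matrix_eq by (rule eq_matI) (auto simp: z)
  then have "Determinant.det (cov_matrix K0 0 n x) = 0" using n by simp
  then show ?thesis unfolding kl_div_eq det_mat_inv_cov[OF n] z by simp
qed

text \<open>The quadratic form at the points t and 0 with weights 1 and s, taken for s = 1 and s =
  -1.\<close>

lemma stationary_covariance_abs_le:
  assumes k: "stationary_covariance k"
  shows "\<bar>k t\<bar> \<le> k 0"
proof -
  have "0 \<le> 2 * k 0 + 2 * s * k t" if "s * s = 1" for s
  proof -
    have "0 \<le> (\<Sum>i\<in>{0, 1 :: nat}. \<Sum>j\<in>{0, 1 :: nat}. (if i = 0 then 1 else s) * (if j = 0 then 1 else s)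
        * k ((if i = 0 then t else 0) - (if j = 0 then t else 0)))"
      by (rule stationary_covariance_psd[OF k]) simp
    also have "\<dots> = 2 * k 0 + 2 * s * k t"
      using stationary_covariance_even[OF k, of t] that by (simp add: algebra_simps)
    finally show ?thesis .
  qed
  from this[of 1] this[of "-1"] show ?thesis by (auto simp: abs_le_iff)
qed

text \<open>The three terms are those of \<open>prob_excess_le\<close> at \<sigma> = 2 ln n and
  \<tau> = ln n: the number of grid points times Chebyshev's bound, n neighbour sums at order n^-2
  each, and Markov's bound for the mean square. A polylogarithmic m keeps the first one
  small.\<close>

lemma grid_rate:
  fixes V d \<kappa> :: real and p :: nat
  defines "m \<equiv> \<lambda>n. nat \<lceil>(ln (real n)) ^ 3\<rceil> + 1"
  shows "(\<lambda>n. real ((m n + 1) ^ p) * (V / real n) + real n * (d / exp (2 * ln (real n))) + \<kappa> / ln (real n)) \<longlonglongrightarrow> 0"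
proof -
  have 1: "(\<lambda>n. real ((m n + 1) ^ p) / real n) \<longlonglongrightarrow> 0"
  proof (rule tendsto_sandwich)
    show "\<forall>\<^sub>F n in sequentially. 0 \<le> real ((m n + 1) ^ p) / real n" by simp
    show "\<forall>\<^sub>F n in sequentially. real ((m n + 1) ^ p) / real n \<le> ((ln (real n)) ^ 3 + 3) ^ p / real n"
      using eventually_ge_at_top[of 1]
    proof eventually_elim
      case (elim n)
      have "0 \<le> (ln (real n)) ^ 3" using elim by simp
      then have "real (m n + 1) \<le> (ln (real n)) ^ 3 + 3" unfolding m_def by linarith
      then have "real (m n + 1) ^ p \<le> ((ln (real n)) ^ 3 + 3) ^ p" by (intro power_mono) auto
      then show ?case by (simp add: divide_right_mono del: of_nat_add)
    qed
    show "(\<lambda>n. ((ln (real n)) ^ 3 + 3) ^ p / real n) \<longlonglongrightarrow> 0" by real_asymp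
  qed simp
  have 2: "(\<lambda>n. real n * (d / exp (2 * ln (real n)))) \<longlonglongrightarrow> 0" by real_asymp
  have 3: "(\<lambda>n. \<kappa> / ln (real n)) \<longlonglongrightarrow> 0" by real_asymp
  have "(\<lambda>n. V * (real ((m n + 1) ^ p) / real n) + real n * (d / exp (2 * ln (real n))) + \<kappa> / ln (real n)) \<longlonglongrightarrow> V * 0 + 0 + 0"
    by (intro tendsto_intros 1 2 3)
  then show ?thesis by (simp add: mult_ac)
qed

text \<open>Row sums and mean square contribute one logarithm each, so the mesh has to beat (ln
  n)^2; this is where the cube in m comes from.\<close>

lemma grid_small:
  fixes a b \<kappa> e :: real
  defines "m \<equiv> \<lambda>n. nat \<lceil>(ln (real n)) ^ 3\<rceil> + 1"
  assumes a: "a \<ge> 0" and \<kappa>: "\<kappa> \<ge> 0" and e: "e > 0"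
  shows "\<forall>\<^sub>F n in sequentially. a / real (m n) * (2 * ln (real n) + 2) / b\<^sup>2 * (ln (real n) + \<kappa>) \<le> e"
proof -
  have "(\<lambda>n. a / (ln (real n)) ^ 3 * (2 * ln (real n) + 2) / b\<^sup>2 * (ln (real n) + \<kappa>)) \<longlonglongrightarrow> 0"
  proof -
    have "(\<lambda>n. (2 * ln (real n) + 2) * (ln (real n) + \<kappa>) / (ln (real n)) ^ 3) \<longlonglongrightarrow> 0" by real_asymp
    from tendsto_mult_right_zero[OF this, of "a / b\<^sup>2"] show ?thesis by (simp add: mult_ac)
  qed
  then have "\<forall>\<^sub>F n in sequentially. a / (ln (real n)) ^ 3 * (2 * ln (real n) + 2) / b\<^sup>2 * (ln (real n) + \<kappa>) < e"
    using e by (rule order_tendstoD)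
  then show ?thesis using eventually_ge_at_top[of 2]
  proof eventually_elim
    case (elim n)
    have ln: "ln (real n) > 0" using elim by simp
    have "(ln (real n)) ^ 3 \<le> real (m n)" unfolding m_def by linarith
    moreover have "m n > 0" by (simp add: m_def)
    ultimately have "a / real (m n) \<le> a / (ln (real n)) ^ 3"
      using a ln by (intro divide_left_mono mult_pos_pos) auto
    then have "a / real (m n) * (2 * ln (real n) + 2) / b\<^sup>2 * (ln (real n) + \<kappa>)
        \<le> a / (ln (real n)) ^ 3 * (2 * ln (real n) + 2) / b\<^sup>2 * (ln (real n) + \<kappa>)"
      using ln \<kappa> by (intro mult_right_mono divide_right_mono) auto
    then show ?case using elim(1) by linarith
  qed
qed

lemma emeasure_cube:
  fixes s :: real
  assumes "s \<ge> 0"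
  shows "emeasure lborel (cbox 0 (\<chi> j. s) :: (real^'d::finite) set) = ennreal (s ^ CARD('d))"
proof -
  have inner: "inner (\<chi> j. s :: real^'d) b = s" if "b \<in> Basis" for b
    using that by (auto simp: Basis_vec_def inner_axis)
  have "emeasure lborel (cbox 0 (\<chi> j. s) :: (real^'d) set) = ennreal (\<Prod>b\<in>(Basis :: (real^'d) set). inner ((\<chi> j. s) - 0) b)"
    using assms by (intro emeasure_lborel_cbox) (simp add: inner)
  also have "(\<Prod>b\<in>(Basis :: (real^'d) set). inner ((\<chi> j. s) - 0) b) = (\<Prod>b\<in>(Basis :: (real^'d) set). s)"
    by (intro prod.cong refl) (simp add: inner)
  also have "\<dots> = s ^ CARD('d)" by simp
  finally show ?thesis .
qed

text \<open>Stated over an arbitrary measurable space \<open>N\<close> because it is applied twice: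
  on M, for the remainder as a random variable, and on the space of data, for the remainder as a
  function of the data.\<close>

lemma borel_measurable_kl_excess:
  fixes K :: "real^'p::finite \<Rightarrow> 'a::{real_normed_vector, second_countable_topology} \<Rightarrow> real" and a b :: "real^'p"
  assumes n: "n \<ge> 1" and ne: "cbox a b \<noteq> {}"
    and K: "\<And>\<theta>. \<theta> \<in> cbox a b \<Longrightarrow> K \<theta> \<in> borel_measurable borel" and K0: "K0 \<in> borel_measurable borel"
    and cont: "\<And>x. continuous_on (cbox a b) (kl_div K \<delta> K0 \<delta>0 n x)"
    and x: "\<And>i. i < n \<Longrightarrow> (\<lambda>t. x t i) \<in> borel_measurable N" and g: "g \<in> borel_measurable N"
  shows "(\<lambda>t. kl_div K \<delta> K0 \<delta>0 n (x t) (clamp a b (g t)) - (INF \<theta>\<in>cbox a b. kl_div K \<delta> K0 \<delta>0 n (x t) \<theta>))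
    \<in> borel_measurable N"
proof (rule borel_measurable_diff)
  have kl: "(\<lambda>t. kl_div K \<delta> K0 \<delta>0 n (x t) \<theta>) \<in> borel_measurable N" if "\<theta> \<in> cbox a b" for \<theta>
    using n K[OF that] K0 x by (rule borel_measurable_kl_div)
  show "(\<lambda>t. kl_div K \<delta> K0 \<delta>0 n (x t) (clamp a b (g t))) \<in> borel_measurable N"
    by (rule borel_measurable_caratheodory[where f = "\<lambda>t. kl_div K \<delta> K0 \<delta>0 n (x t)", OF kl cont g ne])
  show "(\<lambda>t. INF \<theta>\<in>cbox a b. kl_div K \<delta> K0 \<delta>0 n (x t) \<theta>) \<in> borel_measurable N"
    by (rule borel_measurable_INF_continuous[where f = "\<lambda>t. kl_div K \<delta> K0 \<delta>0 n (x t)", OF kl cont compact_cbox ne])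
qed

theorem theorem3p3:
  fixes M :: "'w measure"
    and Y :: "real^'d::finite \<Rightarrow> 'w \<Rightarrow> real"
    and X :: "nat \<Rightarrow> nat \<Rightarrow> 'w \<Rightarrow> real^'d"
    and \<epsilon> :: "nat \<Rightarrow> nat \<Rightarrow> 'w \<Rightarrow> real"
    and K0 :: "real^'d \<Rightarrow> real" and \<delta>0 :: real
    and K :: "real^'p::finite \<Rightarrow> real^'d \<Rightarrow> real" and \<delta> :: "real^'p \<Rightarrow> real"
    and \<theta>inf \<theta>sup :: real and \<Theta> :: "(real^'p) set"
    and \<theta>hat :: "nat \<Rightarrow> 'w \<Rightarrow> real^'p"
  assumes Theta_nontrivial: "\<theta>inf < \<theta>sup"
    and Theta: "\<Theta> = cbox (\<chi> i. \<theta>inf) (\<chi> i. \<theta>sup)"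
    and prob: "prob_space M"
    and Y_gaussian: "centered_gaussian_family M UNIV Y (\<lambda>s t. K0 (s - t))"
    and Y_measurable: "measurable_process M Y"
    and delta0: "\<delta>0 \<ge> 0"
    and eps_gaussian: "\<And>n. n \<ge> 1 \<Longrightarrow>
           centered_gaussian_family M {..<n} (\<epsilon> n) (\<lambda>i j. if i = j then \<delta>0 else 0)"
    and X_indep: "\<And>n. n \<ge> 1 \<Longrightarrow> prob_space.indep_vars M (\<lambda>_. borel) (X n) {..<n}"
    and X_uniform: "\<And>n i. n \<ge> 1 \<Longrightarrow> i < n \<Longrightarrow>
           distr M lborel (X n i) =
           uniform_measure lborel (cbox 0 (\<chi> j. real n powr (1 / real CARD('d))))"
    and independent: "\<And>n. n \<ge> 1 \<Longrightarrow>
           mutually_independent3 M (family_algebra M UNIV Y)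
             (family_algebra M {..<n} (X n)) (family_algebra M {..<n} (\<epsilon> n))"
    and K0_cov: "stationary_covariance K0"
    and K0_cont: "continuous_on UNIV K0"
    and K0_bound: "\<exists>C0. \<forall>t. \<bar>K0 t\<bar> \<le> C0 / (1 + infnorm t ^ (CARD('d) + 1))"
    and K_cov: "\<And>\<theta>. \<theta> \<in> \<Theta> \<Longrightarrow> stationary_covariance (K \<theta>)"
    and K_measurable: "\<And>\<theta>. \<theta> \<in> \<Theta> \<Longrightarrow> K \<theta> \<in> borel_measurable borel"
    and K_smooth: "\<And>t. cont_diff_on (CARD('p) + 1) \<Theta> (\<lambda>\<theta>. K \<theta> t)"
    and K_bound: "\<And>\<alpha>::'p \<Rightarrow> nat. (\<Sum>i\<in>UNIV. \<alpha> i) \<le> CARD('p) + 1 \<Longrightarrow>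
           \<exists>A. \<forall>js. multi_index_list \<alpha> js \<longrightarrow>
             (\<forall>t. \<forall>\<theta>\<in>\<Theta>. \<bar>partials_on \<Theta> js (\<lambda>\<theta>'. K \<theta>' t) \<theta>\<bar>
                           \<le> A / (1 + infnorm t ^ (CARD('d) + 1)))"
    and delta_lower: "\<exists>Cinf>0. \<forall>\<theta>\<in>\<Theta>. \<delta> \<theta> \<ge> Cinf"
    and delta_smooth: "cont_diff_on (CARD('p) + 1) \<Theta> \<delta>"
    and delta_bound: "\<And>\<alpha>::'p \<Rightarrow> nat. (\<Sum>i\<in>UNIV. \<alpha> i) \<le> CARD('p) + 1 \<Longrightarrow>
           \<exists>B. \<forall>js. multi_index_list \<alpha> js \<longrightarrow> (\<forall>\<theta>\<in>\<Theta>. \<bar>partials_on \<Theta> js \<delta> \<theta>\<bar> \<le> B)"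
    and hat_measurable: "\<And>n. n \<ge> 1 \<Longrightarrow> \<theta>hat n \<in> borel_measurable M"
    and hat_argmin: "\<And>n \<omega>. n \<ge> 1 \<Longrightarrow> \<omega> \<in> space M \<Longrightarrow>
           is_arg_min
             (neg_log_lik K \<delta> n (\<lambda>i. X n i \<omega>) (\<lambda>i. obs_value Y (X n) (\<epsilon> n) i \<omega>))
             (\<lambda>\<theta>. \<theta> \<in> \<Theta>) (\<theta>hat n \<omega>)"
  shows "\<exists>r :: nat \<Rightarrow> 'w \<Rightarrow> real.
           (\<forall>n\<ge>1. \<forall>\<omega>\<in>space M.
              kl_div K \<delta> K0 \<delta>0 n (\<lambda>i. X n i \<omega>) (\<theta>hat n \<omega>) =
              (INF \<theta>\<in>\<Theta>. kl_div K \<delta> K0 \<delta>0 n (\<lambda>i. X n i \<omega>) \<theta>) + r n \<omega>) \<and>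
           (\<forall>n\<ge>1. function_of_data M n (X n) (obs_value Y (X n) (\<epsilon> n)) (\<theta>hat n) \<longrightarrow>
              function_of_data M n (X n) (obs_value Y (X n) (\<epsilon> n)) (r n)) \<and>
           tendsto_zero_in_prob M r"
proof -
  interpret prob_space M by (rule prob)
  let ?lo = "(\<chi> i. \<theta>inf) :: real^'p" and ?hi = "(\<chi> i. \<theta>sup) :: real^'p"
  have ne: "\<Theta> \<noteq> {}"
    using Theta_nontrivial unfolding Theta by (simp add: interval_ne_empty_cart less_imp_le)
  have dec: "decay t = 1 / (1 + infnorm t ^ (CARD('d) + 1))" for t :: "real^'d" by (simp add: decay_def)
  have dec0: "0 \<le> decay t" for t :: "real^'d" using decay_bounds(1)[of t] by simp
  obtain C where "\<forall>t. \<bar>K0 t\<bar> \<le> C / (1 + infnorm t ^ (CARD('d) + 1))" using K0_bound by (elim exE)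
  then have C: "\<bar>K0 t\<bar> \<le> C * decay t" for t by (simp add: dec)
  obtain c where "c > 0" "\<forall>\<theta>\<in>\<Theta>. c \<le> \<delta> \<theta>" using delta_lower by (elim exE conjE)
  then have c: "c > 0" "\<And>\<theta>. \<theta> \<in> \<Theta> \<Longrightarrow> c \<le> \<delta> \<theta>" by simp_all
  have K0_meas: "K0 \<in> borel_measurable borel" using K0_cont by (rule borel_measurable_continuous_onI)
  have K_cont: "continuous_on \<Theta> (\<lambda>\<theta>. K \<theta> t)" for t using K_smooth[of t] by simp
  have \<delta>_cont: "continuous_on \<Theta> \<delta>" using delta_smooth by simp
  have pd: "pos_def_on n (cov_entry (K \<theta>) (\<delta> \<theta>) x)" if "\<theta> \<in> \<Theta>" for n x \<theta>
    using K_cov[OF that] c(1) c(2)[OF that] by (intro pos_def_cov_entry) auto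
  have kl_cont: "continuous_on \<Theta> (kl_div K \<delta> K0 \<delta>0 n x)" if "n \<ge> 1" for n x
    using that by (intro continuous_on_kl_div K_cont \<delta>_cont pd)
  have bdd: "bdd_below (kl_div K \<delta> K0 \<delta>0 n x ` \<Theta>)" if "n \<ge> 1" for n x
    using compact_continuous_image[OF kl_cont[OF that]] unfolding Theta
    by (intro bounded_imp_bdd_below compact_imp_bounded) auto
  obtain L1 where L1: "0 \<le> L1" "\<And>t x y. x \<in> \<Theta> \<Longrightarrow> y \<in> \<Theta> \<Longrightarrow>
      \<bar>K y t - K x t\<bar> \<le> L1 * decay t * (\<Sum>i\<in>UNIV. \<bar>y $ i - x $ i\<bar>)"
  proof (rule lipschitz_of_first_partials[where f = "\<lambda>t \<theta>. K \<theta> t" and w = decay and m = "CARD('p)" and a = ?lo and b = ?hi])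
    show "cont_diff_on (Suc CARD('p)) (cbox ?lo ?hi) (\<lambda>\<theta>. K \<theta> t)" for t
      using K_smooth[of t] by (simp add: Theta)
    show "\<exists>A. \<forall>js. multi_index_list \<alpha> js \<longrightarrow> (\<forall>t. \<forall>\<theta>\<in>cbox ?lo ?hi.
        \<bar>partials_on (cbox ?lo ?hi) js (\<lambda>\<theta>. K \<theta> t) \<theta>\<bar> \<le> A * decay t)"
      if "(\<Sum>i\<in>UNIV. \<alpha> i) \<le> Suc CARD('p)" for \<alpha>
      using K_bound[of \<alpha>] that by (simp add: Theta dec)
  qed (use dec0 Theta in blast)+
  obtain L2 where L2: "0 \<le> L2" "\<And>x y. x \<in> \<Theta> \<Longrightarrow> y \<in> \<Theta> \<Longrightarrow>
      \<bar>\<delta> y - \<delta> x\<bar> \<le> L2 * (\<Sum>i\<in>UNIV. \<bar>y $ i - x $ i\<bar>)"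
  proof (rule lipschitz_of_first_partials[where f = "\<lambda>_ :: unit. \<delta>" and w = "\<lambda>_. 1" and m = "CARD('p)" and a = ?lo and b = ?hi])
    show "cont_diff_on (Suc CARD('p)) (cbox ?lo ?hi) \<delta>"
      using delta_smooth by (simp add: Theta)
    show "\<exists>A. \<forall>js. multi_index_list \<alpha> js \<longrightarrow> (\<forall>t :: unit. \<forall>\<theta>\<in>cbox ?lo ?hi.
        \<bar>partials_on (cbox ?lo ?hi) js \<delta> \<theta>\<bar> \<le> A * 1)"
      if "(\<Sum>i\<in>UNIV. \<alpha> i) \<le> Suc CARD('p)" for \<alpha>
      using delta_bound[of \<alpha>] that by (simp add: Theta)
  qed (use Theta in auto)
  define L where "L = L1 + L2"
  have L: "0 \<le> L" using L1(1) L2(1) by (simp add: L_def)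
  have L_K: "\<bar>K y t - K x t\<bar> \<le> L * decay t * (\<Sum>i\<in>UNIV. \<bar>y $ i - x $ i\<bar>)" if "x \<in> \<Theta>" "y \<in> \<Theta>" for t x y
    by (rule order_trans[OF L1(2)[OF that]], intro mult_right_mono)
       (use L2(1) dec0 in \<open>auto simp: L_def intro!: sum_nonneg\<close>)
  have L_\<delta>: "\<bar>\<delta> y - \<delta> x\<bar> \<le> L * (\<Sum>i\<in>UNIV. \<bar>y $ i - x $ i\<bar>)" if "x \<in> \<Theta>" "y \<in> \<Theta>" for x y
    by (rule order_trans[OF L2(2)[OF that]], intro mult_right_mono)
       (use L1(1) in \<open>auto simp: L_def intro!: sum_nonneg\<close>)
  have K0_0: "0 \<le> K0 0" using stationary_covariance_abs_le[OF K0_cov, of 0] by simp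
  define \<kappa> where "\<kappa> = K0 0 + \<delta>0"
  have \<kappa>: "0 \<le> \<kappa>" using K0_0 delta0 by (simp add: \<kappa>_def)
  define D where "D n \<omega> = kl_div K \<delta> K0 \<delta>0 n (\<lambda>i. X n i \<omega>)" for n \<omega>
  \<comment> \<open>The remainder is the excess itself, which settles the equation; measurability,
    dependence on the data and the limit are what is left.\<close>
  define r where "r n \<omega> = D n \<omega> (\<theta>hat n \<omega>) - (INF \<theta>\<in>\<Theta>. D n \<omega> \<theta>)" for n \<omega>
  have hat: "\<theta>hat n \<omega> \<in> \<Theta>" if "n \<ge> 1" "\<omega> \<in> space M" for n \<omega>
    using hat_argmin[OF that] by (simp add: is_arg_min_def)
  have clamp_hat: "clamp ?lo ?hi (\<theta>hat n \<omega>) = \<theta>hat n \<omega>" if "n \<ge> 1" "\<omega> \<in> space M" for n \<omega>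
    using hat[OF that] unfolding Theta by (rule clamp_cancel_cbox)
  have X_meas: "X n i \<in> borel_measurable M" if "n \<ge> 1" "i < n" for n i
    using X_indep[OF that(1)] that(2) by (auto simp: indep_vars_def2)
  note excess = borel_measurable_kl_excess[OF _ ne[unfolded Theta] K_measurable[unfolded Theta] K0_meas kl_cont[unfolded Theta]]
  have r_meas: "r n \<in> borel_measurable M" if n: "n \<ge> 1" for n
  proof -
    have "(\<lambda>\<omega>. kl_div K \<delta> K0 \<delta>0 n (\<lambda>i. X n i \<omega>) (clamp ?lo ?hi (\<theta>hat n \<omega>))
        - (INF \<theta>\<in>cbox ?lo ?hi. kl_div K \<delta> K0 \<delta>0 n (\<lambda>i. X n i \<omega>) \<theta>)) \<in> borel_measurable M"
      by (rule excess[where x = "\<lambda>\<omega> i. X n i \<omega>", OF n _ _ X_meas[OF n] hat_measurable[OF n]])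
        (assumption, rule n)
    then show ?thesis
      by (rule measurable_cong[THEN iffD1, rotated]) (simp add: r_def D_def clamp_hat[OF n] Theta)
  qed
  have r_data: "function_of_data M n (X n) (obs_value Y (X n) (\<epsilon> n)) (r n)"
    if n: "n \<ge> 1" and data: "function_of_data M n (X n) (obs_value Y (X n) (\<epsilon> n)) (\<theta>hat n)" for n
  proof -
    let ?P = "(\<Pi>\<^sub>M i\<in>{..<n}. (borel :: (real^'d) measure)) \<Otimes>\<^sub>M (\<Pi>\<^sub>M i\<in>{..<n}. (borel :: real measure))"
    let ?data = "\<lambda>\<omega>. (\<lambda>i\<in>{..<n}. X n i \<omega>, \<lambda>i\<in>{..<n}. obs_value Y (X n) (\<epsilon> n) i \<omega>)"
    obtain g where g: "g \<in> borel_measurable ?P" "\<And>\<omega>. \<omega> \<in> space M \<Longrightarrow> \<theta>hat n \<omega> = g (?data \<omega>)"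
      using data unfolding function_of_data_def by (elim bexE) simp
    \<comment> \<open>Off the range of the data \<open>g\<close> may leave \<Theta>;
      \<open>clamp\<close> keeps the formula measurable on the whole data space.\<close>
    let ?h = "\<lambda>p. kl_div K \<delta> K0 \<delta>0 n (fst p) (clamp ?lo ?hi (g p))
        - (INF \<theta>\<in>cbox ?lo ?hi. kl_div K \<delta> K0 \<delta>0 n (fst p) \<theta>)"
    have "?h \<in> borel_measurable ?P"
    proof (rule excess[where x = fst, OF n _ n _ g(1)])
      show "(\<lambda>p. fst p i) \<in> borel_measurable ?P" if "i < n" for i
        using that by (intro measurable_compose[OF measurable_fst measurable_component_singleton]) auto
    qed
    moreover have "r n \<omega> = ?h (?data \<omega>)" if \<omega>: "\<omega> \<in> space M" for \<omega>
    proof -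
      have "kl_div K \<delta> K0 \<delta>0 n (\<lambda>i\<in>{..<n}. X n i \<omega>) = D n \<omega>"
        unfolding D_def by (intro ext kl_div_cong) simp
      then show ?thesis using clamp_hat[OF n \<omega>] g(2)[OF \<omega>] by (simp add: r_def Theta)
    qed
    ultimately show ?thesis unfolding function_of_data_def by (intro bexI[of _ ?h] ballI)
  qed
  have lim: "(\<lambda>n. prob {\<omega> \<in> space M. \<bar>r n \<omega>\<bar> > e}) \<longlonglongrightarrow> 0" if e: "e > 0" for e
  \<comment> \<open>\<kappa> is the variance of one observation; it vanishes only if
    \<open>K0 0\<close> and \<open>\<delta>0\<close> both do.\<close>
  proof (cases "\<kappa> = 0")
    case True
    then have z: "K0 0 = 0" "\<delta>0 = 0" using K0_0 delta0 by (auto simp: \<kappa>_def)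
    have K0z: "K0 t = 0" for t using stationary_covariance_abs_le[OF K0_cov, of t] z by simp
    have "{\<omega> \<in> space M. \<bar>r n \<omega>\<bar> > e} = {}" if n: "n \<ge> 1" for n
    proof -
      have "r n \<omega> = 0" for \<omega>
      proof -
        have "D n \<omega> \<theta> = D n \<omega> (\<theta>hat n \<omega>)" for \<theta>
          unfolding D_def z(2) by (rule cov_zero_kl_div_const[OF n K0z])
        then have "(INF \<theta>\<in>\<Theta>. D n \<omega> \<theta>) = (INF \<theta>\<in>\<Theta>. D n \<omega> (\<theta>hat n \<omega>))"
          by (intro arg_cong[where f = Inf] image_cong refl)
        also have "\<dots> = D n \<omega> (\<theta>hat n \<omega>)" using ne by simp
        finally show ?thesis by (simp add: r_def)
      qed
      then show ?thesis using e by simp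
    qed
    then have "\<forall>\<^sub>F n in sequentially. prob {\<omega> \<in> space M. \<bar>r n \<omega>\<bar> > e} = 0"
      by (intro eventually_mono[OF eventually_ge_at_top[of 1]]) (simp only: measure_empty)
    then show ?thesis by (rule tendsto_eventually)
  next
    case False
    have C0: "0 \<le> C" using order_trans[OF abs_ge_zero C[of 0]] decay_bounds(1)[of "0 :: real^'d"]
      by (simp add: zero_le_mult_iff)
    have K0_bounded: "\<bar>K0 t\<bar> \<le> K0 0" for t by (rule stationary_covariance_abs_le[OF K0_cov])
    have K0_int: "integrable lborel K0"
    proof (rule Bochner_Integration.integrable_bound)
      show "integrable lborel (\<lambda>t :: real^'d. C * decay t)" by (intro integrable_mult_right integrable_decay)
      show "AE t in lborel. norm (K0 t) \<le> norm (C * decay t)"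
      proof (rule AE_I2)
        show "norm (K0 t) \<le> norm (C * decay t)" for t
          using C[of t] C0 dec0[of t] by simp
      qed
    qed (use K0_meas in simp)
    define m where "m n = nat \<lceil>(ln (real n)) ^ 3\<rceil> + 1" for n
    define V where "V = 2 * (\<kappa>\<^sup>2 + C\<^sup>2 * decay_const TYPE(real^'d)) / c\<^sup>2 / (e / 4)\<^sup>2"
    define U where "U n = real ((m n + 1) ^ CARD('p)) * (V / real n)
        + real n * (decay_const TYPE(real^'d) / exp (2 * ln (real n))) + \<kappa> / ln (real n)" for n
    have U: "U \<longlonglongrightarrow> 0" unfolding U_def[abs_def] m_def by (rule grid_rate)
    have small: "\<forall>\<^sub>F n in sequentially. L * (real CARD('p) * (\<theta>sup - \<theta>inf)) / real (m n)
        * (2 * ln (real n) + 2) / c\<^sup>2 * (ln (real n) + \<kappa>) \<le> e / 4"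
      unfolding m_def using L Theta_nontrivial \<kappa> e by (intro grid_small) auto
    have "\<forall>\<^sub>F n in sequentially. prob {\<omega> \<in> space M. \<bar>r n \<omega>\<bar> > e} \<le> U n"
      \<comment> \<open>From n = 2 on, ln n is positive, as required of \<tau>.\<close>
      using small eventually_ge_at_top[of 2]
    proof eventually_elim
      case (elim n)
      then have n: "n \<ge> 1" by simp
      let ?A = "cbox 0 (\<chi> j. real n powr (1 / real CARD('d))) :: (real^'d) set"
      interpret S: spatial_sample M Y "X n" "\<epsilon> n" K0 \<delta>0 n ?A
      proof (intro spatial_sample.intro spatial_sample_axioms.intro)
        show "prob_space M" by (rule prob)
        show "centered_gaussian_family M UNIV Y (\<lambda>s t. K0 (s - t))" by (rule Y_gaussian)
        show "measurable_process M Y" by (rule Y_measurable)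
        show "centered_gaussian_family M {..<n} (\<epsilon> n) (\<lambda>i j. if i = j then \<delta>0 else 0)" by (rule eps_gaussian[OF n])
        show "indep_vars (\<lambda>_. borel) (X n) {..<n}" by (rule X_indep[OF n])
        show "mutually_independent3 M (family_algebra M UNIV Y) (family_algebra M {..<n} (X n))
            (family_algebra M {..<n} (\<epsilon> n))" by (rule independent[OF n])
        \<comment> \<open>\<open>lborel\<close> and \<open>borel\<close> have the same measurable
          sets, so the target of \<open>distr\<close> may be changed.\<close>
        show "distr M borel (X n i) = uniform_measure lborel ?A" if "i < n" for i
          unfolding X_uniform[OF n that, symmetric] by (rule distr_cong) auto
        have "(real n powr (1 / real CARD('d))) ^ CARD('d) = real n"
          using n by (simp add: powr_realpow[symmetric] powr_powr)
        then show "emeasure lborel ?A = ennreal (real n)" by (simp add: emeasure_cube)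
        show "?A \<in> sets borel" by simp
      qed (rule n K0_cov K0_meas)+
      have AE_pd: "AE \<omega> in M. pos_def_on n (cov_entry K0 \<delta>0 (\<lambda>i. X n i \<omega>))"
      \<comment> \<open>Without a nugget the points have to be distinct, which holds almost surely;
        with a nugget every design will do.\<close>
      proof (cases "\<delta>0 = 0")
        case True
        then have "K0 0 \<noteq> 0" using False by (simp add: \<kappa>_def)
        then show ?thesis using S.AE_inj unfolding True
          by (auto elim!: eventually_mono intro!: pos_def_cov_entry_distinct[OF K0_cov K0_cont K0_int K0_bounded])
      next
        case False
        then show ?thesis using delta0 by (intro AE_I2 pos_def_cov_entry K0_cov) simp
      qed
      have "prob {\<omega> \<in> space M. \<bar>r n \<omega>\<bar> > e} \<le>
          real ((m n + 1) ^ CARD('p)) * (2 * ((K0 0 + \<delta>0)\<^sup>2 + C\<^sup>2 * decay_const TYPE(real^'d)) / (c\<^sup>2 * real n) / (e / 4)\<^sup>2)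
          + real n * (decay_const TYPE(real^'d) / exp (2 * ln (real n))) + (K0 0 + \<delta>0) / ln (real n)"
        unfolding r_def D_def Theta
      proof (rule S.prob_excess_le[OF C delta0 Theta_nontrivial K_cov[unfolded Theta] K_measurable[unfolded Theta]
            c(1) c(2)[unfolded Theta] L L_K[unfolded Theta] L_\<delta>[unfolded Theta] AE_pd bdd[OF n, unfolded Theta]
            hat_argmin[OF n, unfolded Theta] e])
        show "m n \<ge> 1" by (simp add: m_def)
        show "ln (real n) > 0" "2 * ln (real n) \<ge> 0" using elim(2) by simp_all
        show "L * (real CARD('p) * (\<theta>sup - \<theta>inf) / real (m n)) * (2 * ln (real n) + 2) / c\<^sup>2 * (ln (real n) + (K0 0 + \<delta>0)) \<le> e / 4"
          using elim(1) by (simp add: \<kappa>_def)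
      qed
      also have "2 * ((K0 0 + \<delta>0)\<^sup>2 + C\<^sup>2 * decay_const TYPE(real^'d)) / (c\<^sup>2 * real n) / (e / 4)\<^sup>2 = V / real n"
        by (simp add: V_def \<kappa>_def)
      finally show ?case by (simp only: U_def \<kappa>_def)
    qed
    then show ?thesis
      by (intro tendsto_sandwich[OF _ _ tendsto_const U]) auto
  qed
  show ?thesis
  proof (intro exI[of _ r] conjI allI ballI impI)
    show "tendsto_zero_in_prob M r"
      unfolding tendsto_zero_in_prob_def by (intro conjI allI impI r_meas lim)
  qed (simp add: r_def D_def, rule r_data)
qed

end
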